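(* Suppose that problem $(GLQ)_T$ satisfies the measure turnpike property or the exponential turnpike property at some steady state $(x_e,u_e)$. Then the following statements hold: (a) $\mathcal T$ is exponentially stable on the unobservable subspace $U^\infty$, i.e. the restriction of $\mathcal T$ to $U^\infty$ is an exponentially stable semigroup. (b) $(x_e,u_e)$ is the unique optimal steady state, i.e. the unique minimizer of $\ell(x,u)$ over all $(x,u)\in D(A)\times\mathcal U$ with $Ax+Bu=0$. (c) The pair $(A,B)$ is exponentially stabilizable.
   Context: Setting. $\mathcal H,\mathcal U,\mathcal Y$ are complex Hilbert spaces. $A:D(A)\to\mathcal H$ generates a strongly continuous semigroup $\mathcal T=(\mathcal T_t)_{t\ge0}$ on $\mathcal H$; $B\in\mathcal L(\mathcal U,\mathcal H)$, $C\in\mathcal L(\mathcal H,\mathcal Y)$, $K\in\mathcal L(\mathcal U)$, $z\in\mathcal H$, $v\in\mathcal U$. $K$ is coercive: there is $m>0$ with $\langle K^*Ku,u\rangle\ge m\|u\|^2$ for all $u\in\mathcal U$. The running cost is $$\ell(x,u)=\|Cx\|^2+\|Ku\|^2+2\operatorname{Re}\langle z,x\rangle+2\operatorname{Re}\langle v,u\rangle .$$ Problem $(GLQ)_T$: for horizon $T>0$ and initial state $x_0\in\mathcal H$, minimize $J_T(x_0,u)=\int_0^T\ell(x(t),u(t))\,dt$ over $u\in L^2(0,T;\mathcal U)$, where $x$ is the mild solution of $\dot x=Ax+Bu$, $x(0)=x_0$. The optimal pair exists and is unique; it is denoted $(x_T^*(\cdot,x_0),u_T^*(\cdot,x_0))$.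 Steady state: a pair $(x_e,u_e)\in D(A)\times\mathcal U$ with $Ax_e+Bu_e=0$. Measure turnpike property at a steady state $(x_e,u_e)$: for every bounded neighborhood $\mathcal N$ of $x_e$ in $\mathcal H$ and every $\varepsilon>0$ there is $M_{\mathcal N,\varepsilon}>0$ such that for all $x_0\in\mathcal N$ and all $T>0$, $\mu\{t\in[0,T]:\|x_T^*(t,x_0)-x_e\|+\|u_T^*(t,x_0)-u_e\|>\varepsilon\}\le M_{\mathcal N,\varepsilon}$, with $\mu$ the Lebesgue measure. Exponential turnpike property at $(x_e,u_e)$: for every bounded neighborhood $\mathcal N$ of $x_e$ there are positive constants $M_{\mathcal N},k$ such that for all $x_0\in\mathcal N$ and all $T>0$, $\|x_T^*(t,x_0)-x_e\|+\|u_T^*(t,x_0)-u_e\|\le M_{\mathcal N}(e^{-kt}+e^{-k(T-t)})$ for all $t\in[0,T]$. Unobservable subspace: $U^\infty=\{x\in\mathcal H: C\mathcal T_tx=0\text{ for all }t\ge0\}$, a closed $\mathcal T$-invariant subspace. $(A,B)$ is exponentially stabilizable if there is $F\in\mathcal L(\mathcal H,\mathcal U)$ such that $A+BF$ generates an exponentially stable semigroup. *)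

theory Defs
  imports "HOL-Analysis.Analysis"
begin

text \<open>
  Complex Hilbert spaces. The class extends the real inner product spaces of HOL-Analysis, whose
  norm and topology it keeps; the real inner product is the real part of the complex one.
  The complex inner product is linear in its first argument; the statement is insensitive to this
  choice, because it only uses real parts and the adjoint relation.
\<close>

class complex_inner = real_inner +
  fixes scaleC :: "complex \<Rightarrow> 'a \<Rightarrow> 'a"
    and cinner :: "'a \<Rightarrow> 'a \<Rightarrow> complex"
  assumes scaleC_add_right: "scaleC a (x + y) = scaleC a x + scaleC a y"
    and scaleC_add_left: "scaleC (a + b) x = scaleC a x + scaleC b x"
    and scaleC_scaleC: "scaleC a (scaleC b x) = scaleC (a * b) x"
    and scaleC_of_real: "scaleC (complex_of_real r) x = r *\<^sub>R x"
    and cinner_commute: "cinner x y = cnj (cinner y x)"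
    and cinner_add_left: "cinner (x + y) w = cinner x w + cinner y w"
    and cinner_scaleC_left: "cinner (scaleC a x) y = a * cinner x y"
    and Re_cinner: "Re (cinner x y) = x \<bullet> y"

class chilbert_space = complex_inner + complete_space
begin
subclass banach ..
end

instantiation complex :: chilbert_space
begin
definition "scaleC (a::complex) (x::complex) = a * x"
definition "cinner (x::complex) (y::complex) = x * cnj y"
instance
  by standard (auto simp: scaleC_complex_def cinner_complex_def inner_complex_def
      algebra_simps scaleR_conv_of_real)
end

definition bounded_clinear :: "('a::complex_inner \<Rightarrow> 'b::complex_inner) \<Rightarrow> bool" where
  "bounded_clinear f \<longleftrightarrow> bounded_linear f \<and> (\<forall>a x. f (scaleC a x) = scaleC a (f x))"

text \<open>On a Hilbert space the adjoint of a bounded operator exists and is unique.\<close>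

definition is_cadjoint ::
  "('a::complex_inner \<Rightarrow> 'b::complex_inner) \<Rightarrow> ('b \<Rightarrow> 'a) \<Rightarrow> bool" where
  "is_cadjoint f g \<longleftrightarrow> (\<forall>x y. cinner (f x) y = cinner x (g y))"

definition coercive_op :: "('u::complex_inner \<Rightarrow> 'u) \<Rightarrow> bool" where
  "coercive_op K \<longleftrightarrow>
     (\<exists>Kadj. is_cadjoint K Kadj \<and>
        (\<exists>m>0. \<forall>u. Re (cinner (Kadj (K u)) u) \<ge> m * (norm u)\<^sup>2))"


text \<open>A semigroup is a family indexed by all reals of which only the part \<open>t \<ge> 0\<close> matters.\<close>

definition c0_semigroup :: "(real \<Rightarrow> 'h::complex_inner \<Rightarrow> 'h) \<Rightarrow> bool" where
  "c0_semigroup S \<longleftrightarrow>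
     (\<forall>t\<ge>0. bounded_clinear (S t)) \<and>
     (\<forall>x. S 0 x = x) \<and>
     (\<forall>s\<ge>0. \<forall>t\<ge>0. \<forall>x. S (s + t) x = S s (S t x)) \<and>
     (\<forall>x. ((\<lambda>t. S t x) \<longlongrightarrow> x) (at_right 0))"

definition generates ::
  "'h::complex_inner set \<Rightarrow> ('h \<Rightarrow> 'h) \<Rightarrow> (real \<Rightarrow> 'h \<Rightarrow> 'h) \<Rightarrow> bool" where
  "generates DA A S \<longleftrightarrow>
     c0_semigroup S \<and>
     DA = {x. \<exists>y. ((\<lambda>h. (S h x - x) /\<^sub>R h) \<longlongrightarrow> y) (at_right 0)} \<and>
     (\<forall>x\<in>DA. ((\<lambda>h. (S h x - x) /\<^sub>R h) \<longlongrightarrow> A x) (at_right 0))"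

definition exp_stable_on :: "'h::complex_inner set \<Rightarrow> (real \<Rightarrow> 'h \<Rightarrow> 'h) \<Rightarrow> bool" where
  "exp_stable_on V S \<longleftrightarrow>
     (\<forall>t\<ge>0. \<forall>x\<in>V. S t x \<in> V) \<and>
     (\<exists>M>0. \<exists>\<omega>>0. \<forall>t\<ge>0. \<forall>x\<in>V. norm (S t x) \<le> M * exp (- \<omega> * t) * norm x)"

definition exp_stabilizable ::
  "'h::complex_inner set \<Rightarrow> ('h \<Rightarrow> 'h) \<Rightarrow> ('u::complex_inner \<Rightarrow> 'h) \<Rightarrow> bool" where
  "exp_stabilizable DA A B \<longleftrightarrow>
     (\<exists>F S. bounded_clinear F \<and> generates DA (\<lambda>x. A x + B (F x)) S \<and> exp_stable_on UNIV S)"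

definition unobservable_subspace ::
  "(real \<Rightarrow> 'h::complex_inner \<Rightarrow> 'h) \<Rightarrow> ('h \<Rightarrow> 'y::complex_inner) \<Rightarrow> 'h set" where
  "unobservable_subspace S C = {x. \<forall>t\<ge>0. C (S t x) = 0}"

definition steady_states ::
  "'h::complex_inner set \<Rightarrow> ('h \<Rightarrow> 'h) \<Rightarrow> ('u::complex_inner \<Rightarrow> 'h) \<Rightarrow> ('h \<times> 'u) set" where
  "steady_states DA A B = {(x, u). x \<in> DA \<and> A x + B u = 0}"


text \<open>
  \<open>L\<^sup>2(0,T;U)\<close> in the sense of Bochner, as a set of functions rather than of equivalence classes.
  The spaces need not be separable, so that the Bochner integral of HOL-Analysis, which is confined
  to second countable spaces, is not available; neither is Borel measurability enough.
\<close>

definition strongly_measurable :: "real measure \<Rightarrow> (real \<Rightarrow> 'u::real_normed_vector) \<Rightarrow> bool" where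
  "strongly_measurable M u \<longleftrightarrow>
     (\<exists>s. (\<forall>i::nat. simple_function M (s i)) \<and> (AE t in M. (\<lambda>i. s i t) \<longlonglongrightarrow> u t))"

definition L2_controls :: "real \<Rightarrow> (real \<Rightarrow> 'u::real_normed_vector) set" where
  "L2_controls T =
     {u. strongly_measurable (lebesgue_on {0..T}) u \<and>
         integrable (lebesgue_on {0..T}) (\<lambda>t. (norm (u t))\<^sup>2)}"

text \<open>
  Variation of constants formula. The integral is the Banach space valued Henstock--Kurzweil
  integral, which extends the Bochner integral; for \<open>u\<close> in \<open>L\<^sup>2(0,T;U)\<close> and \<open>0 \<le> t \<le> T\<close> the
  integrand is Bochner integrable.
\<close>

definition mild_solution ::
  "(real \<Rightarrow> 'h::chilbert_space \<Rightarrow> 'h) \<Rightarrow> ('u \<Rightarrow> 'h) \<Rightarrow> 'h \<Rightarrow> (real \<Rightarrow> 'u) \<Rightarrow> real \<Rightarrow> 'h" where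
  "mild_solution S B x0 u t = S t x0 + integral {0..t} (\<lambda>s. S (t - s) (B (u s)))"

definition running_cost ::
  "('h::complex_inner \<Rightarrow> 'y::complex_inner) \<Rightarrow> ('u::complex_inner \<Rightarrow> 'u) \<Rightarrow> 'h \<Rightarrow> 'u
     \<Rightarrow> 'h \<Rightarrow> 'u \<Rightarrow> real" where
  "running_cost C K z v x u =
     (norm (C x))\<^sup>2 + (norm (K u))\<^sup>2 + 2 * Re (cinner z x) + 2 * Re (cinner v u)"

definition total_cost ::
  "(real \<Rightarrow> 'h::chilbert_space \<Rightarrow> 'h) \<Rightarrow> ('u \<Rightarrow> 'h) \<Rightarrow> ('h \<Rightarrow> 'u \<Rightarrow> real)
     \<Rightarrow> real \<Rightarrow> 'h \<Rightarrow> (real \<Rightarrow> 'u) \<Rightarrow> real" where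
  "total_cost S B l T x0 u =
     (LINT t|lebesgue_on {0..T}. l (mild_solution S B x0 u t) (u t))"

definition optimal_pair ::
  "(real \<Rightarrow> 'h::chilbert_space \<Rightarrow> 'h) \<Rightarrow> ('u::chilbert_space \<Rightarrow> 'h) \<Rightarrow> ('h \<Rightarrow> 'u \<Rightarrow> real)
     \<Rightarrow> real \<Rightarrow> 'h \<Rightarrow> (real \<Rightarrow> 'h) \<Rightarrow> (real \<Rightarrow> 'u) \<Rightarrow> bool" where
  "optimal_pair S B l T x0 x u \<longleftrightarrow>
     x = mild_solution S B x0 u \<and> u \<in> L2_controls T \<and>
     (\<forall>w\<in>L2_controls T. total_cost S B l T x0 u \<le> total_cost S B l T x0 w)"

text \<open>
  Optimal pairs exist for the quadratic problem at hand, and the optimal control is unique up to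
  null sets. The turnpike properties therefore speak about one representative of the optimal
  control. For the measure turnpike the choice does not matter; the pointwise bound of the
  exponential turnpike for all \<open>t\<close> is only meaningful for a suitable representative.
\<close>

definition bounded_neighborhood :: "'h::metric_space \<Rightarrow> 'h set \<Rightarrow> bool" where
  "bounded_neighborhood x N \<longleftrightarrow> bounded N \<and> x \<in> interior N"

definition measure_turnpike ::
  "(real \<Rightarrow> 'h::chilbert_space \<Rightarrow> 'h) \<Rightarrow> ('u::chilbert_space \<Rightarrow> 'h) \<Rightarrow> ('h \<Rightarrow> 'u \<Rightarrow> real)
     \<Rightarrow> 'h \<Rightarrow> 'u \<Rightarrow> bool" where
  "measure_turnpike S B l xe ue \<longleftrightarrow>
     (\<forall>N \<epsilon>. bounded_neighborhood xe N \<and> \<epsilon> > 0 \<longrightarrow>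
        (\<exists>M>0. \<forall>x0\<in>N. \<forall>T>0. \<exists>x u. optimal_pair S B l T x0 x u \<and>
           measure lebesgue {t\<in>{0..T}. norm (x t - xe) + norm (u t - ue) > \<epsilon>} \<le> M))"

definition exponential_turnpike ::
  "(real \<Rightarrow> 'h::chilbert_space \<Rightarrow> 'h) \<Rightarrow> ('u::chilbert_space \<Rightarrow> 'h) \<Rightarrow> ('h \<Rightarrow> 'u \<Rightarrow> real)
     \<Rightarrow> 'h \<Rightarrow> 'u \<Rightarrow> bool" where
  "exponential_turnpike S B l xe ue \<longleftrightarrow>
     (\<forall>N. bounded_neighborhood xe N \<longrightarrow>
        (\<exists>M>0. \<exists>k>0. \<forall>x0\<in>N. \<forall>T>0. \<exists>x u. optimal_pair S B l T x0 x u \<and>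
           (\<forall>t\<in>{0..T}. norm (x t - xe) + norm (u t - ue)
                          \<le> M * (exp (- k * t) + exp (- k * (T - t))))))"

end

(* A difference of two optimal pairs with equal horizon solves the homogeneous problem with cost
   |Cx|^2 + |Ku|^2, and by the turnpike property it is, for all horizons T at once, small at some time
   in a fixed interval [1, tau]. Concatenating such pairs bounds the homogeneous optimal cost
   independently of T; being monotone in T it converges, and so do the optimal trajectories, to a
   semigroup Phi. The contraction survives in the limit, so Phi is exponentially stable. On the
   unobservable subspace the zero control is optimal, hence Phi = S there, which gives (a).
   The limit of the optimal cost is a quadratic form whose representative yields the feedback F, and
   (Phi t w - S t w) / t tends to B (F w), so that Phi is generated by A + BF, which gives (c).
   For (b) compare the optimal cost from another steady state with T times its running cost: every
   time is within a fixed distance of a time at which the optimal pair is close to (xe, ue), so that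
   the trajectory on the bad set is controlled by the L2 norm of the control. Uniqueness
   follows from strict convexity along a segment of steady states and (a). *)

theory Submission imports Defs begin

section \<open>Strong measurability\<close>

text \<open>No minimization problem in function space is solved here. That the homogeneous problem
  has optimal controls at every horizon is read off from the optimal pairs which the turnpike
  property supplies: in a difference of two of them the linear terms of the cost cancel. Controls
  are determined only up to null sets, so linearity, uniqueness and dynamic programming are proved
  for trajectories and for the bilinear form of the cost, never for the controls. \<open>S\<close>
  is merely strongly continuous, and the time at which a trajectory has become small depends on its
  initial state. Hence decay is iterated along single trajectories, and the feedback comes from a
  variational identity instead of a differential Riccati equation. The numbers 1/8, 1/4 and 1/2
  belong together: 1/8 is the tolerance for each of two optimal pairs, 1/4 the resulting size of
  their difference, and the room between 1/4 and 1/2 pays for the limit in the horizon. All forms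
  are real; complex linearity is recovered by moving \<open>scaleC c\<close> to the other argument
  as \<open>scaleC (cnj c)\<close>.\<close>

lemma strongly_measurableE:
  assumes "strongly_measurable M u"
  obtains s where "\<And>i::nat. simple_function M (s i)" "AE t in M. (\<lambda>i. s i t) \<longlonglongrightarrow> u t"
  using assms unfolding strongly_measurable_def by blast

lemma strongly_measurableI:
  assumes "\<And>i::nat. simple_function M (s i)" "AE t in M. (\<lambda>i. s i t) \<longlonglongrightarrow> u t"
  shows "strongly_measurable M u"
  using assms unfolding strongly_measurable_def by blast

lemma strongly_measurable_compose2:
  fixes f :: "real \<Rightarrow> 'a::real_normed_vector" and g :: "real \<Rightarrow> 'b::real_normed_vector"
    and \<phi> :: "'a \<Rightarrow> 'b \<Rightarrow> 'c::real_normed_vector"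
  assumes "strongly_measurable M f" "strongly_measurable M g"
    and cont: "continuous_on UNIV (\<lambda>p. \<phi> (fst p) (snd p))"
  shows "strongly_measurable M (\<lambda>t. \<phi> (f t) (g t))"
proof -
  obtain s where s: "\<And>i::nat. simple_function M (s i)" "AE t in M. (\<lambda>i. s i t) \<longlonglongrightarrow> f t"
    using assms(1) by (rule strongly_measurableE) (rule that)
  obtain s' where s': "\<And>i::nat. simple_function M (s' i)" "AE t in M. (\<lambda>i. s' i t) \<longlonglongrightarrow> g t"
    using assms(2) by (rule strongly_measurableE) (rule that)
  have "simple_function M (\<lambda>t. \<phi> (s i t) (s' i t))" for i
    using s(1) s'(1) by (rule simple_function_compose2)
  moreover have "AE t in M. (\<lambda>i. \<phi> (s i t) (s' i t)) \<longlonglongrightarrow> \<phi> (f t) (g t)"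
    using s(2) s'(2)
  proof eventually_elim
    case (elim t)
    then have "(\<lambda>i. (s i t, s' i t)) \<longlonglongrightarrow> (f t, g t)" by (rule tendsto_Pair)
    from continuous_on_tendsto_compose[OF cont this] show ?case by simp
  qed
  ultimately show ?thesis by (rule strongly_measurableI)
qed

lemma strongly_measurable_const: "strongly_measurable M (\<lambda>_. c)"
  unfolding strongly_measurable_def by (rule exI[of _ "\<lambda>_ _. c"]) simp

lemma strongly_measurable_compose:
  fixes f :: "real \<Rightarrow> 'a::real_normed_vector" and \<phi> :: "'a \<Rightarrow> 'c::real_normed_vector"
  assumes "strongly_measurable M f" "continuous_on UNIV \<phi>"
  shows "strongly_measurable M (\<lambda>t. \<phi> (f t))"
proof -
  have "continuous_on UNIV (\<lambda>p. \<phi> (fst (p :: 'a \<times> real)))"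
    by (rule continuous_on_compose2[OF assms(2) continuous_on_fst[OF continuous_on_id]]) simp
  from strongly_measurable_compose2[OF assms(1) strongly_measurable_const[of M 0] this]
  show ?thesis by simp
qed

text \<open>Extension by 0 moves the notion to the whole line, where controls can be translated and
  glued.\<close>

lemma strongly_measurable_lebesgue_on_iff:
  fixes u :: "real \<Rightarrow> 'a::real_normed_vector"
  assumes A: "A \<in> sets lebesgue"
  shows "strongly_measurable (lebesgue_on A) u
    \<longleftrightarrow> strongly_measurable lebesgue (\<lambda>t. if t \<in> A then u t else 0)"
proof
  assume "strongly_measurable (lebesgue_on A) u"
  then obtain s where s: "\<And>i::nat. simple_function (lebesgue_on A) (s i)"
    "AE t in lebesgue_on A. (\<lambda>i. s i t) \<longlonglongrightarrow> u t"
    by (rule strongly_measurableE) (rule that)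
  have "simple_function lebesgue (\<lambda>t. if t \<in> A then s i t else 0)" for i
  proof -
    have fin: "finite (s i ` A)" and
      pre: "\<And>x. x \<in> s i ` A \<Longrightarrow> s i -` {x} \<inter> A \<in> sets (lebesgue_on A)"
      using s(1)[of i] by (auto simp: simple_function_def)
    have pre': "s i -` {x} \<inter> A \<in> sets lebesgue" for x
    proof (cases "x \<in> s i ` A")
      case True
      then show ?thesis using pre[OF True] A by (simp add: sets_restrict_space_iff)
    next
      case False
      then have "s i -` {x} \<inter> A = {}" by auto
      then show ?thesis by simp
    qed
    have "(\<lambda>t. if t \<in> A then s i t else 0) -` {x} \<inter> UNIV \<in> sets lebesgue" for x
    proof -
      have eq: "(\<lambda>t. if t \<in> A then s i t else 0) -` {x} \<inter> UNIV
        = (s i -` {x} \<inter> A) \<union> (if x = 0 then - A else {})" by (auto split: if_splits)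
      have "- A \<in> sets lebesgue" using A by (metis Compl_in_sets_lebesgue)
      then show ?thesis unfolding eq using pre'[of x] by auto
    qed
    moreover have "finite ((\<lambda>t. if t \<in> A then s i t else 0) ` UNIV)"
      by (rule finite_subset[of _ "insert 0 (s i ` A)"]) (use fin in auto)
    ultimately show ?thesis by (simp add: simple_function_def)
  qed
  moreover have "AE t in lebesgue. (\<lambda>i. if t \<in> A then s i t else 0) \<longlonglongrightarrow> (if t \<in> A then u t else 0)"
    using s(2) A by (subst (asm) AE_restrict_space_iff) (auto elim: eventually_mono)
  ultimately show "strongly_measurable lebesgue (\<lambda>t. if t \<in> A then u t else 0)"
    unfolding strongly_measurable_def
    by (intro exI[of _ "\<lambda>i t. if t \<in> A then s i t else 0"]) auto
next
  assume "strongly_measurable lebesgue (\<lambda>t. if t \<in> A then u t else 0)"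
  then obtain s where s: "\<And>i::nat. simple_function lebesgue (s i)"
    "AE t in lebesgue. (\<lambda>i. s i t) \<longlonglongrightarrow> (if t \<in> A then u t else 0)"
    by (rule strongly_measurableE) (rule that)
  have "simple_function (lebesgue_on A) (s i)" for i
    unfolding simple_function_def
  proof safe
    have "finite (range (s i))" using s(1)[of i] by (simp add: simple_function_def)
    then show "finite (s i ` space (lebesgue_on A))" by (rule rev_finite_subset) auto
    fix x
    have "s i -` {s i x} \<in> sets lebesgue" using s(1)[of i] by (auto simp: simple_function_def)
    then show "s i -` {s i x} \<inter> space (lebesgue_on A) \<in> sets (lebesgue_on A)"
      using A by (auto simp: sets_restrict_space_iff)
  qed
  moreover have "AE t in lebesgue_on A. (\<lambda>i. s i t) \<longlonglongrightarrow> u t"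
    using s(2) A by (subst AE_restrict_space_iff) (auto elim: eventually_mono)
  ultimately show "strongly_measurable (lebesgue_on A) u"
    unfolding strongly_measurable_def by blast
qed

lemma strongly_measurable_shift:
  fixes u :: "real \<Rightarrow> 'a::real_normed_vector"
  assumes "strongly_measurable lebesgue u"
  shows "strongly_measurable lebesgue (\<lambda>t. u (t + c))"
proof -
  obtain s where s: "\<And>i::nat. simple_function lebesgue (s i)"
    "AE t in lebesgue. (\<lambda>i. s i t) \<longlonglongrightarrow> u t"
    using assms by (rule strongly_measurableE) (rule that)
  have tr: "(\<lambda>t. t + c) -` X = (+) (- c) ` X" for X :: "real set"
    by (force simp: image_iff)
  have "simple_function lebesgue (\<lambda>t. s i (t + c))" for i
    unfolding simple_function_def
  proof safe
    have "finite (range (s i))" using s(1)[of i] by (simp add: simple_function_def)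
    then show "finite ((\<lambda>t. s i (t + c)) ` space lebesgue)" by (rule rev_finite_subset) auto
    fix x
    have "s i -` {s i (x + c)} \<in> sets lebesgue" using s(1)[of i] by (auto simp: simple_function_def)
    then have "(\<lambda>t. t + c) -` (s i -` {s i (x + c)}) \<in> sets lebesgue"
      unfolding tr by (rule lebesgue_sets_translation)
    then show "(\<lambda>t. s i (t + c)) -` {s i (x + c)} \<inter> space lebesgue \<in> sets lebesgue"
      by (simp add: vimage_def)
  qed
  moreover have "AE t in lebesgue. (\<lambda>i. s i (t + c)) \<longlonglongrightarrow> u (t + c)"
  proof -
    obtain N where N: "N \<in> null_sets lebesgue" "{t. \<not> (\<lambda>i. s i t) \<longlonglongrightarrow> u t} \<subseteq> N"
      using s(2) by (auto simp: eventually_ae_filter)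
    have "negligible ((+) (- c) ` N)"
      using N(1) negligible_translation[of N "- c"] by (simp add: negligible_iff_null_sets)
    moreover have "{t. \<not> (\<lambda>i. s i (t + c)) \<longlonglongrightarrow> u (t + c)} \<subseteq> (\<lambda>t. t + c) -` N" using N(2) by auto
    ultimately show ?thesis unfolding eventually_ae_filter
      by (intro bexI[of _ "(+) (- c) ` N"]) (auto simp: tr negligible_iff_null_sets)
  qed
  ultimately show ?thesis by (rule strongly_measurableI)
qed

text \<open>The simple functions converge only almost everywhere. Setting them to 0 on the
  exceptional null set makes the convergence pointwise, and completeness of Lebesgue measure carries
  measurability back to \<open>f\<close>.\<close>

lemma strongly_measurable_imp_borel:
  fixes f :: "real \<Rightarrow> real"
  assumes "strongly_measurable (lebesgue_on A) f" and A: "A \<in> sets lebesgue"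
  shows "f \<in> borel_measurable (lebesgue_on A)"
proof -
  let ?f = "\<lambda>t. if t \<in> A then f t else 0"
  obtain s where s: "\<And>i::nat. simple_function lebesgue (s i)"
    "AE t in lebesgue. (\<lambda>i. s i t) \<longlonglongrightarrow> ?f t"
    using assms(1)[unfolded strongly_measurable_lebesgue_on_iff[OF A]] by (rule strongly_measurableE) (rule that)
  obtain N where N: "N \<in> null_sets lebesgue" "{t. \<not> (\<lambda>i. s i t) \<longlonglongrightarrow> ?f t} \<subseteq> N"
    using s(2) by (auto simp: eventually_ae_filter)
  define h where "h t = (if t \<in> N then 0 else ?f t)" for t
  have "(\<lambda>t. if t \<in> N then 0 else s i t) \<in> borel_measurable lebesgue" for i
  proof -
    have "s i \<in> borel_measurable lebesgue" using s(1) by (rule borel_measurable_simple_function)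
    then show ?thesis using N(1) by (intro measurable_If_set) auto
  qed
  moreover have "(\<lambda>i. if t \<in> N then 0 else s i t) \<longlonglongrightarrow> h t" for t
  proof (cases "t \<in> N")
    case False
    then have "(\<lambda>i. s i t) \<longlonglongrightarrow> ?f t" using N(2) by blast
    then show ?thesis using False by (simp add: h_def)
  qed (simp add: h_def)
  ultimately have "h \<in> borel_measurable lebesgue" by (rule borel_measurable_LIMSEQ_real[rotated])
  moreover have "AE t in lebesgue. h t = ?f t"
    using N(1) by (intro AE_I'[of N]) (auto simp: h_def)
  ultimately have "?f \<in> borel_measurable lebesgue" by (rule borel_measurable_AE)
  then show ?thesis using borel_measurable_if[OF A, of f] by simp
qed

text \<open>The family is continuous in \<open>r\<close> only for each fixed vector. The
  approximants therefore freeze both arguments: the time is rounded to a grid and the vector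
  replaced by a simple function, so only finitely many values occur. Strong continuity handles the
  first replacement, the uniform bound \<open>M\<close> the second.\<close>

lemma strongly_measurable_operator_family:
  fixes G :: "real \<Rightarrow> 'a::real_normed_vector \<Rightarrow> 'b::real_normed_vector"
  assumes add: "\<And>r x y. r \<in> {0..t} \<Longrightarrow> G r (x - y) = G r x - G r y"
    and bd: "\<And>r x. r \<in> {0..t} \<Longrightarrow> norm (G r x) \<le> M * norm x"
    and cont: "\<And>x. continuous_on {0..t} (\<lambda>r. G r x)"
    and g: "strongly_measurable (lebesgue_on {0..t}) g"
  shows "strongly_measurable (lebesgue_on {0..t}) (\<lambda>r. G r (g r))"
proof -
  obtain s where s: "\<And>i::nat. simple_function (lebesgue_on {0..t}) (s i)"
    "AE r in lebesgue_on {0..t}. (\<lambda>i. s i r) \<longlonglongrightarrow> g r"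
    using g by (rule strongly_measurableE) (rule that)
  \<comment> \<open>Rounding down to a multiple of \<open>1 / (i + 1)\<close> keeps the grid time
    inside \<open>{0..t}\<close>, where the assumptions on \<open>G\<close> hold.\<close>
  define d where "d i r = of_int \<lfloor>(real i + 1) * r\<rfloor> / (real i + 1)" for i :: nat and r :: real
  have d_le: "d i r \<le> r" for i r
    unfolding d_def by (simp add: pos_divide_le_eq mult.commute)
  have d_ge: "d i r \<ge> r - 1 / (real i + 1)" for i r
  proof -
    have "(real i + 1) * r - 1 \<le> of_int \<lfloor>(real i + 1) * r\<rfloor>" by linarith
    then have "((real i + 1) * r - 1) / (real i + 1) \<le> d i r"
      unfolding d_def by (rule divide_right_mono) simp
    then show ?thesis by (simp add: diff_divide_distrib)
  qed
  have d_nonneg: "d i r \<ge> 0" if "r \<ge> 0" for i r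
    unfolding d_def using that by simp
  have d_lim: "(\<lambda>i. d i r) \<longlonglongrightarrow> r" for r
  proof (rule tendsto_sandwich[of "\<lambda>i. r - 1 / (real i + 1)" _ _ "\<lambda>_. r"])
    have "(\<lambda>i. r - inverse (real (Suc i))) \<longlonglongrightarrow> r - 0"
      by (intro tendsto_intros LIMSEQ_inverse_real_of_nat)
    then show "(\<lambda>i. r - 1 / (real i + 1)) \<longlonglongrightarrow> r" by (simp add: inverse_eq_divide add.commute)
  qed (use d_le d_ge in auto)
  have d_simple: "simple_function (lebesgue_on {0..t}) (d i)" for i
  proof (rule simple_function_borel_measurable)
    have "d i \<in> borel_measurable borel" unfolding d_def by measurable
    then have "d i \<in> borel_measurable lebesgue" by (simp add: measurable_completion)
    then show "d i \<in> borel_measurable (lebesgue_on {0..t})" by (rule measurable_restrict_space1)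
    have "d i ` {0..t} \<subseteq> (\<lambda>k. of_int k / (real i + 1)) ` {0..\<lfloor>(real i + 1) * t\<rfloor>}"
      unfolding d_def by (intro image_subsetI image_eqI[OF refl]) (auto intro!: floor_mono mult_left_mono)
    then have "finite (d i ` {0..t})" by (rule finite_subset) simp
    then show "finite (d i ` space (lebesgue_on {0..t}))" by simp
  qed
  have "simple_function (lebesgue_on {0..t}) (\<lambda>r. G (d i r) (s i r))" for i
    using d_simple s(1) by (rule simple_function_compose2)
  moreover have "AE r in lebesgue_on {0..t}. (\<lambda>i. G (d i r) (s i r)) \<longlonglongrightarrow> G r (g r)"
    using s(2) AE_space
  proof eventually_elim
    case (elim r)
    then have r: "r \<in> {0..t}" by simp
    have dr: "d i r \<in> {0..t}" for i using d_le[of i r] d_nonneg[of r i] r by auto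
    have "(\<lambda>i. G (d i r) (g r)) \<longlonglongrightarrow> G r (g r)"
      by (rule continuous_on_tendsto_compose[OF cont d_lim r]) (simp add: dr[simplified])
    moreover have "(\<lambda>i. G (d i r) (s i r - g r)) \<longlonglongrightarrow> 0"
    proof (rule tendsto_norm_zero_cancel, rule tendsto_sandwich[of "\<lambda>_. 0"])
      show "(\<lambda>i. M * norm (s i r - g r)) \<longlonglongrightarrow> 0"
        using elim(1) by (intro tendsto_mult_right_zero tendsto_norm_zero) (simp add: LIM_zero_iff)
    qed (use bd[OF dr] in auto)
    ultimately have "(\<lambda>i. G (d i r) (g r) + G (d i r) (s i r - g r)) \<longlonglongrightarrow> G r (g r) + 0"
      by (rule tendsto_add)
    then show ?case by (simp add: add[OF dr])
  qed
  ultimately show ?thesis unfolding strongly_measurable_def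
    by (intro exI[of _ "\<lambda>i r. G (d i r) (s i r)"]) auto
qed

text \<open>A continuous function is the operator family \<open>x *\<^sub>R f r\<close> applied to
  the constant scalar 1.\<close>

lemma strongly_measurable_continuous:
  fixes f :: "real \<Rightarrow> 'a::real_normed_vector"
  assumes "continuous_on {0..t} f"
  shows "strongly_measurable (lebesgue_on {0..t}) f"
proof -
  have "compact (f ` {0..t})" using assms by (intro compact_continuous_image) auto
  then obtain M where M: "\<And>r. r \<in> {0..t} \<Longrightarrow> norm (f r) \<le> M"
    using compact_imp_bounded bounded_iff by (metis image_eqI)
  have "strongly_measurable (lebesgue_on {0..t}) (\<lambda>r. (1::real) *\<^sub>R f r)"
  proof (rule strongly_measurable_operator_family[where G="\<lambda>r x. x *\<^sub>R f r" and M=M])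
    show "continuous_on {0..t} (\<lambda>r. x *\<^sub>R f r)" for x
      by (intro continuous_intros assms)
  qed (auto simp: scaleR_diff_left M mult.commute[of M] strongly_measurable_const intro!: mult_left_mono)
  then show ?thesis by simp
qed

section \<open>Integrability of strongly measurable functions with integrable norm\<close>

lemma simple_function_integrable_on:
  fixes s :: "real \<Rightarrow> 'a::real_normed_vector"
  assumes "simple_function (lebesgue_on {a..b}) s"
  shows "s integrable_on {a..b}"
proof -
  let ?D = "s ` {a..b}"
  have fin: "finite ?D" and pre: "\<And>y. y \<in> ?D \<Longrightarrow> s -` {y} \<inter> {a..b} \<in> sets (lebesgue_on {a..b})"
    using assms by (auto simp: simple_function_def)
  have "(\<lambda>x. \<Sum>y\<in>?D. indicat_real (s -` {y} \<inter> {a..b}) x *\<^sub>R y) integrable_on {a..b}"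
  proof (intro integrable_sum fin)
    fix y assume y: "y \<in> ?D"
    have "s -` {y} \<inter> {a..b} \<in> sets lebesgue"
      using pre[OF y] by (simp add: sets_restrict_space_iff)
    then have "s -` {y} \<inter> {a..b} \<in> lmeasurable"
      by (intro bounded_set_imp_lmeasurable) (auto intro: bounded_subset[of "{a..b}"])
    then have "indicat_real (s -` {y} \<inter> {a..b}) integrable_on {a..b}"
      by (simp add: integrable_on_indicator Int_assoc)
    from integrable_linear[OF this bounded_linear_scaleR_left[of y]]
    show "(\<lambda>x. indicat_real (s -` {y} \<inter> {a..b}) x *\<^sub>R y) integrable_on {a..b}"
      by (simp add: o_def)
  qed
  then show ?thesis
  proof (rule integrable_eq)
    fix x assume x: "x \<in> {a..b}"
    have "(\<Sum>y\<in>?D. indicat_real (s -` {y} \<inter> {a..b}) x *\<^sub>R y)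
      = (\<Sum>y\<in>?D. if y = s x then y else 0)"
      by (rule sum.cong) (use x in \<open>auto simp: indicator_def\<close>)
    also have "\<dots> = s x" using fin x by (subst sum.delta) auto
    finally show "(\<Sum>y\<in>?D. indicat_real (s -` {y} \<inter> {a..b}) x *\<^sub>R y) = s x" .
  qed
qed

lemma strongly_measurable_norm:
  assumes "strongly_measurable (lebesgue_on A) f" "A \<in> sets lebesgue"
  shows "(\<lambda>t. norm (f t)) \<in> borel_measurable (lebesgue_on A)"
  by (rule strongly_measurable_imp_borel[OF
        strongly_measurable_compose[OF assms(1) continuous_on_norm_id] assms(2)])

lemma simple_function_imp_strongly_measurable:
  "simple_function M s \<Longrightarrow> strongly_measurable M s"
  unfolding strongly_measurable_def by (rule exI[of _ "\<lambda>_. s"]) simp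

lemma simple_function_L1_approx:
  fixes g :: "real \<Rightarrow> 'a::real_normed_vector"
  assumes g: "strongly_measurable (lebesgue_on {a..b}) g"
    and int: "(\<lambda>t. norm (g t)) integrable_on {a..b}" and e: "e > 0"
  obtains s where "simple_function (lebesgue_on {a..b}) s"
    "(\<lambda>t. norm (g t - s t)) integrable_on {a..b}" "integral {a..b} (\<lambda>t. norm (g t - s t)) < e"
proof -
  let ?L = "lebesgue_on {a..b}"
  obtain s where s: "\<And>i::nat. simple_function ?L (s i)" "AE r in ?L. (\<lambda>i. s i r) \<longlonglongrightarrow> g r"
    using g by (rule strongly_measurableE) (rule that)
  \<comment> \<open>The truncation yields the dominating function \<open>3 * norm (g r)\<close>.
    Where \<open>g r\<close> is nonzero, the factor 2 leaves room, so the truncation is eventually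
    inactive; where \<open>g r\<close> is 0, it forces the value 0.\<close>
  define s' where "s' i r = (if norm (s i r) \<le> 2 * norm (g r) then s i r else 0)" for i r
  have meas_g: "(\<lambda>t. norm (g t)) \<in> borel_measurable ?L"
    by (rule strongly_measurable_norm[OF g]) simp
  have s'_simple: "simple_function ?L (s' i)" for i
    unfolding s'_def
  proof (rule simple_function_If)
    have "(\<lambda>t. norm (s i t)) \<in> borel_measurable ?L"
      by (rule strongly_measurable_norm[OF simple_function_imp_strongly_measurable[OF s(1)]]) simp
    with meas_g show "{x \<in> space ?L. norm (s i x) \<le> 2 * norm (g x)} \<in> sets ?L"
      by measurable
  qed (use s in auto)
  have lim: "AE r in ?L. (\<lambda>i. norm (g r - s' i r)) \<longlonglongrightarrow> 0"
    using s(2)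
  proof eventually_elim
    case (elim r)
    have "(\<lambda>i. s' i r) \<longlonglongrightarrow> g r"
    proof (cases "g r = 0")
      case True
      then have "s' i r = 0" for i by (auto simp: s'_def)
      then show ?thesis using True by simp
    next
      case False
      have "(\<lambda>i. norm (s i r)) \<longlonglongrightarrow> norm (g r)" using elim by (rule tendsto_norm)
      moreover have "norm (g r) < 2 * norm (g r)" using False by simp
      ultimately have "\<forall>\<^sub>F i in sequentially. norm (s i r) < 2 * norm (g r)"
        by (rule order_tendstoD)
      then have "\<forall>\<^sub>F i in sequentially. s i r = s' i r"
        by eventually_elim (simp add: s'_def)
      then show ?thesis by (rule Lim_transform_eventually[OF elim])
    qed
    then have "(\<lambda>i. norm (g r - s' i r)) \<longlonglongrightarrow> norm (g r - g r)"
      by (intro tendsto_intros)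
    then show ?case by simp
  qed
  have meas: "(\<lambda>t. norm (g t - s' i t)) \<in> borel_measurable ?L" for i
  proof (rule strongly_measurable_norm)
    show "strongly_measurable ?L (\<lambda>t. g t - s' i t)"
      by (rule strongly_measurable_compose2[OF g simple_function_imp_strongly_measurable[OF s'_simple]])
        (intro continuous_intros)
  qed simp
  have le: "norm (g t - s' i t) \<le> 3 * norm (g t)" for i t
  proof -
    have "norm (s' i t) \<le> 2 * norm (g t)" by (auto simp: s'_def)
    then show ?thesis using norm_triangle_ineq4[of "g t" "s' i t"] by linarith
  qed
  have int3: "integrable ?L (\<lambda>t. 3 * norm (g t))"
    using nonnegative_absolutely_integrable_1[OF int] absolutely_integrable_on_def
    by (intro integrable_mult_right) (simp add: integrable_restrict_space set_integrable_def)
  have zero: "(\<lambda>_. 0::real) \<in> borel_measurable ?L" by simp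
  have "(\<lambda>i. integral\<^sup>L ?L (\<lambda>t. norm (g t - s' i t))) \<longlonglongrightarrow> integral\<^sup>L ?L (\<lambda>_. 0)"
    by (rule integral_dominated_convergence[OF zero meas int3 lim]) (simp add: le)
  then have "\<forall>\<^sub>F i in sequentially. integral\<^sup>L ?L (\<lambda>t. norm (g t - s' i t)) < e"
    using e by (auto dest: order_tendstoD)
  then obtain i where i: "integral\<^sup>L ?L (\<lambda>t. norm (g t - s' i t)) < e"
    by (auto simp: eventually_sequentially)
  have int_i: "integrable ?L (\<lambda>t. norm (g t - s' i t))"
    by (rule Bochner_Integration.integrable_bound[OF int3 meas]) (simp add: le)
  show ?thesis
  proof (rule that[OF s'_simple[of i]])
    show "(\<lambda>t. norm (g t - s' i t)) integrable_on {a..b}"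
      using int_i by (rule integrable_on_lebesgue_on) simp
    show "integral {a..b} (\<lambda>t. norm (g t - s' i t)) < e"
      using i lebesgue_integral_eq_integral[OF int_i] by simp
  qed
qed

text \<open>A Riemann sum of \<open>g\<close> differs from that of the simple function \<open>s\<close> by at most the Riemann sum
  of \<open>norm (g - s)\<close>, which is small for fine divisions; hence the Cauchy criterion.\<close>

lemma strongly_measurable_integrable_on:
  fixes g :: "real \<Rightarrow> 'a::banach"
  assumes g: "strongly_measurable (lebesgue_on {a..b}) g"
    and int: "(\<lambda>t. norm (g t)) integrable_on {a..b}"
  shows "g integrable_on {a..b}"
proof -
  have "\<exists>\<gamma>. gauge \<gamma> \<and>
          (\<forall>D1 D2. D1 tagged_division_of (cbox a b) \<and> \<gamma> fine D1 \<and>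
            D2 tagged_division_of (cbox a b) \<and> \<gamma> fine D2 \<longrightarrow>
            norm ((\<Sum>(x,K)\<in>D1. measure lborel K *\<^sub>R g x) - (\<Sum>(x,K)\<in>D2. measure lborel K *\<^sub>R g x)) < e)"
    if e: "e > 0" for e :: real
  proof -
    \<comment> \<open>Three errors of \<open>e / 6\<close> occur for each division: the Riemann sum
      of \<open>norm (g - s)\<close> against its integral, that integral itself, and the Riemann sum
      of \<open>s\<close> against its integral. Each division is thus within \<open>e / 2\<close> of
      the same vector.\<close>
    obtain s where s: "simple_function (lebesgue_on {a..b}) s"
      "(\<lambda>t. norm (g t - s t)) integrable_on {a..b}"
      "integral {a..b} (\<lambda>t. norm (g t - s t)) < e / 6"
      by (rule simple_function_L1_approx[OF g int, of "e / 6"]) (use e in auto)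
    let ?h = "\<lambda>t. norm (g t - s t)"
    have e6: "e / 6 > 0" using e by simp
    have "(?h has_integral integral {a..b} ?h) (cbox a b)" using s(2) by (simp add: integrable_integral)
    from this[unfolded has_integral, rule_format, OF e6] obtain \<gamma>1 where \<gamma>1: "gauge \<gamma>1" "\<forall>D. D tagged_division_of (cbox a b) \<and> \<gamma>1 fine D \<longrightarrow>
        norm ((\<Sum>(x,K)\<in>D. measure lborel K *\<^sub>R ?h x) - integral {a..b} ?h) < e / 6"
      by (elim exE conjE) (rule that)
    have "(s has_integral integral {a..b} s) (cbox a b)"
      using simple_function_integrable_on[OF s(1)] by (simp add: integrable_integral)
    from this[unfolded has_integral, rule_format, OF e6] obtain \<gamma>2 where \<gamma>2: "gauge \<gamma>2" "\<forall>D. D tagged_division_of (cbox a b) \<and> \<gamma>2 fine D \<longrightarrow>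
        norm ((\<Sum>(x,K)\<in>D. measure lborel K *\<^sub>R s x) - integral {a..b} s) < e / 6"
      by (elim exE conjE) (rule that)
    have near: "norm ((\<Sum>(x,K)\<in>D. measure lborel K *\<^sub>R g x) - integral {a..b} s) < e / 2"
      if D: "D tagged_division_of (cbox a b)" "(\<lambda>x. \<gamma>1 x \<inter> \<gamma>2 x) fine D" for D
    proof -
      have fine: "\<gamma>1 fine D" "\<gamma>2 fine D" using D(2) by (auto simp: fine_Int)
      have "norm ((\<Sum>(x,K)\<in>D. measure lborel K *\<^sub>R g x) - (\<Sum>(x,K)\<in>D. measure lborel K *\<^sub>R s x))
        = norm (\<Sum>(x,K)\<in>D. measure lborel K *\<^sub>R (g x - s x))"
        by (simp add: sum_subtractf[symmetric] split_beta scaleR_diff_right)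
      also have "\<dots> \<le> (\<Sum>(x,K)\<in>D. measure lborel K *\<^sub>R ?h x)"
        by (rule order_trans[OF norm_sum]) (simp add: split_beta)
      also have "\<dots> < e / 6 + integral {a..b} ?h"
        using \<gamma>1(2)[rule_format, OF conjI, OF D(1) fine(1)] unfolding real_norm_def by linarith
      also have "\<dots> < e / 3" using s(3) by simp
      finally have 1: "norm ((\<Sum>(x,K)\<in>D. measure lborel K *\<^sub>R g x) - (\<Sum>(x,K)\<in>D. measure lborel K *\<^sub>R s x)) < e / 3" .
      show ?thesis
        using norm_triangle_lt[OF add_strict_mono[OF 1 \<gamma>2(2)[rule_format, OF conjI, OF D(1) fine(2)]]] by (simp add: field_simps)
    qed
    show ?thesis
    proof (intro exI[of _ "\<lambda>x. \<gamma>1 x \<inter> \<gamma>2 x"] conjI allI impI)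
      show "gauge (\<lambda>x. \<gamma>1 x \<inter> \<gamma>2 x)" using \<gamma>1(1) \<gamma>2(1) by (rule gauge_Int)
      fix D1 D2
      assume "D1 tagged_division_of cbox a b \<and> (\<lambda>x. \<gamma>1 x \<inter> \<gamma>2 x) fine D1 \<and>
        D2 tagged_division_of cbox a b \<and> (\<lambda>x. \<gamma>1 x \<inter> \<gamma>2 x) fine D2"
      then show "norm ((\<Sum>(x,K)\<in>D1. measure lborel K *\<^sub>R g x) - (\<Sum>(x,K)\<in>D2. measure lborel K *\<^sub>R g x)) < e"
        using near[of D1] near[of D2]
          norm_triangle_ineq4[of "(\<Sum>(x,K)\<in>D1. measure lborel K *\<^sub>R g x) - integral {a..b} s"
            "(\<Sum>(x,K)\<in>D2. measure lborel K *\<^sub>R g x) - integral {a..b} s"] by simp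
    qed
  qed
  then have "g integrable_on cbox a b" using integrable_Cauchy[of g a b] by blast
  then show ?thesis by simp
qed

section \<open>Square integrable controls\<close>

lemma nonneg_integrable_lebesgue_on_iff:
  fixes f :: "real \<Rightarrow> real"
  assumes "S \<in> sets lebesgue" "\<And>x. x \<in> S \<Longrightarrow> 0 \<le> f x"
  shows "integrable (lebesgue_on S) f \<longleftrightarrow> f integrable_on S"
proof
  assume "f integrable_on S"
  then have "f absolutely_integrable_on S"
    by (rule nonnegative_absolutely_integrable_1) (use assms in auto)
  then show "integrable (lebesgue_on S) f"
    using assms(1) by (simp add: integrable_restrict_space set_integrable_def)
qed (use integrable_on_lebesgue_on assms(1) in blast)

lemma L2_controls_iff:
  "u \<in> L2_controls T \<longleftrightarrow>
     strongly_measurable (lebesgue_on {0..T}) u \<and> (\<lambda>t. (norm (u t))\<^sup>2) integrable_on {0..T}"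
  by (simp add: L2_controls_def nonneg_integrable_lebesgue_on_iff)

lemma L2_measurable: "u \<in> L2_controls T \<Longrightarrow> strongly_measurable (lebesgue_on {0..T}) u"
  by (simp add: L2_controls_def)

lemma L2_dominated:
  assumes meas: "strongly_measurable (lebesgue_on {0..T}) u" and f: "f \<in> L2_controls T"
    and le: "\<And>t. t \<in> {0..T} \<Longrightarrow> norm (u t) \<le> M * norm (f t)"
  shows "u \<in> L2_controls T"
proof -
  have sm: "strongly_measurable (lebesgue_on {0..T}) (\<lambda>t. (norm (u t))\<^sup>2)"
    by (rule strongly_measurable_compose[OF meas]) (intro continuous_intros)
  have "(\<lambda>t. (norm (u t))\<^sup>2) absolutely_integrable_on {0..T}"
  proof (rule measurable_bounded_by_integrable_imp_absolutely_integrable)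
    show "(\<lambda>t. (norm (u t))\<^sup>2) \<in> borel_measurable (lebesgue_on {0..T})"
      by (rule strongly_measurable_imp_borel[OF sm]) simp
    show "(\<lambda>t. M\<^sup>2 * (norm (f t))\<^sup>2) integrable_on {0..T}"
      using f by (intro integrable_on_mult_right) (simp add: L2_controls_iff)
    show "norm ((norm (u t))\<^sup>2) \<le> M\<^sup>2 * (norm (f t))\<^sup>2" if "t \<in> {0..T}" for t
      using power_mono[OF le[OF that], of 2] by (simp add: power_mult_distrib)
  qed simp
  then show ?thesis using meas by (simp add: L2_controls_iff absolutely_integrable_on_def)
qed

lemma L2_operator_family:
  fixes G :: "real \<Rightarrow> 'a::real_normed_vector \<Rightarrow> 'b::real_normed_vector"
  assumes add: "\<And>r x y. r \<in> {0..t} \<Longrightarrow> G r (x - y) = G r x - G r y"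
    and bd: "\<And>r x. r \<in> {0..t} \<Longrightarrow> norm (G r x) \<le> M * norm x"
    and cont: "\<And>x. continuous_on {0..t} (\<lambda>r. G r x)"
    and g: "g \<in> L2_controls t"
  shows "(\<lambda>r. G r (g r)) \<in> L2_controls t"
  by (rule L2_dominated[OF strongly_measurable_operator_family[OF add bd cont L2_measurable[OF g]] g bd])

lemma L2_bounded_linear:
  assumes A: "bounded_linear A" and f: "f \<in> L2_controls T"
  shows "(\<lambda>t. A (f t)) \<in> L2_controls T"
proof -
  obtain M where "\<And>x. norm (A x) \<le> norm x * M" using bounded_linear.bounded[OF A] by blast
  then show ?thesis
    by (intro L2_operator_family[of T "\<lambda>_. A" M, OF _ _ _ f])
      (auto simp: linear_diff[OF bounded_linear.linear[OF A]] mult.commute)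
qed

lemma L2_continuous:
  assumes "continuous_on {0..T} f"
  shows "f \<in> L2_controls T"
  unfolding L2_controls_iff
  by (intro conjI strongly_measurable_continuous integrable_continuous_real continuous_intros assms)

lemma L2_const: "(\<lambda>_. c) \<in> L2_controls T"
  by (rule L2_continuous) (rule continuous_on_const)

lemma L2_integrable_norm_sq: "f \<in> L2_controls T \<Longrightarrow> (\<lambda>t. (norm (f t))\<^sup>2) integrable_on {0..T}"
  by (simp add: L2_controls_iff)

lemma L2_add:
  assumes f: "f \<in> L2_controls T" and g: "g \<in> L2_controls T"
  shows "(\<lambda>t. f t + g t) \<in> L2_controls T"
proof -
  have meas: "strongly_measurable (lebesgue_on {0..T}) (\<lambda>t. f t + g t)"
    by (rule strongly_measurable_compose2[OF L2_measurable[OF f] L2_measurable[OF g]])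
      (intro continuous_intros)
  have sm: "strongly_measurable (lebesgue_on {0..T}) (\<lambda>t. (norm (f t + g t))\<^sup>2)"
    by (rule strongly_measurable_compose[OF meas]) (intro continuous_intros)
  have "(\<lambda>t. (norm (f t + g t))\<^sup>2) absolutely_integrable_on {0..T}"
  proof (rule measurable_bounded_by_integrable_imp_absolutely_integrable)
    show "(\<lambda>t. (norm (f t + g t))\<^sup>2) \<in> borel_measurable (lebesgue_on {0..T})"
      by (rule strongly_measurable_imp_borel[OF sm]) simp
    show "(\<lambda>t. 2 * (norm (f t))\<^sup>2 + 2 * (norm (g t))\<^sup>2) integrable_on {0..T}"
      using f g by (intro integrable_add integrable_on_mult_right L2_integrable_norm_sq)
    show "norm ((norm (f t + g t))\<^sup>2) \<le> 2 * (norm (f t))\<^sup>2 + 2 * (norm (g t))\<^sup>2" for t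
    proof -
      have "(norm (f t + g t))\<^sup>2 \<le> (norm (f t) + norm (g t))\<^sup>2"
        by (intro power_mono norm_triangle_ineq) simp
      then show ?thesis
        using zero_le_power2[of "norm (f t) - norm (g t)"] by (simp add: power2_eq_square algebra_simps)
    qed
  qed simp
  then show ?thesis using meas by (simp add: L2_controls_iff absolutely_integrable_on_def)
qed

lemma L2_scaleR: "f \<in> L2_controls T \<Longrightarrow> (\<lambda>t. c *\<^sub>R f t) \<in> L2_controls T"
  by (rule L2_bounded_linear[OF bounded_linear_scaleR_right])

lemma L2_diff:
  assumes "f \<in> L2_controls T" "g \<in> L2_controls T"
  shows "(\<lambda>t. f t - g t) \<in> L2_controls T"
  using L2_add[OF assms(1) L2_scaleR[OF assms(2), of "-1"]] by simp

lemma L2_sub: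
  assumes f: "f \<in> L2_controls T" and s: "0 \<le> s" "s \<le> T" and T': "T' \<le> T - s"
  shows "(\<lambda>t. f (s + t)) \<in> L2_controls T'"
proof -
  have "strongly_measurable lebesgue (\<lambda>t. if t \<in> {0..T} then f t else 0)"
    using L2_measurable[OF f] by (simp add: strongly_measurable_lebesgue_on_iff)
  from strongly_measurable_shift[OF this, of s]
  have 1: "strongly_measurable lebesgue (\<lambda>t. if t + s \<in> {0..T} then f (t + s) else 0)" .
  have "strongly_measurable (lebesgue_on {0..T'}) (\<lambda>t. f (s + t))"
  proof -
    obtain \<sigma> where \<sigma>: "\<And>i::nat. simple_function lebesgue (\<sigma> i)"
      "AE t in lebesgue. (\<lambda>i. \<sigma> i t) \<longlonglongrightarrow> (if t + s \<in> {0..T} then f (t + s) else 0)"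
      using 1 by (rule strongly_measurableE) (rule that)
    have "strongly_measurable lebesgue (\<lambda>t. if t \<in> {0..T'} then f (s + t) else 0)"
    proof (rule strongly_measurableI)
      show "simple_function lebesgue (\<lambda>t. if t \<in> {0..T'} then \<sigma> i t else 0)" for i
        using \<sigma>(1) by (intro simple_function_If_set) auto
      show "AE t in lebesgue. (\<lambda>i. if t \<in> {0..T'} then \<sigma> i t else 0)
          \<longlonglongrightarrow> (if t \<in> {0..T'} then f (s + t) else 0)"
        using \<sigma>(2) by eventually_elim (use s T' in \<open>auto simp: add.commute\<close>)
    qed
    then show ?thesis by (simp add: strongly_measurable_lebesgue_on_iff)
  qed
  moreover have "(\<lambda>t. (norm (f (s + t)))\<^sup>2) integrable_on {0..T'}"
  proof -
    have "(\<lambda>t. (norm (f t))\<^sup>2) integrable_on {s..T' + s}"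
      using L2_integrable_norm_sq[OF f] by (rule integrable_subinterval_real) (use s T' in auto)
    then show ?thesis
      using integrable_on_shift_Icc_real[of "\<lambda>t. (norm (f t))\<^sup>2" s 0 T'] by (simp add: o_def)
  qed
  ultimately show ?thesis by (simp add: L2_controls_iff)
qed

lemma L2_subset: "f \<in> L2_controls T \<Longrightarrow> 0 \<le> T \<Longrightarrow> T' \<le> T \<Longrightarrow> f \<in> L2_controls T'"
  using L2_sub[of f T 0 T'] by simp

lemma integral_shift_0:
  fixes f :: "real \<Rightarrow> 'a::banach"
  shows "integral {s..T} f = integral {0..T - s} (\<lambda>t. f (s + t))"
  using integral_shift_Icc_real[of 0 "T - s" f s] by (simp add: o_def)

lemma integrable_shift_0:
  fixes f :: "real \<Rightarrow> 'a::banach"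
  shows "f integrable_on {s..T} \<longleftrightarrow> (\<lambda>t. f (s + t)) integrable_on {0..T - s}"
  using integrable_on_shift_Icc_real[of f s 0 "T - s"] by (simp add: o_def)

text \<open>At \<open>t = s\<close> the second control already counts, so on \<open>{0..s}\<close>
  the result agrees with \<open>f\<close> except possibly at one point; later proofs discard this
  point as a null set.\<close>

definition concat_control :: "real \<Rightarrow> (real \<Rightarrow> 'a) \<Rightarrow> (real \<Rightarrow> 'a) \<Rightarrow> real \<Rightarrow> 'a" where
  "concat_control s f g t = (if t < s then f t else g (t - s))"

lemma L2_concat:
  assumes f: "f \<in> L2_controls s" and g: "g \<in> L2_controls (T - s)" and s: "0 \<le> s" "s \<le> T"
  shows "concat_control s f g \<in> L2_controls T"
proof -
  let ?c = "concat_control s f g"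
  have 1: "strongly_measurable lebesgue (\<lambda>t. if t \<in> {0..s} then f t else 0)"
    and 2: "strongly_measurable lebesgue (\<lambda>t. if t + - s \<in> {0..T - s} then g (t + - s) else 0)"
    using L2_measurable[OF f] strongly_measurable_shift[of "\<lambda>t. if t \<in> {0..T - s} then g t else 0" "- s"]
      L2_measurable[OF g] by (simp_all add: strongly_measurable_lebesgue_on_iff)
  obtain \<sigma> where \<sigma>: "\<And>i::nat. simple_function lebesgue (\<sigma> i)"
      "AE t in lebesgue. (\<lambda>i. \<sigma> i t) \<longlonglongrightarrow> (if t \<in> {0..s} then f t else 0)"
    using 1 by (rule strongly_measurableE) (rule that)
  obtain \<tau> where \<tau>: "\<And>i::nat. simple_function lebesgue (\<tau> i)"
      "AE t in lebesgue. (\<lambda>i. \<tau> i t) \<longlonglongrightarrow> (if t + - s \<in> {0..T - s} then g (t + - s) else 0)"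
    using 2 by (rule strongly_measurableE) (rule that)
  have "strongly_measurable lebesgue (\<lambda>t. if t \<in> {0..T} then ?c t else 0)"
  proof (rule strongly_measurableI)
    show "simple_function lebesgue (\<lambda>t. if t \<in> {..<s} then \<sigma> i t else \<tau> i t)" for i
      using \<sigma>(1) \<tau>(1) by (intro simple_function_If_set) auto
    show "AE t in lebesgue. (\<lambda>i. if t \<in> {..<s} then \<sigma> i t else \<tau> i t)
        \<longlonglongrightarrow> (if t \<in> {0..T} then ?c t else 0)"
      using \<sigma>(2) \<tau>(2)
      by eventually_elim (use s in \<open>auto simp: concat_control_def split: if_splits\<close>)
  qed
  then have "strongly_measurable (lebesgue_on {0..T}) ?c"
    by (simp add: strongly_measurable_lebesgue_on_iff)
  moreover have "(\<lambda>t. (norm (?c t))\<^sup>2) integrable_on {0..T}"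
  proof (rule Henstock_Kurzweil_Integration.integrable_combine[OF s])
    show "(\<lambda>t. (norm (?c t))\<^sup>2) integrable_on {0..s}"
      by (rule integrable_spike_finite[of "{s}", OF _ _ L2_integrable_norm_sq[OF f]])
        (auto simp: concat_control_def)
    show "(\<lambda>t. (norm (?c t))\<^sup>2) integrable_on {s..T}"
      unfolding integrable_shift_0[of _ s T]
      by (rule integrable_eq[OF L2_integrable_norm_sq[OF g]]) (simp add: concat_control_def)
  qed
  ultimately show ?thesis by (simp add: L2_controls_iff)
qed

lemma L2_absolutely_integrable_inner:
  fixes f g :: "real \<Rightarrow> 'a::real_inner"
  assumes f: "f \<in> L2_controls T" and g: "g \<in> L2_controls T"
  shows "(\<lambda>t. f t \<bullet> g t) absolutely_integrable_on {0..T}"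
proof (rule measurable_bounded_by_integrable_imp_absolutely_integrable)
  have "strongly_measurable (lebesgue_on {0..T}) (\<lambda>t. f t \<bullet> g t)"
    by (rule strongly_measurable_compose2[OF L2_measurable[OF f] L2_measurable[OF g]])
      (intro continuous_intros)
  then show "(\<lambda>t. f t \<bullet> g t) \<in> borel_measurable (lebesgue_on {0..T})"
    by (rule strongly_measurable_imp_borel) simp
  show "(\<lambda>t. (norm (f t))\<^sup>2 + (norm (g t))\<^sup>2) integrable_on {0..T}"
    using f g by (intro integrable_add L2_integrable_norm_sq)
  show "norm (f t \<bullet> g t) \<le> (norm (f t))\<^sup>2 + (norm (g t))\<^sup>2" for t
  proof -
    have "\<bar>f t \<bullet> g t\<bar> \<le> norm (f t) * norm (g t)" by (rule Cauchy_Schwarz_ineq2)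
    also have "\<dots> \<le> (norm (f t))\<^sup>2 + (norm (g t))\<^sup>2"
      using sum_squares_bound[of "norm (f t)" "norm (g t)"]
        mult_nonneg_nonneg[OF norm_ge_zero[of "f t"] norm_ge_zero[of "g t"]] by linarith
    finally show ?thesis by simp
  qed
qed simp

lemma L2_integrable_inner:
  fixes f g :: "real \<Rightarrow> 'a::real_inner"
  assumes "f \<in> L2_controls T" "g \<in> L2_controls T"
  shows "(\<lambda>t. f t \<bullet> g t) integrable_on {0..T}"
  using L2_absolutely_integrable_inner[OF assms] by (simp add: absolutely_integrable_on_def)

lemma L2_norm: "f \<in> L2_controls T \<Longrightarrow> (\<lambda>t. norm (f t)) \<in> L2_controls T"
  by (rule L2_dominated[OF strongly_measurable_compose[OF L2_measurable continuous_on_norm_id], where M = 1])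
    auto

lemma L2_integrable_norm: "f \<in> L2_controls T \<Longrightarrow> (\<lambda>t. norm (f t)) integrable_on {0..T}"
  using L2_integrable_inner[OF L2_norm L2_const[of 1]] by simp

lemma L2_integrable_on:
  fixes f :: "real \<Rightarrow> 'a::banach"
  shows "f \<in> L2_controls T \<Longrightarrow> f integrable_on {0..T}"
  by (rule strongly_measurable_integrable_on[OF L2_measurable L2_integrable_norm])

lemma L2_integral_norm_le:
  fixes f :: "real \<Rightarrow> 'a::banach"
  shows "f \<in> L2_controls T \<Longrightarrow> norm (integral {0..T} f) \<le> integral {0..T} (\<lambda>t. norm (f t))"
  by (rule integral_norm_bound_integral[OF L2_integrable_on L2_integrable_norm]) auto

section \<open>The semidefinite inner product on square integrable functions\<close>

definition L2_inner :: "real \<Rightarrow> (real \<Rightarrow> 'a::real_inner) \<Rightarrow> (real \<Rightarrow> 'a) \<Rightarrow> real" where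
  "L2_inner T f g = integral {0..T} (\<lambda>t. f t \<bullet> g t)"

lemma L2_inner_commute: "L2_inner T f g = L2_inner T g f"
  by (simp add: L2_inner_def inner_commute)

lemma L2_inner_add_left:
  "f \<in> L2_controls T \<Longrightarrow> g \<in> L2_controls T \<Longrightarrow> h \<in> L2_controls T \<Longrightarrow>
   L2_inner T (\<lambda>t. f t + g t) h = L2_inner T f h + L2_inner T g h"
  by (simp add: L2_inner_def inner_add_left Henstock_Kurzweil_Integration.integral_add L2_integrable_inner)

lemma L2_inner_diff_left:
  "f \<in> L2_controls T \<Longrightarrow> g \<in> L2_controls T \<Longrightarrow> h \<in> L2_controls T \<Longrightarrow>
   L2_inner T (\<lambda>t. f t - g t) h = L2_inner T f h - L2_inner T g h"
  by (simp add: L2_inner_def inner_diff_left Henstock_Kurzweil_Integration.integral_diff L2_integrable_inner)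

lemma L2_inner_scaleR_left: "L2_inner T (\<lambda>t. c *\<^sub>R f t) h = c * L2_inner T f h"
  by (simp add: L2_inner_def)

lemma L2_inner_add_right:
  "f \<in> L2_controls T \<Longrightarrow> g \<in> L2_controls T \<Longrightarrow> h \<in> L2_controls T \<Longrightarrow>
   L2_inner T h (\<lambda>t. f t + g t) = L2_inner T h f + L2_inner T h g"
  by (simp add: L2_inner_def inner_add_right Henstock_Kurzweil_Integration.integral_add L2_integrable_inner)

lemma L2_inner_scaleR_right: "L2_inner T h (\<lambda>t. c *\<^sub>R f t) = c * L2_inner T h f"
  by (simp add: L2_inner_def)

lemma L2_inner_nonneg: "L2_inner T f f \<ge> 0"
proof (cases "(\<lambda>t. f t \<bullet> f t) integrable_on {0..T}")
  case True
  then show ?thesis unfolding L2_inner_def by (rule Henstock_Kurzweil_Integration.integral_nonneg) simp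
qed (simp add: L2_inner_def not_integrable_integral)

text \<open>Serves two purposes: with general \<open>a\<close> it is the Cauchy-Schwarz inequality
  for semidefinite forms, and with \<open>a = 0\<close> it says that the first variation
  \<open>b\<close> vanishes at a minimizer.\<close>

lemma quadratic_nonneg_imp_discriminant:
  fixes a b c :: real
  assumes nonneg: "\<And>s. 0 \<le> a + 2 * s * b + s\<^sup>2 * c" and c: "0 \<le> c"
  shows "b\<^sup>2 \<le> a * c"
proof (cases "c = 0")
  case True
  have "b = 0"
  proof (rule ccontr)
    assume "b \<noteq> 0"
    \<comment> \<open>At this \<open>s\<close> the affine function has the value -1.\<close>
    then show False using nonneg[of "- (a + 1) / (2 * b)"] True by (simp add: field_simps)
  qed
  then show ?thesis using True by simp
next
  case False
  then have "0 \<le> c * (a + 2 * (- b / c) * b + (- b / c)\<^sup>2 * c)"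
    using nonneg[of "- b / c"] c by (simp only: mult_nonneg_nonneg)
  also have "\<dots> = a * c - b\<^sup>2" using False by (simp add: power2_eq_square field_simps)
  finally show ?thesis by simp
qed

lemma L2_inner_Cauchy_Schwarz:
  assumes f: "f \<in> L2_controls T" and g: "g \<in> L2_controls T"
  shows "\<bar>L2_inner T f g\<bar> \<le> sqrt (L2_inner T f f) * sqrt (L2_inner T g g)"
proof -
  have "0 \<le> L2_inner T f f + 2 * s * L2_inner T f g + s\<^sup>2 * L2_inner T g g" for s
  proof -
    have sg: "(\<lambda>t. s *\<^sub>R g t) \<in> L2_controls T" using g by (rule L2_scaleR)
    have sum: "(\<lambda>t. f t + s *\<^sub>R g t) \<in> L2_controls T" using f sg by (rule L2_add)
    have "L2_inner T (\<lambda>t. f t + s *\<^sub>R g t) (\<lambda>t. f t + s *\<^sub>R g t)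
      = L2_inner T f (\<lambda>t. f t + s *\<^sub>R g t) + s * L2_inner T g (\<lambda>t. f t + s *\<^sub>R g t)"
      by (simp add: L2_inner_add_left[OF f sg sum] L2_inner_scaleR_left)
    also have "\<dots> = L2_inner T f f + 2 * s * L2_inner T f g + s\<^sup>2 * L2_inner T g g"
      by (simp add: L2_inner_add_right f g sg L2_inner_scaleR_right L2_inner_commute[of T g f]
          power2_eq_square algebra_simps)
    finally show ?thesis using L2_inner_nonneg by metis
  qed
  from quadratic_nonneg_imp_discriminant[OF this L2_inner_nonneg]
  have "\<bar>L2_inner T f g\<bar>\<^sup>2 \<le> L2_inner T f f * L2_inner T g g" by simp
  then have "\<bar>L2_inner T f g\<bar> \<le> sqrt (L2_inner T f f * L2_inner T g g)" by (rule real_le_rsqrt)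
  then show ?thesis by (simp add: real_sqrt_mult)
qed

lemma L2_inner_self: "L2_inner T f f = integral {0..T} (\<lambda>t. (norm (f t))\<^sup>2)"
  by (simp add: L2_inner_def dot_square_norm)

text \<open>Cauchy-Schwarz against the constant 1. It is the source of every \<open>sqrt t\<close>
  in the trajectory estimates below.\<close>

lemma L2_integral_norm_le_sqrt:
  assumes f: "f \<in> L2_controls T" and T: "0 \<le> T"
  shows "integral {0..T} (\<lambda>t. norm (f t)) \<le> sqrt T * sqrt (L2_inner T f f)"
proof -
  have "\<bar>L2_inner T (\<lambda>_. 1::real) (\<lambda>t. norm (f t))\<bar>
    \<le> sqrt (L2_inner T (\<lambda>_. 1::real) (\<lambda>_. 1)) * sqrt (L2_inner T (\<lambda>t. norm (f t)) (\<lambda>t. norm (f t)))"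
    by (rule L2_inner_Cauchy_Schwarz[OF L2_const L2_norm[OF f]])
  then show ?thesis using T by (simp add: L2_inner_self) (simp add: L2_inner_def)
qed

lemma L2_inner_split:
  assumes f: "f \<in> L2_controls T" and g: "g \<in> L2_controls T" and s: "0 \<le> s" "s \<le> T"
  shows "L2_inner T f g = L2_inner s f g + L2_inner (T - s) (\<lambda>t. f (s + t)) (\<lambda>t. g (s + t))"
  unfolding L2_inner_def
  using Henstock_Kurzweil_Integration.integral_combine[OF s L2_integrable_inner[OF f g]]
  by (simp add: integral_shift_0[of s T])

lemma L2_inner_cong:
  assumes "\<And>t. t \<in> {0..T} \<Longrightarrow> f t = f' t" "\<And>t. t \<in> {0..T} \<Longrightarrow> g t = g' t"
  shows "L2_inner T f g = L2_inner T f' g'"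
  unfolding L2_inner_def by (rule integral_cong) (use assms in simp)

section \<open>Strongly continuous semigroups and mild solutions\<close>

lemma uniform_boundedness:
  fixes T :: "nat \<Rightarrow> 'a::banach \<Rightarrow> 'b::real_normed_vector"
  assumes lin: "\<And>n. bounded_linear (T n)" and bd: "\<And>x. \<exists>c. \<forall>n. norm (T n x) \<le> c"
  obtains M where "\<And>n x. norm (T n x) \<le> M * norm x"
proof -
  \<comment> \<open>These closed sets cover the space, so by Baire's theorem one of them contains a
    ball; linearity moves the bound from there to the origin.\<close>
  define F where "F k = {x. \<forall>n. norm (T n x) \<le> real k}" for k :: nat
  have closed: "closed (F k)" for k
    unfolding F_def
    by (intro closed_Collect_all closed_Collect_le continuous_on_norm continuous_on_const
        linear_continuous_on lin)
  have "\<exists>k. x \<in> F k" for x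
  proof -
    obtain c where c: "\<And>n. norm (T n x) \<le> c" using bd by blast
    obtain k :: nat where "c \<le> real k" using real_arch_simple by blast
    then have "x \<in> F k" using c order_trans unfolding F_def by blast
    then show ?thesis ..
  qed
  then have "\<Union> (range F) = UNIV" by blast
  moreover have "interior (\<Union> (range F)) = {}" if "\<And>k. interior (F k) = {}"
    using Met_TC.metric_Baire_category_alt[of "range F"] that closed by (auto simp: complete_UNIV)
  ultimately obtain k where "interior (F k) \<noteq> {}" by auto
  then obtain a where "a \<in> interior (F k)" by blast
  then obtain r where r: "r > 0" "ball a r \<subseteq> F k" by (auto simp: mem_interior)
  \<comment> \<open>Scaling \<open>x\<close> to norm \<open>r / 2\<close> and writing it as a
    difference of two points of \<open>F k\<close> costs \<open>2 * k\<close>; undoing the scaling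
    gives \<open>4 * k / r\<close>.\<close>
  have "norm (T n x) \<le> (4 * real k / r) * norm x" for n x
  proof (cases "x = 0")
    case True
    then show ?thesis by (simp add: linear_simps(3)[OF lin])
  next
    case False
    define y where "y = (r / (2 * norm x)) *\<^sub>R x"
    have "norm y < r" using False r by (simp add: y_def)
    then have "a + y \<in> F k" "a \<in> F k" using r by (auto simp: dist_norm)
    then have "norm (T n (a + y)) \<le> k" "norm (T n a) \<le> k" by (auto simp: F_def)
    moreover have "T n y = T n (a + y) - T n a" by (simp add: linear_simps[OF lin])
    ultimately have "norm (T n y) \<le> 2 * real k"
      using norm_triangle_ineq4[of "T n (a + y)" "T n a"] by simp
    then have "r / (2 * norm x) * norm (T n x) \<le> 2 * real k"
      using r False by (simp add: y_def linear_simps[OF lin])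
    then show ?thesis using r False by (simp add: field_simps)
  qed
  then show ?thesis by (rule that)
qed

text \<open>The representative is the minimizer of \<open>\<lambda>x. (norm (K x))\<^sup>2 - 2 * f x\<close>.\<close>

lemma Riesz_coercive:
  fixes K :: "'a::{real_inner, complete_space} \<Rightarrow> 'b::real_inner" and f :: "'a \<Rightarrow> real"
  assumes K: "bounded_linear K" and m: "m > 0" "\<And>u. m * (norm u)\<^sup>2 \<le> (norm (K u))\<^sup>2"
    and f: "bounded_linear f"
  obtains x where "\<And>y. K x \<bullet> K y = f y"
proof -
  define J where "J u = (norm (K u))\<^sup>2 - 2 * f u" for u
  obtain c where c: "c > 0" "\<And>u. \<bar>f u\<bar> \<le> norm u * c"
    using bounded_linear.pos_bounded[OF f] by (auto simp: real_norm_def)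
  have lower: "J u \<ge> - (c\<^sup>2 / m)" for u
  proof -
    have "0 \<le> (m * norm u - c)\<^sup>2 / m" using m by simp
    also have "\<dots> = m * (norm u)\<^sup>2 - 2 * (norm u * c) + c\<^sup>2 / m"
      using m by (simp add: power2_eq_square field_simps)
    finally show ?thesis using c(2)[of u] m(2)[of u] unfolding J_def by linarith
  qed
  then have bdd: "bdd_below (range J)" by (rule bdd_belowI2)
  define d where "d = Inf (range J)"
  have d_le: "d \<le> J u" for u unfolding d_def by (rule cInf_lower[OF _ bdd]) simp
  have "\<exists>u. J u < d + inverse (real (Suc n))" for n
    using cInf_lessD[of "range J" "d + inverse (real (Suc n))"] unfolding d_def by auto
  then obtain u where u: "\<And>n. J (u n) < d + inverse (real (Suc n))" by metis
  \<comment> \<open>The parallelogram identity for \<open>K\<close>: two nearly minimizing points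
    have a midpoint that cannot go below \<open>d\<close>, hence they are close. This makes the
    minimizing sequence Cauchy.\<close>
  have par: "m * (norm (v - w))\<^sup>2 \<le> 2 * (J v - d) + 2 * (J w - d)" for v w
  proof -
    have "m * (norm (v - w))\<^sup>2 \<le> (norm (K (v - w)))\<^sup>2" by (rule m)
    also have "\<dots> = 2 * J v + 2 * J w - 4 * J ((1/2) *\<^sub>R (v + w))"
      unfolding J_def by (simp add: linear_simps[OF K] linear_simps[OF f] power2_norm_eq_inner
          inner_simps inner_commute algebra_simps)
    also have "\<dots> \<le> 2 * J v + 2 * J w - 4 * d" by (simp add: d_le)
    finally show ?thesis by (simp add: algebra_simps)
  qed
  have "Cauchy u"
  proof (rule CauchyI)
    fix e :: real assume e: "e > 0"
    then have "m * e\<^sup>2 / 4 > 0" using m by simp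
    then obtain N where N: "inverse (real (Suc N)) < m * e\<^sup>2 / 4" using reals_Archimedean by blast
    have small: "J (u n) - d < m * e\<^sup>2 / 4" if "n \<ge> N" for n
    proof -
      have "inverse (real (Suc n)) \<le> inverse (real (Suc N))" using that by (simp add: le_imp_inverse_le)
      then show ?thesis using u[of n] N by linarith
    qed
    have "norm (u k - u n) < e" if "k \<ge> N" "n \<ge> N" for k n
    proof -
      note par[of "u k" "u n"]
      also have "2 * (J (u k) - d) + 2 * (J (u n) - d) < 2 * (m * e\<^sup>2 / 4) + 2 * (m * e\<^sup>2 / 4)"
        using small that by (intro add_strict_mono mult_strict_left_mono) auto
      also have "\<dots> = m * e\<^sup>2" by simp
      finally have "m * (norm (u k - u n))\<^sup>2 < m * e\<^sup>2" .
      then have "(norm (u k - u n))\<^sup>2 < e\<^sup>2" using m by simp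
      then show ?thesis using e by (simp add: power_less_imp_less_base)
    qed
    then show "\<exists>M. \<forall>k\<ge>M. \<forall>n\<ge>M. norm (u k - u n) < e" by blast
  qed
  then obtain x where x: "u \<longlonglongrightarrow> x" using Cauchy_convergent convergent_def by blast
  have "(\<lambda>n. J (u n)) \<longlonglongrightarrow> J x"
    unfolding J_def
    by (intro tendsto_intros bounded_linear.tendsto[OF K] bounded_linear.tendsto[OF f] x)
  moreover have "(\<lambda>n. d + inverse (real (Suc n))) \<longlonglongrightarrow> d + 0"
    by (intro tendsto_intros LIMSEQ_inverse_real_of_nat)
  ultimately have "J x \<le> d + 0" by (rule LIMSEQ_le) (use u less_imp_le in blast)
  then have Jx: "J x \<le> J y" for y using d_le[of y] by simp
  \<comment> \<open>The first variation of \<open>J\<close> at its minimizer in direction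
    \<open>y\<close>.\<close>
  have "K x \<bullet> K y = f y" for y
  proof -
    have "0 \<le> 0 + 2 * s * (K x \<bullet> K y - f y) + s\<^sup>2 * (norm (K y))\<^sup>2" for s
    proof -
      have "(norm (K x + s *\<^sub>R K y))\<^sup>2
        = (norm (K x))\<^sup>2 + 2 * s * (K x \<bullet> K y) + s\<^sup>2 * (norm (K y))\<^sup>2"
        by (simp add: power2_norm_eq_inner inner_simps inner_commute power2_eq_square[of s] algebra_simps)
      then show ?thesis using Jx[of "x + s *\<^sub>R y"] unfolding J_def
        by (simp add: linear_simps[OF K] linear_simps[OF f] algebra_simps)
    qed
    from quadratic_nonneg_imp_discriminant[OF this] show ?thesis by simp
  qed
  then show ?thesis by (rule that)
qed

section \<open>Local bounds and continuity of the semigroup\<close>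

locale c0_semigroup_loc =
  fixes S :: "real \<Rightarrow> 'h::chilbert_space \<Rightarrow> 'h"
  assumes c0: "c0_semigroup S"
begin

lemma S_bounded_linear: "t \<ge> 0 \<Longrightarrow> bounded_linear (S t)"
  using c0 by (simp add: c0_semigroup_def bounded_clinear_def)

lemma S_scaleC: "t \<ge> 0 \<Longrightarrow> S t (scaleC c x) = scaleC c (S t x)"
  using c0 by (simp add: c0_semigroup_def bounded_clinear_def)

lemmas S_linear = linear_simps[OF S_bounded_linear]

lemma S_0: "S 0 x = x" and S_add: "s \<ge> 0 \<Longrightarrow> t \<ge> 0 \<Longrightarrow> S (s + t) x = S s (S t x)"
  and S_lim: "((\<lambda>t. S t x) \<longlongrightarrow> x) (at_right 0)"
  using c0 by (simp_all add: c0_semigroup_def)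

text \<open>If no such bound existed, there would be times decreasing to 0 with operators of
  unbounded norm. Along these times \<open>S t y\<close> converges for every \<open>y\<close>, which
  contradicts uniform boundedness.\<close>

lemma S_bound_near_0: "\<exists>\<delta>>0. \<exists>M\<ge>1. \<forall>t\<in>{0..\<delta>}. \<forall>x. norm (S t x) \<le> M * norm x"
proof (rule ccontr)
  assume neg: "\<not> ?thesis"
  have "\<exists>t x. 0 < t \<and> t \<le> inverse (real (Suc n)) \<and> norm (S t x) > real (Suc n) * norm x" for n
  proof -
    have "\<not> (\<forall>t\<in>{0..inverse (real (Suc n))}. \<forall>x. norm (S t x) \<le> real (Suc n) * norm x)"
      using neg by (metis Suc_le_mono inverse_positive_iff_positive le0 of_nat_0_less_iff of_nat_1
          of_nat_le_iff One_nat_def zero_less_Suc)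
    then obtain t x where tx: "t \<in> {0..inverse (real (Suc n))}" "norm (S t x) > real (Suc n) * norm x"
      by (meson not_le)
    have "t \<noteq> 0"
    proof
      assume "t = 0"
      then have "real (Suc n) * norm x < 1 * norm x" using tx(2) by (simp add: S_0)
      moreover have "1 * norm x \<le> real (Suc n) * norm x" by (rule mult_right_mono) auto
      ultimately show False by linarith
    qed
    then show ?thesis using tx by (intro exI[of _ t] exI[of _ x]) auto
  qed
  then obtain t x where t: "\<And>n. 0 < t n" "\<And>n. t n \<le> inverse (real (Suc n))"
    and x: "\<And>n. norm (S (t n) (x n)) > real (Suc n) * norm (x n)" by metis
  have "t \<longlonglongrightarrow> 0"
    by (rule tendsto_sandwich[OF _ _ tendsto_const LIMSEQ_inverse_real_of_nat])
      (use t less_imp_le in \<open>auto intro!: always_eventually\<close>)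
  then have "filterlim t (at_right 0) sequentially"
    using t(1) less_imp_neq[OF t(1)] by (auto simp: filterlim_at intro!: always_eventually)
  then have "(\<lambda>n. S (t n) y) \<longlonglongrightarrow> y" for y
    by (rule filterlim_compose[OF S_lim])
  then have "Bseq (\<lambda>n. S (t n) y)" for y using convergent_imp_Bseq convergentI by blast
  then have "\<exists>c. \<forall>n. norm (S (t n) y) \<le> c" for y unfolding Bseq_def by blast
  then obtain M where M: "\<And>n y. norm (S (t n) y) \<le> M * norm y"
    using uniform_boundedness[of "\<lambda>n. S (t n)"] S_bounded_linear t(1) less_imp_le by metis
  obtain n where n: "M \<le> real n" using real_arch_simple by blast
  have "real (Suc n) * norm (x n) < M * norm (x n)" using x[of n] M[of n "x n"] by linarith
  moreover have "M * norm (x n) \<le> real (Suc n) * norm (x n)" using n by (intro mult_right_mono) auto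
  ultimately show False by linarith
qed

text \<open>A time up to \<open>n * \<delta>\<close> is cut into at most \<open>n\<close> pieces of
  length at most \<delta>, each costing a factor \<open>M\<close>.\<close>

lemma S_bound_ex: "\<exists>M\<ge>1. \<forall>t\<in>{0..T}. \<forall>x. norm (S t x) \<le> M * norm x"
proof -
  obtain \<delta> M where \<delta>: "\<delta> > 0" and M: "M \<ge> 1" "\<And>t x. t \<in> {0..\<delta>} \<Longrightarrow> norm (S t x) \<le> M * norm x"
    using S_bound_near_0 by blast
  have "\<forall>t\<in>{0..real n * \<delta>}. \<forall>x. norm (S t x) \<le> M ^ n * norm x" for n
  proof (induction n)
    case 0
    then show ?case by (simp add: S_0)
  next
    case (Suc n)
    have "norm (S t x) \<le> M ^ Suc n * norm x" if t: "t \<in> {0..real (Suc n) * \<delta>}" for t x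
    proof -
      define r where "r = min t \<delta>"
      have r: "r \<in> {0..\<delta>}" using t \<delta> by (auto simp: r_def)
      have tr: "t - r \<in> {0..real n * \<delta>}" using t \<delta> by (auto simp: r_def min_def algebra_simps)
      have "S t x = S (t - r) (S r x)" using S_add[of "t - r" r x] r tr by simp
      then have "norm (S t x) \<le> M ^ n * norm (S r x)" using Suc tr by auto
      also have "\<dots> \<le> M ^ n * (M * norm x)" using M r by (intro mult_left_mono) auto
      finally show ?thesis by (simp add: algebra_simps)
    qed
    then show ?case by blast
  qed
  moreover obtain n :: nat where n: "T \<le> real n * \<delta>"
    using real_arch_simple[of "T / \<delta>"] \<delta> by (auto simp: pos_divide_le_eq)
  ultimately show ?thesis using M(1) by (intro exI[of _ "M ^ n"]) auto
qed

text \<open>An arbitrary choice for each \<open>T\<close>, so nothing is known about its dependence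
  on \<open>T\<close>. The estimates below hence name the interval whose bound they use, often as a
  separate \<open>t1\<close>.\<close>

definition S_bd :: "real \<Rightarrow> real" where
  "S_bd T = (SOME M. M \<ge> 1 \<and> (\<forall>t\<in>{0..T}. \<forall>x. norm (S t x) \<le> M * norm x))"

lemma S_bd: "S_bd T \<ge> 1" "t \<in> {0..T} \<Longrightarrow> norm (S t x) \<le> S_bd T * norm x"
  using someI_ex[OF S_bound_ex[of T, unfolded Bex_def]] S_bound_ex[of T] unfolding S_bd_def
  by (metis (mono_tags, lifting) someI_ex)+

text \<open>Only right continuity at 0 is given. Factoring out the operator at the earlier of two
  times, \<open>S b x - S a x = S a (S (b - a) x - x)\<close>, treats approach from the left and
  from the right alike.\<close>

lemma S_continuous: "continuous_on {0..T} (\<lambda>t. S t x)"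
  unfolding continuous_on_iff
proof (intro ballI allI impI)
  fix t e :: real assume t: "t \<in> {0..T}" and e: "e > 0"
  have "e / S_bd T > 0" using e S_bd(1)[of T] by simp
  then obtain \<delta> where \<delta>: "\<delta> > 0" "\<And>h. 0 < h \<Longrightarrow> h < \<delta> \<Longrightarrow> dist (S h x) x < e / S_bd T"
    using S_lim[of x, THEN tendstoD, of "e / S_bd T"] unfolding eventually_at_right_field by auto
  have key: "norm (S b x - S a x) < e" if ab: "0 \<le> a" "a \<le> b" "b \<le> T" "b - a < \<delta>" for a b
  proof (cases "a = b")
    case False
    have "S b x - S a x = S a (S (b - a) x - x)"
      using S_add[of a "b - a" x] ab by (simp add: S_linear)
    then have "norm (S b x - S a x) \<le> S_bd T * norm (S (b - a) x - x)" using S_bd(2)[of a T] ab by simp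
    also have "\<dots> < S_bd T * (e / S_bd T)"
      using \<delta>(2)[of "b - a"] ab False S_bd(1)[of T] by (intro mult_strict_left_mono) (auto simp: dist_norm)
    finally show ?thesis using S_bd(1)[of T] by simp
  qed (use e in simp)
  show "\<exists>d>0. \<forall>x'\<in>{0..T}. dist x' t < d \<longrightarrow> dist (S x' x) (S t x) < e"
  proof (intro exI[of _ \<delta>] conjI ballI impI \<delta>(1))
    fix t' assume t': "t' \<in> {0..T}" "dist t' t < \<delta>"
    then show "dist (S t' x) (S t x) < e"
      using key[of t t'] key[of t' t] t by (cases "t \<le> t'") (auto simp: dist_norm norm_minus_commute)
  qed
qed

end

section \<open>Mild solutions: linearity, causality, continuity\<close>

locale control_system = c0_semigroup_loc S
  for S :: "real \<Rightarrow> 'h::chilbert_space \<Rightarrow> 'h" +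
  fixes B :: "'u::chilbert_space \<Rightarrow> 'h"
  assumes B: "bounded_clinear B"
begin

lemma B_bounded_linear: "bounded_linear B" and B_scaleC: "B (scaleC c u) = scaleC c (B u)"
  using B by (simp_all add: bounded_clinear_def)

lemmas B_linear = linear_simps[OF B_bounded_linear]

definition nB :: real where "nB = onorm B"

lemma nB: "nB \<ge> 0" "norm (B u) \<le> nB * norm u"
  unfolding nB_def using onorm_pos_le[OF B_bounded_linear] onorm[OF B_bounded_linear] by auto

abbreviation traj :: "'h \<Rightarrow> (real \<Rightarrow> 'u) \<Rightarrow> real \<Rightarrow> 'h" where
  "traj \<equiv> mild_solution S B"

lemma convolution_L2:
  assumes u: "u \<in> L2_controls t"
  shows "(\<lambda>s. S (t - s) (B (u s))) \<in> L2_controls t"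
proof (rule L2_operator_family[where G = "\<lambda>s x. S (t - s) (B x)" and M = "S_bd t * nB"])
  show "norm (S (t - r) (B x)) \<le> S_bd t * nB * norm x" if "r \<in> {0..t}" for r x
  proof -
    have "norm (S (t - r) (B x)) \<le> S_bd t * norm (B x)" using S_bd(2) that by simp
    also have "\<dots> \<le> S_bd t * (nB * norm x)" using nB S_bd(1)[of t] by (intro mult_left_mono) auto
    finally show ?thesis by simp
  qed
  show "continuous_on {0..t} (\<lambda>r. S (t - r) (B x))" for x
    by (rule continuous_on_compose2[OF S_continuous[of t]]) (auto intro!: continuous_intros)
qed (use u in \<open>auto simp: B_linear S_linear\<close>)

lemma convolution_integrable:
  "u \<in> L2_controls t \<Longrightarrow> (\<lambda>s. S (t - s) (B (u s))) integrable_on {0..t}"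
  by (rule L2_integrable_on[OF convolution_L2])

lemma convolution_norm_le:
  assumes u: "u \<in> L2_controls t" and t: "0 \<le> t" "t \<le> T"
  shows "norm (integral {0..t} (\<lambda>s. S (t - s) (B (u s))))
    \<le> S_bd T * nB * integral {0..t} (\<lambda>s. norm (u s))"
proof -
  have "norm (integral {0..t} (\<lambda>s. S (t - s) (B (u s))))
    \<le> integral {0..t} (\<lambda>s. S_bd T * nB * norm (u s))"
  proof (rule integral_norm_bound_integral[OF convolution_integrable[OF u]])
    show "(\<lambda>s. S_bd T * nB * norm (u s)) integrable_on {0..t}"
      by (intro integrable_on_mult_right L2_integrable_norm u)
    show "norm (S (t - s) (B (u s))) \<le> S_bd T * nB * norm (u s)" if "s \<in> {0..t}" for s
    proof -
      have "norm (S (t - s) (B (u s))) \<le> S_bd T * norm (B (u s))" using S_bd(2)[of "t - s" T] that t by simp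
      also have "\<dots> \<le> S_bd T * (nB * norm (u s))" using nB S_bd(1)[of T] by (intro mult_left_mono) auto
      finally show ?thesis by simp
    qed
  qed
  then show ?thesis by simp
qed

lemma traj_0: "traj w u 0 = w"
  by (simp add: mild_solution_def S_0)

lemma traj_zero_control: "0 \<le> t \<Longrightarrow> traj w (\<lambda>_. 0) t = S t w"
proof -
  have "integral {0..t} (\<lambda>s. S (t - s) (B 0)) = integral {0..t} (\<lambda>s. 0)"
    by (rule integral_cong) (simp add: B_linear S_linear)
  then show ?thesis by (simp add: mild_solution_def)
qed

lemma traj_add:
  assumes "u \<in> L2_controls t" "u' \<in> L2_controls t" "0 \<le> t"
  shows "traj (w + w') (\<lambda>s. u s + u' s) t = traj w u t + traj w' u' t"
proof -
  have "integral {0..t} (\<lambda>s. S (t - s) (B (u s + u' s)))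
    = integral {0..t} (\<lambda>s. S (t - s) (B (u s)) + S (t - s) (B (u' s)))"
    by (rule integral_cong) (simp add: B_linear S_linear)
  then show ?thesis
    using assms by (simp add: mild_solution_def S_linear convolution_integrable
        Henstock_Kurzweil_Integration.integral_add)
qed

lemma traj_scaleR:
  assumes "0 \<le> t"
  shows "traj (c *\<^sub>R w) (\<lambda>s. c *\<^sub>R u s) t = c *\<^sub>R traj w u t"
proof -
  have "integral {0..t} (\<lambda>s. S (t - s) (B (c *\<^sub>R u s))) = integral {0..t} (\<lambda>s. c *\<^sub>R S (t - s) (B (u s)))"
    by (rule integral_cong) (simp add: B_linear S_linear)
  then show ?thesis using assms by (simp add: mild_solution_def S_linear scaleR_add_right)
qed

lemma traj_diff:
  assumes "u \<in> L2_controls t" "u' \<in> L2_controls t" "0 \<le> t"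
  shows "traj (w - w') (\<lambda>s. u s - u' s) t = traj w u t - traj w' u' t"
  using traj_add[OF assms(1) L2_scaleR[OF assms(2), of "-1"] assms(3), of w "- w'"]
    traj_scaleR[OF assms(3), of "-1" w' u'] by simp

text \<open>The class ties the norm to real scalars only; for complex ones the value is computed
  from \<open>cinner\<close> of the scaled vector with itself.\<close>

lemma (in -) norm_scaleC: "norm (scaleC c x) = cmod c * norm (x :: 'a::complex_inner)"
proof -
  have "complex_of_real ((norm (scaleC c x))\<^sup>2) = cinner (scaleC c x) (scaleC c x)"
    using Re_cinner[of "scaleC c x" "scaleC c x"] cinner_commute[of "scaleC c x" "scaleC c x"]
    by (simp add: complex_eq_iff power2_norm_eq_inner)
  also have "\<dots> = c * cnj (cinner (scaleC c x) x)"
    by (simp only: cinner_scaleC_left cinner_commute[of x "scaleC c x"])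
  also have "\<dots> = c * cnj c * cnj (cinner x x)"
    by (simp add: cinner_scaleC_left)
  finally have "(norm (scaleC c x))\<^sup>2 = Re (c * cnj c * cnj (cinner x x))"
    by (metis Re_complex_of_real)
  also have "\<dots> = (cmod c)\<^sup>2 * (norm x)\<^sup>2"
    using Re_cinner[of x x] by (simp add: complex_mult_cnj cmod_power2 power2_norm_eq_inner)
  finally have "(norm (scaleC c x))\<^sup>2 = (cmod c * norm x)\<^sup>2" by (simp add: power_mult_distrib)
  then show ?thesis by simp
qed

lemma (in -) bounded_linear_scaleC: "bounded_linear (scaleC c :: 'a::complex_inner \<Rightarrow> 'a)"
proof (rule bounded_linear_intro[where K = "cmod c"])
  show "scaleC c (r *\<^sub>R x) = r *\<^sub>R scaleC c x" for r and x :: 'a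
    by (simp add: scaleC_of_real[symmetric] scaleC_scaleC mult.commute)
qed (simp_all add: scaleC_add_right norm_scaleC mult.commute)

lemma traj_scaleC:
  assumes "0 \<le> t" "u \<in> L2_controls t"
  shows "traj (scaleC c w) (\<lambda>s. scaleC c (u s)) t = scaleC c (traj w u t)"
proof -
  have "integral {0..t} (\<lambda>s. S (t - s) (B (scaleC c (u s))))
    = integral {0..t} (scaleC c \<circ> (\<lambda>s. S (t - s) (B (u s))))"
    by (rule integral_cong) (simp add: B_scaleC S_scaleC)
  also have "\<dots> = scaleC c (integral {0..t} (\<lambda>s. S (t - s) (B (u s))))"
    by (rule integral_linear[OF convolution_integrable[OF assms(2)] bounded_linear_scaleC])
  finally show ?thesis using assms by (simp add: mild_solution_def S_scaleC scaleC_add_right)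
qed

lemma traj_norm_le:
  assumes u: "u \<in> L2_controls t" and t: "0 \<le> t" "t \<le> T"
  shows "norm (traj w u t) \<le> S_bd T * (norm w + nB * integral {0..t} (\<lambda>s. norm (u s)))"
proof -
  have "norm (traj w u t) \<le> norm (S t w) + norm (integral {0..t} (\<lambda>s. S (t - s) (B (u s))))"
    unfolding mild_solution_def by (rule norm_triangle_ineq)
  also have "\<dots> \<le> S_bd T * norm w + S_bd T * nB * integral {0..t} (\<lambda>s. norm (u s))"
    by (intro add_mono convolution_norm_le[OF u t] S_bd(2)) (use t in auto)
  finally show ?thesis by (simp add: algebra_simps)
qed

text \<open>The control at the final time itself does not matter, so a concatenated trajectory can
  be read up to and including its junction.\<close>

lemma traj_cong:
  assumes "\<And>s. 0 \<le> s \<Longrightarrow> s < t \<Longrightarrow> u s = u' s"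
  shows "traj w u t = traj w u' t"
proof -
  have "integral {0..t} (\<lambda>s. S (t - s) (B (u s))) = integral {0..t} (\<lambda>s. S (t - s) (B (u' s)))"
    by (rule integral_spike[of "{t}"]) (use assms in auto)
  then show ?thesis by (simp add: mild_solution_def)
qed

lemma traj_shift:
  assumes u: "u \<in> L2_controls T" and st: "0 \<le> s" "0 \<le> t" "s + t \<le> T"
  shows "traj w u (s + t) = traj (traj w u s) (\<lambda>r. u (s + r)) t"
proof -
  have ust: "u \<in> L2_controls (s + t)" and us: "u \<in> L2_controls s"
    using u st by (auto intro: L2_subset)
  let ?f = "\<lambda>r. S (s + t - r) (B (u r))"
  have "integral {0..s + t} ?f = integral {0..s} ?f + integral {s..s + t} ?f"
    by (rule Henstock_Kurzweil_Integration.integral_combine[symmetric])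
      (use st convolution_integrable[OF ust] in auto)
  also have "integral {0..s} ?f = integral {0..s} (S t \<circ> (\<lambda>r. S (s - r) (B (u r))))"
    using st by (intro integral_cong) (simp add: S_add[symmetric] add.commute add_diff_eq)
  also have "\<dots> = S t (integral {0..s} (\<lambda>r. S (s - r) (B (u r))))"
    by (rule integral_linear[OF convolution_integrable[OF us] S_bounded_linear[OF st(2)]])
  also have "integral {s..s + t} ?f = integral {0..t} (\<lambda>r. S (t - r) (B (u (s + r))))"
    using integral_shift_0[of s "s + t" ?f] by simp
  finally show ?thesis
    using st S_add[of t s w] by (simp add: mild_solution_def S_linear add.commute)
qed

lemma traj_concat_before:
  "t \<le> s \<Longrightarrow> traj w (concat_control s f g) t = traj w f t"
  by (rule traj_cong) (simp add: concat_control_def)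

text \<open>Both the integrand and the domain of the convolution move with \<open>t\<close>.
  Extending the semigroup by the identity to negative times fixes the domain \<open>{0..T}\<close>;
  the surplus over \<open>{t..T}\<close> is then just the integral of \<open>B (u s)\<close>. What
  remains is continuous by dominated convergence.\<close>

lemma traj_continuous:
  assumes u: "u \<in> L2_controls T"
  shows "continuous_on {0..T} (traj w u)"
proof -
  define R where "R r = S (max r 0)" for r
  have R_cont: "continuous_on UNIV (\<lambda>r. R r x)" for x
  proof -
    have "continuous_on {a..b} (\<lambda>r. R r x)" for a b
      unfolding R_def
      by (rule continuous_on_compose2[OF S_continuous[of "max b 0"]]) (auto intro!: continuous_intros)
    then have "isCont (\<lambda>r. R r x) r" for r
      using continuous_on_interior[of "{r - 1..r + 1}" "\<lambda>r. R r x" r] by simp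
    then show ?thesis by (simp add: continuous_at_imp_continuous_on)
  qed
  have R_bl: "bounded_linear (R r)" for r unfolding R_def by (rule S_bounded_linear) simp
  note R_lin = linear_simps[OF R_bl]
  have R_bd: "norm (R r x) \<le> S_bd T * norm x" if "r \<le> T" "0 \<le> T" for r x
    unfolding R_def using that by (intro S_bd) auto
  have R_L2: "(\<lambda>s. R (t - s) (B (u s))) \<in> L2_controls T" if t: "t \<in> {0..T}" for t
  proof (rule L2_operator_family[where G = "\<lambda>s x. R (t - s) (B x)" and M = "S_bd T * nB"])
    show "norm (R (t - r) (B x)) \<le> S_bd T * nB * norm x" if "r \<in> {0..T}" for r x
    proof -
      have "norm (R (t - r) (B x)) \<le> S_bd T * norm (B x)" using that t by (intro R_bd) auto
      also have "\<dots> \<le> S_bd T * (nB * norm x)" using nB S_bd(1)[of T] by (intro mult_left_mono) auto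
      finally show ?thesis by simp
    qed
    show "continuous_on {0..T} (\<lambda>r. R (t - r) (B x))" for x
      by (rule continuous_on_compose2[OF R_cont]) (auto intro!: continuous_intros)
  qed (use u in \<open>auto simp: B_linear R_lin\<close>)
  define P where "P t = integral {0..T} (\<lambda>s. R (t - s) (B (u s)))" for t
  have P_cont: "continuous_on {0..T} P"
  proof (rule continuous_on_sequentiallyI)
    fix x :: "nat \<Rightarrow> real" and a
    assume x: "\<forall>n. x n \<in> {0..T}" "a \<in> {0..T}" "x \<longlonglongrightarrow> a"
    have diff: "(\<lambda>s. R (x n - s) (B (u s)) - R (a - s) (B (u s))) \<in> L2_controls T" for n
      using x by (intro L2_diff R_L2) auto
    have "(\<lambda>n. integral {0..T} (\<lambda>s. norm (R (x n - s) (B (u s)) - R (a - s) (B (u s)))))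
      \<longlonglongrightarrow> integral {0..T} (\<lambda>s. 0)"
    proof (rule Equivalence_Lebesgue_Henstock_Integration.dominated_convergence(2))
      show "(\<lambda>s. norm (R (x n - s) (B (u s)) - R (a - s) (B (u s)))) integrable_on {0..T}" for n
        by (rule L2_integrable_norm[OF diff])
      show "(\<lambda>s. 2 * S_bd T * norm (B (u s))) integrable_on {0..T}"
        by (intro integrable_on_mult_right L2_integrable_norm L2_bounded_linear[OF B_bounded_linear] u)
      fix s assume s: "s \<in> {0..T}"
      show "norm (norm (R (x n - s) (B (u s)) - R (a - s) (B (u s)))) \<le> 2 * S_bd T * norm (B (u s))" for n
      proof -
        have "norm (R (x n - s) (B (u s)) - R (a - s) (B (u s)))
          \<le> norm (R (x n - s) (B (u s))) + norm (R (a - s) (B (u s)))" by (rule norm_triangle_ineq4)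
        also have "\<dots> \<le> S_bd T * norm (B (u s)) + S_bd T * norm (B (u s))"
          using x(1)[rule_format, of n] x(2) s by (intro add_mono R_bd) auto
        finally show ?thesis by simp
      qed
      have "(\<lambda>n. R (x n - s) (B (u s))) \<longlonglongrightarrow> R (a - s) (B (u s))"
        by (rule continuous_on_tendsto_compose[OF R_cont]) (auto intro!: tendsto_intros x)
      then show "(\<lambda>n. norm (R (x n - s) (B (u s)) - R (a - s) (B (u s)))) \<longlonglongrightarrow> 0"
        by (intro tendsto_norm_zero) (simp add: LIM_zero_iff)
    qed
    then have lim: "(\<lambda>n. integral {0..T} (\<lambda>s. norm (R (x n - s) (B (u s)) - R (a - s) (B (u s))))) \<longlonglongrightarrow> 0"
      by simp
    have "P (x n) - P a = integral {0..T} (\<lambda>s. R (x n - s) (B (u s)) - R (a - s) (B (u s)))" for n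
      unfolding P_def using x
      by (intro Henstock_Kurzweil_Integration.integral_diff[symmetric] L2_integrable_on R_L2) auto
    then have "norm (P (x n) - P a)
      \<le> integral {0..T} (\<lambda>s. norm (R (x n - s) (B (u s)) - R (a - s) (B (u s))))" for n
      using L2_integral_norm_le[OF diff] by simp
    then have "(\<lambda>n. norm (P (x n) - P a)) \<longlonglongrightarrow> 0"
      by (intro tendsto_sandwich[OF _ _ tendsto_const lim]) auto
    then show "(\<lambda>n. P (x n)) \<longlonglongrightarrow> P a" using tendsto_norm_zero_iff LIM_zero_iff by blast
  qed
  have Bu: "(\<lambda>s. B (u s)) integrable_on {0..T}"
    by (rule L2_integrable_on[OF L2_bounded_linear[OF B_bounded_linear u]])
  have eq: "traj w u t = S t w + (P t - integral {t..T} (\<lambda>s. B (u s)))" if t: "t \<in> {0..T}" for t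
  proof -
    have "P t = integral {0..t} (\<lambda>s. R (t - s) (B (u s))) + integral {t..T} (\<lambda>s. R (t - s) (B (u s)))"
      unfolding P_def using t
      by (intro Henstock_Kurzweil_Integration.integral_combine[symmetric] L2_integrable_on R_L2) auto
    also have "integral {0..t} (\<lambda>s. R (t - s) (B (u s))) = integral {0..t} (\<lambda>s. S (t - s) (B (u s)))"
      by (rule integral_cong) (simp add: R_def)
    also have "integral {t..T} (\<lambda>s. R (t - s) (B (u s))) = integral {t..T} (\<lambda>s. B (u s))"
      by (rule integral_cong) (simp add: R_def S_0)
    finally show ?thesis by (simp add: mild_solution_def)
  qed
  have cont: "continuous_on {0..T} (\<lambda>t. S t w + (P t - integral {t..T} (\<lambda>s. B (u s))))"
    by (intro continuous_intros S_continuous P_cont indefinite_integral_continuous_1' Bu)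
  show ?thesis by (rule continuous_on_eq[OF cont eq[symmetric]])
qed

lemma traj_L2: "u \<in> L2_controls T \<Longrightarrow> traj w u \<in> L2_controls T"
  by (rule L2_continuous[OF traj_continuous])

end

section \<open>The homogeneous quadratic problem\<close>

text \<open>Through this adjoint relation the real forms below remember complex linearity.\<close>

lemma inner_scaleC_left: "scaleC c x \<bullet> y = x \<bullet> scaleC (cnj c) (y :: 'a::complex_inner)"
proof -
  have "cinner (scaleC c x) y = cinner x (scaleC (cnj c) y)"
    using cinner_commute[of x "scaleC (cnj c) y"] cinner_commute[of x y]
    by (simp add: cinner_scaleC_left)
  then show ?thesis by (metis Re_cinner)
qed

lemma L2_scaleC:
  "f \<in> L2_controls T \<Longrightarrow> (\<lambda>t. scaleC c (f t :: 'a::complex_inner)) \<in> L2_controls T"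
  by (rule L2_bounded_linear[OF bounded_linear_scaleC])

locale lq_system = control_system S B
  for S :: "real \<Rightarrow> 'h::chilbert_space \<Rightarrow> 'h" and B :: "'u::chilbert_space \<Rightarrow> 'h" +
  fixes C :: "'h \<Rightarrow> 'y::chilbert_space" and K :: "'u \<Rightarrow> 'u" and m :: real
  assumes C: "bounded_clinear C" and K: "bounded_clinear K"
    and m_pos: "m > 0" and K_coercive: "m * (norm u)\<^sup>2 \<le> (norm (K u))\<^sup>2"
begin

lemma C_bounded_linear: "bounded_linear C" and C_scaleC: "C (scaleC c x) = scaleC c (C x)"
  and K_bounded_linear: "bounded_linear K" and K_scaleC: "K (scaleC c u) = scaleC c (K u)"
  using C K by (simp_all add: bounded_clinear_def)

lemmas C_linear = linear_simps[OF C_bounded_linear]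
lemmas K_linear = linear_simps[OF K_bounded_linear]

definition nC :: real where "nC = onorm C"
definition nK :: real where "nK = onorm K"

lemma nC: "nC \<ge> 0" "norm (C x) \<le> nC * norm x"
  unfolding nC_def using onorm_pos_le[OF C_bounded_linear] onorm[OF C_bounded_linear] by auto

lemma nK: "nK \<ge> 0" "norm (K x) \<le> nK * norm x"
  unfolding nK_def using onorm_pos_le[OF K_bounded_linear] onorm[OF K_bounded_linear] by auto

text \<open>The polarization of the homogeneous cost. It is bilinear in the pairs of initial state
  and control, not in the two components separately.\<close>

definition form :: "real \<Rightarrow> 'h \<Rightarrow> (real \<Rightarrow> 'u) \<Rightarrow> 'h \<Rightarrow> (real \<Rightarrow> 'u) \<Rightarrow> real" where
  "form T w u w' u' = L2_inner T (\<lambda>t. C (traj w u t)) (\<lambda>t. C (traj w' u' t))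
     + L2_inner T (\<lambda>t. K (u t)) (\<lambda>t. K (u' t))"

lemma C_traj_L2: "u \<in> L2_controls T \<Longrightarrow> (\<lambda>t. C (traj w u t)) \<in> L2_controls T"
  by (rule L2_bounded_linear[OF C_bounded_linear traj_L2])

lemma K_L2: "u \<in> L2_controls T \<Longrightarrow> (\<lambda>t. K (u t)) \<in> L2_controls T"
  by (rule L2_bounded_linear[OF K_bounded_linear])

lemma form_commute: "form T w u w' u' = form T w' u' w u"
  unfolding form_def by (metis L2_inner_commute)

lemma form_nonneg: "form T w u w u \<ge> 0"
  unfolding form_def by (intro add_nonneg_nonneg L2_inner_nonneg)

lemma form_cong:
  assumes "\<And>t. t \<in> {0..T} \<Longrightarrow> u t = v t" "\<And>t. t \<in> {0..T} \<Longrightarrow> u' t = v' t"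
  shows "form T w u w' u' = form T w v w' v'"
proof -
  have "traj w u t = traj w v t" "traj w' u' t = traj w' v' t" if "t \<in> {0..T}" for t
    using that assms by (auto intro!: traj_cong)
  then show ?thesis unfolding form_def using assms
    by (intro arg_cong2[where f="(+)"] L2_inner_cong) auto
qed

lemma form_add_left:
  assumes u: "u \<in> L2_controls T" and v: "v \<in> L2_controls T" and h: "h \<in> L2_controls T"
  shows "form T (w + w') (\<lambda>t. u t + v t) y h = form T w u y h + form T w' v y h"
proof -
  have "L2_inner T (\<lambda>t. C (traj (w + w') (\<lambda>t. u t + v t) t)) (\<lambda>t. C (traj y h t))
    = L2_inner T (\<lambda>t. C (traj w u t) + C (traj w' v t)) (\<lambda>t. C (traj y h t))"
  proof (rule L2_inner_cong)
    fix t assume t: "t \<in> {0..T}"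
    then have "u \<in> L2_controls t" "v \<in> L2_controls t" using u v by (auto intro: L2_subset)
    from traj_add[OF this, of w w'] t
    show "C (traj (w + w') (\<lambda>t. u t + v t) t) = C (traj w u t) + C (traj w' v t)"
      by (simp add: C_linear)
  qed simp
  then show ?thesis
    by (simp add: form_def K_linear L2_inner_add_left C_traj_L2 K_L2 assms)
qed

lemma form_scaleR_left: "form T (c *\<^sub>R w) (\<lambda>t. c *\<^sub>R u t) y h = c * form T w u y h"
proof -
  have "L2_inner T (\<lambda>t. C (traj (c *\<^sub>R w) (\<lambda>t. c *\<^sub>R u t) t)) (\<lambda>t. C (traj y h t))
    = L2_inner T (\<lambda>t. c *\<^sub>R C (traj w u t)) (\<lambda>t. C (traj y h t))"
    by (rule L2_inner_cong) (simp_all add: traj_scaleR C_linear)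
  then show ?thesis by (simp add: form_def K_linear L2_inner_scaleR_left algebra_simps)
qed

lemma form_diff_left:
  assumes u: "u \<in> L2_controls T" and v: "v \<in> L2_controls T" and h: "h \<in> L2_controls T"
  shows "form T (w - w') (\<lambda>t. u t - v t) y h = form T w u y h - form T w' v y h"
  using form_add_left[OF u L2_scaleR[OF v, of "-1"] h, of w "- w'"]
    form_scaleR_left[of T "-1" w' v y h] by simp

lemma form_add_right:
  assumes "u \<in> L2_controls T" "v \<in> L2_controls T" "h \<in> L2_controls T"
  shows "form T y h (w + w') (\<lambda>t. u t + v t) = form T y h w u + form T y h w' v"
  using form_add_left[OF assms] by (metis form_commute)

lemma form_diff_right:
  assumes "u \<in> L2_controls T" "v \<in> L2_controls T" "h \<in> L2_controls T"
  shows "form T y h (w - w') (\<lambda>t. u t - v t) = form T y h w u - form T y h w' v"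
  using form_diff_left[OF assms] by (metis form_commute)

lemma form_scaleR_right: "form T y h (c *\<^sub>R w) (\<lambda>t. c *\<^sub>R u t) = c * form T y h w u"
  using form_scaleR_left by (metis form_commute)

lemma form_scaleC:
  assumes u: "u \<in> L2_controls T" and h: "h \<in> L2_controls T"
  shows "form T (scaleC c w) (\<lambda>t. scaleC c (u t)) y h = form T w u (scaleC (cnj c) y) (\<lambda>t. scaleC (cnj c) (h t))"
proof -
  have "L2_inner T (\<lambda>t. C (traj (scaleC c w) (\<lambda>t. scaleC c (u t)) t)) (\<lambda>t. C (traj y h t))
    = L2_inner T (\<lambda>t. C (traj w u t)) (\<lambda>t. C (traj (scaleC (cnj c) y) (\<lambda>t. scaleC (cnj c) (h t)) t))"
    unfolding L2_inner_def
  proof (rule integral_cong)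
    fix t assume t: "t \<in> {0..T}"
    then have "u \<in> L2_controls t" "h \<in> L2_controls t" using u h by (auto intro: L2_subset)
    then show "C (traj (scaleC c w) (\<lambda>t. scaleC c (u t)) t) \<bullet> C (traj y h t)
      = C (traj w u t) \<bullet> C (traj (scaleC (cnj c) y) (\<lambda>t. scaleC (cnj c) (h t)) t)"
      using t by (simp add: traj_scaleC C_scaleC inner_scaleC_left)
  qed
  then show ?thesis by (simp add: form_def K_scaleC L2_inner_def inner_scaleC_left)
qed

lemma form_split:
  assumes u: "u \<in> L2_controls T" and v: "v \<in> L2_controls T" and s: "0 \<le> s" "s \<le> T"
  shows "form T w u w' v = form s w u w' v
    + form (T - s) (traj w u s) (\<lambda>r. u (s + r)) (traj w' v s) (\<lambda>r. v (s + r))"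
proof -
  have "L2_inner (T - s) (\<lambda>t. C (traj w u (s + t))) (\<lambda>t. C (traj w' v (s + t)))
    = L2_inner (T - s) (\<lambda>t. C (traj (traj w u s) (\<lambda>r. u (s + r)) t))
        (\<lambda>t. C (traj (traj w' v s) (\<lambda>r. v (s + r)) t))"
    using s by (intro L2_inner_cong) (simp_all add: traj_shift[OF u] traj_shift[OF v])
  then show ?thesis
    by (simp add: form_def L2_inner_split[OF C_traj_L2[OF u] C_traj_L2[OF v] s]
        L2_inner_split[OF K_L2[OF u] K_L2[OF v] s])
qed

lemma form_mono:
  assumes u: "u \<in> L2_controls T" and s: "0 \<le> s" "s \<le> T"
  shows "form s w u w u \<le> form T w u w u"
  using form_split[OF u u s, of w w] form_nonneg by simp

lemma form_coercive:
  assumes u: "u \<in> L2_controls T"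
  shows "m * L2_inner T u u \<le> form T w u w u"
proof -
  have "m * L2_inner T u u = integral {0..T} (\<lambda>t. m * (norm (u t))\<^sup>2)"
    by (simp add: L2_inner_self)
  also have "\<dots> \<le> integral {0..T} (\<lambda>t. (norm (K (u t)))\<^sup>2)"
    by (intro integral_le integrable_on_mult_right L2_integrable_norm_sq K_L2 u K_coercive)
  also have "\<dots> \<le> form T w u w u"
    using L2_inner_nonneg[of T "\<lambda>t. C (traj w u t)"] by (simp add: form_def L2_inner_self)
  finally show ?thesis .
qed

lemma form_zero_control:
  "form T w (\<lambda>_. 0) y h = L2_inner T (\<lambda>t. C (S t w)) (\<lambda>t. C (traj y h t))"
proof -
  have "L2_inner T (\<lambda>t. C (traj w (\<lambda>_. 0) t)) (\<lambda>t. C (traj y h t))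
    = L2_inner T (\<lambda>t. C (S t w)) (\<lambda>t. C (traj y h t))"
    by (rule L2_inner_cong) (simp_all add: traj_zero_control)
  then show ?thesis by (simp add: form_def K_linear) (simp add: L2_inner_def)
qed

text \<open>The first order condition for the homogeneous problem with initial state \<open>w\<close>; as the cost is
  convex, it characterizes the optimal controls.\<close>

definition stationary :: "real \<Rightarrow> 'h \<Rightarrow> (real \<Rightarrow> 'u) \<Rightarrow> bool" where
  "stationary T w u \<longleftrightarrow> u \<in> L2_controls T \<and> (\<forall>h\<in>L2_controls T. form T w u 0 h = 0)"

lemma stationary_L2: "stationary T w u \<Longrightarrow> u \<in> L2_controls T"
  and stationaryD: "stationary T w u \<Longrightarrow> h \<in> L2_controls T \<Longrightarrow> form T w u 0 h = 0"
  by (simp_all add: stationary_def)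

lemma stationary_add:
  "stationary T w u \<Longrightarrow> stationary T w' u' \<Longrightarrow> stationary T (w + w') (\<lambda>t. u t + u' t)"
  unfolding stationary_def by (auto simp: form_add_left intro: L2_add)

lemma stationary_diff:
  "stationary T w u \<Longrightarrow> stationary T w' u' \<Longrightarrow> stationary T (w - w') (\<lambda>t. u t - u' t)"
  unfolding stationary_def by (auto simp: form_diff_left intro: L2_diff)

lemma stationary_scaleR: "stationary T w u \<Longrightarrow> stationary T (c *\<^sub>R w) (\<lambda>t. c *\<^sub>R u t)"
  unfolding stationary_def by (auto simp: form_scaleR_left intro: L2_scaleR)

lemma stationary_scaleC:
  assumes "stationary T w u"
  shows "stationary T (scaleC c w) (\<lambda>t. scaleC c (u t))"
  unfolding stationary_def
proof (intro conjI ballI)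
  show "(\<lambda>t. scaleC c (u t)) \<in> L2_controls T"
    using assms by (intro L2_scaleC stationary_L2)
  fix h :: "real \<Rightarrow> 'u" assume h: "h \<in> L2_controls T"
  have "scaleC (cnj c) (0::'h) = 0" using linear_simps(3)[OF bounded_linear_scaleC] .
  then show "form T (scaleC c w) (\<lambda>t. scaleC c (u t)) 0 h = 0"
    using form_scaleC[OF stationary_L2[OF assms] h, of c w 0]
      stationaryD[OF assms L2_scaleC[OF h, of "cnj c"]] by simp
qed

text \<open>Two controls for the same initial state \<open>y\<close> differ by an admissible
  variation starting at 0, which stationarity annihilates. So in the second slot any control may
  stand, in particular 0.\<close>

lemma stationary_form_eq:
  assumes st: "stationary T w u" and h: "h \<in> L2_controls T" "h' \<in> L2_controls T"
  shows "form T w u y h = form T w u y h'"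
  using stationaryD[OF st L2_diff[OF h]] form_diff_right[OF h stationary_L2[OF st], of w y y] by simp

text \<open>Stationarity kills the mixed term. The excess cost of a competitor thus measures its
  distance to the optimum, which turns convergence of costs into convergence of
  trajectories.\<close>

lemma stationary_pythagoras:
  assumes st: "stationary T w u" and h: "h \<in> L2_controls T"
  shows "form T w h w h = form T w u w u + form T 0 (\<lambda>t. h t - u t) 0 (\<lambda>t. h t - u t)"
proof -
  have u: "u \<in> L2_controls T" using st by (rule stationary_L2)
  have d: "(\<lambda>t. h t - u t) \<in> L2_controls T" using h u by (rule L2_diff)
  have "form T 0 (\<lambda>t. h t - u t) 0 (\<lambda>t. h t - u t)
    = form T w h 0 (\<lambda>t. h t - u t) - form T w u 0 (\<lambda>t. h t - u t)"
    using form_diff_left[OF h u d, of w w 0] by simp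
  also have "form T w u 0 (\<lambda>t. h t - u t) = 0" using st d by (rule stationaryD)
  also have "form T w h 0 (\<lambda>t. h t - u t) = form T w h w h - form T w h w u"
    using form_diff_right[OF h u h, of w w w] by simp
  also have "form T w h w u = form T w u w u"
    using stationary_form_eq[OF st h u] by (simp add: form_commute)
  finally show ?thesis by simp
qed

text \<open>Coercivity converts the cost of the difference into an \<open>L2\<close> bound on the
  controls; the trajectories start at the same state and hence differ only by a convolution.\<close>

lemma traj_diff_le:
  assumes u: "u \<in> L2_controls T" and v: "v \<in> L2_controls T" and t: "0 \<le> t" "t \<le> t1" "t \<le> T"
    and E: "form T 0 (\<lambda>t. u t - v t) 0 (\<lambda>t. u t - v t) \<le> E"
  shows "norm (traj w u t - traj w v t) \<le> S_bd t1 * nB * sqrt t1 * sqrt (E / m)"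
proof -
  let ?d = "\<lambda>t. u t - v t"
  have d: "?d \<in> L2_controls T" using u v by (rule L2_diff)
  have sub: "u \<in> L2_controls t" "v \<in> L2_controls t" "?d \<in> L2_controls t"
    using u v d t by (auto intro: L2_subset order_trans)
  have "m * L2_inner t ?d ?d \<le> form t 0 ?d 0 ?d" by (rule form_coercive[OF sub(3)])
  also have "\<dots> \<le> form T 0 ?d 0 ?d" by (rule form_mono[OF d]) (use t in auto)
  also note E
  finally have "L2_inner t ?d ?d \<le> E / m" using m_pos by (simp add: field_simps)
  then have "sqrt t * sqrt (L2_inner t ?d ?d) \<le> sqrt t1 * sqrt (E / m)"
    using t L2_inner_nonneg by (intro mult_mono) auto
  then have int: "integral {0..t} (\<lambda>s. norm (?d s)) \<le> sqrt t1 * sqrt (E / m)"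
    using L2_integral_norm_le_sqrt[OF sub(3) t(1)] by linarith
  have "traj w u t - traj w v t = traj 0 ?d t"
    using traj_diff[OF sub(1,2) t(1), of w w] by simp
  then have "norm (traj w u t - traj w v t) \<le> S_bd t1 * (nB * integral {0..t} (\<lambda>s. norm (?d s)))"
    using traj_norm_le[OF sub(3) t(1,2), of 0] by simp
  also have "\<dots> \<le> S_bd t1 * (nB * (sqrt t1 * sqrt (E / m)))"
    using S_bd(1)[of t1] nB int by (intro mult_left_mono) auto
  finally show ?thesis by (simp add: mult.assoc)
qed

text \<open>The previous estimate with \<open>E = 0\<close>. Stationary controls may still differ on
  a null set.\<close>

lemma stationary_unique:
  assumes st: "stationary T w u" "stationary T w v" and t: "0 \<le> t" "t \<le> T"
  shows "traj w u t = traj w v t"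
proof -
  have "stationary T 0 (\<lambda>t. u t - v t)" using stationary_diff[OF st] by simp
  from stationaryD[OF this stationary_L2[OF this]]
  have "form T 0 (\<lambda>t. u t - v t) 0 (\<lambda>t. u t - v t) \<le> 0" by simp
  from traj_diff_le[OF stationary_L2[OF st(1)] stationary_L2[OF st(2)] t(1) order_refl t(2) this]
  show ?thesis by simp
qed

text \<open>Bellman's principle: a variation of the tail is a variation of the whole control that
  vanishes before \<open>s\<close> and so leaves the trajectory at 0 until then.\<close>

lemma stationary_tail:
  assumes st: "stationary T w u" and s: "0 \<le> s" "s \<le> T"
  shows "stationary (T - s) (traj w u s) (\<lambda>r. u (s + r))"
  unfolding stationary_def
proof (intro conjI ballI)
  have u: "u \<in> L2_controls T" using st by (rule stationary_L2)
  show "(\<lambda>r. u (s + r)) \<in> L2_controls (T - s)" by (rule L2_sub[OF u s]) simp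
  fix h :: "real \<Rightarrow> 'u" assume h: "h \<in> L2_controls (T - s)"
  let ?c = "concat_control s (\<lambda>_. 0) h"
  have c: "?c \<in> L2_controls T" by (rule L2_concat[OF L2_const h s])
  have tr: "traj 0 ?c t = 0" if "0 \<le> t" "t \<le> s" for t
    using traj_concat_before[OF that(2), of 0 "\<lambda>_. 0" h] traj_zero_control[OF that(1), of 0] that
    by (simp add: S_linear)
  have "L2_inner s (\<lambda>t. K (u t)) (\<lambda>t. K (?c t)) = integral {0..s} (\<lambda>_. 0)"
    unfolding L2_inner_def
    by (rule integral_spike[of "{s}"]) (auto simp: concat_control_def K_linear)
  moreover have "L2_inner s (\<lambda>t. C (traj w u t)) (\<lambda>t. C (traj 0 ?c t))
    = L2_inner s (\<lambda>t. C (traj w u t)) (\<lambda>t. 0)"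
    by (rule L2_inner_cong) (simp_all add: tr C_linear)
  ultimately have "form s w u 0 ?c = 0" by (simp add: form_def) (simp add: L2_inner_def)
  moreover have "form (T - s) (traj w u s) (\<lambda>r. u (s + r)) (traj 0 ?c s) (\<lambda>r. ?c (s + r))
    = form (T - s) (traj w u s) (\<lambda>r. u (s + r)) 0 h"
    using s by (simp only: tr order_refl) (rule form_cong, auto simp: concat_control_def)
  ultimately show "form (T - s) (traj w u s) (\<lambda>r. u (s + r)) 0 h = 0"
    using form_split[OF u c s, of w 0] stationaryD[OF st c] by simp
qed

lemma form_free_le: 
  assumes T: "0 \<le> T"
  shows "form T w (\<lambda>_. 0) w (\<lambda>_. 0) \<le> T * (nC * S_bd T)\<^sup>2 * (norm w)\<^sup>2"
proof -
  have eq: "form T w (\<lambda>_. 0) w (\<lambda>_. 0) = integral {0..T} (\<lambda>t. (norm (C (traj w (\<lambda>_. 0) t)))\<^sup>2)"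
    by (simp add: form_def K_linear L2_inner_self)
  also have "\<dots> \<le> integral {0..T} (\<lambda>t. (nC * S_bd T * norm w)\<^sup>2)"
  proof (rule integral_le)
    show "(\<lambda>t. (norm (C (traj w (\<lambda>_. 0) t)))\<^sup>2) integrable_on {0..T}"
      by (intro L2_integrable_norm_sq C_traj_L2 L2_const)
    fix t assume t: "t \<in> {0..T}"
    have "norm (C (S t w)) \<le> nC * norm (S t w)" by (rule nC)
    also have "\<dots> \<le> nC * (S_bd T * norm w)" using S_bd(2)[OF t] nC(1) by (rule mult_left_mono)
    finally have "(norm (C (S t w)))\<^sup>2 \<le> (nC * (S_bd T * norm w))\<^sup>2" by (rule power_mono) simp
    then show "(norm (C (traj w (\<lambda>_. 0) t)))\<^sup>2 \<le> (nC * S_bd T * norm w)\<^sup>2"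
      using t by (simp add: traj_zero_control mult.assoc)
  qed (rule integrable_const_ivl)
  also have "\<dots> = T * (nC * S_bd T)\<^sup>2 * (norm w)\<^sup>2" using T by (simp add: power_mult_distrib)
  finally show ?thesis .
qed

end

section \<open>The limit semigroup\<close>

text \<open>The contraction time depends on the state, so there is no single operator of norm below
  1 to take powers of. One jumps along the trajectory instead. Each jump takes at least unit time,
  which allows induction on an integer bound for \<open>t\<close>.\<close>

lemma exp_stable_onI_contraction:
  fixes \<Phi> :: "real \<Rightarrow> 'h::complex_inner \<Rightarrow> 'h"
  assumes inv: "\<And>t x. 0 \<le> t \<Longrightarrow> x \<in> V \<Longrightarrow> \<Phi> t x \<in> V"
    and add: "\<And>s t x. 0 \<le> s \<Longrightarrow> 0 \<le> t \<Longrightarrow> x \<in> V \<Longrightarrow> \<Phi> (s + t) x = \<Phi> s (\<Phi> t x)"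
    and bd: "\<And>t x. 0 \<le> t \<Longrightarrow> t \<le> \<tau> \<Longrightarrow> x \<in> V \<Longrightarrow> norm (\<Phi> t x) \<le> M * norm x"
    and contr: "\<And>x. x \<in> V \<Longrightarrow> \<exists>t\<in>{1..\<tau>}. norm (\<Phi> t x) \<le> norm x / 2"
    and \<tau>: "\<tau> \<ge> 1" and M: "M > 0"
  shows "exp_stable_on V \<Phi>"
proof -
  \<comment> \<open>With this rate a contraction time \<open>s \<le> \<tau>\<close> satisfies
    \<open>exp (\<omega> * s) \<le> 2\<close>, exactly what halving pays for. On
    \<open>{0..\<tau>}\<close> the exponential is at least 1/2, whence the constant
    \<open>2 * M\<close>.\<close>
  define \<omega> where "\<omega> = ln 2 / \<tau>"
  have \<omega>: "\<omega> > 0" "\<omega> * \<tau> = ln 2" using \<tau> by (auto simp: \<omega>_def)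
  have short: "norm (\<Phi> t x) \<le> 2 * M * exp (- \<omega> * t) * norm x"
    if t: "0 \<le> t" "t \<le> \<tau>" and x: "x \<in> V" for t x
  proof -
    have "\<omega> * t \<le> \<omega> * \<tau>" using \<omega> t by (intro mult_left_mono) auto
    then have "exp (- ln 2) \<le> exp (- \<omega> * t)" using \<omega> by simp
    then have "1 \<le> 2 * exp (- \<omega> * t)" by (simp add: exp_minus)
    then have "M * norm x * 1 \<le> M * norm x * (2 * exp (- \<omega> * t))"
      using M by (intro mult_left_mono) auto
    then show ?thesis using bd[OF t x] by (simp add: algebra_simps)
  qed
  have "norm (\<Phi> t x) \<le> 2 * M * exp (- \<omega> * t) * norm x"
    if "0 \<le> t" "t \<le> real n" "x \<in> V" for n t x
    using that
  proof (induction n arbitrary: t x)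
    case 0
    then show ?case using short[of t x] \<tau> by simp
  next
    case (Suc n)
    show ?case
    proof (cases "t \<le> \<tau>")
      case True
      then show ?thesis using short Suc.prems by simp
    next
      case False
      obtain s where s: "s \<in> {1..\<tau>}" "norm (\<Phi> s x) \<le> norm x / 2" using contr Suc.prems by blast
      have ts: "0 \<le> t - s" "t - s \<le> real n" using s False Suc.prems by auto
      have "\<Phi> t x = \<Phi> (t - s) (\<Phi> s x)" using add[of "t - s" s x] s ts Suc.prems by simp
      then have "norm (\<Phi> t x) \<le> 2 * M * exp (- \<omega> * (t - s)) * norm (\<Phi> s x)"
        using Suc.IH[OF ts inv] s Suc.prems by simp
      also have "\<dots> \<le> 2 * M * exp (- \<omega> * (t - s)) * (norm x / 2)"
        using s(2) M by (intro mult_left_mono) auto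
      also have "\<dots> = M * norm x * (exp (- \<omega> * t) * exp (\<omega> * s))"
        by (simp add: exp_add[symmetric] algebra_simps)
      also have "\<dots> \<le> M * norm x * (exp (- \<omega> * t) * 2)"
      proof (intro mult_left_mono)
        have "\<omega> * s \<le> \<omega> * \<tau>" using \<omega> s by (intro mult_left_mono) auto
        then have "exp (\<omega> * s) \<le> exp (ln 2)" by (simp only: exp_le_cancel_iff \<omega>)
        then show "exp (\<omega> * s) \<le> 2" by simp
      qed (use M in auto)
      finally show ?thesis by (simp add: algebra_simps)
    qed
  qed
  then have "norm (\<Phi> t x) \<le> 2 * M * exp (- \<omega> * t) * norm x" if "0 \<le> t" "x \<in> V" for t x
    using real_nat_ceiling_ge[of t] that by blast
  then show ?thesis unfolding exp_stable_on_def
    using inv M \<omega> by (intro conjI allI impI exI[of _ "2 * M"] exI[of _ \<omega>]) auto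
qed

text \<open>What remains of the turnpike property once the steady state and the linear cost terms
  are eliminated. The lower end 1 of the time window excludes the useless time 0.\<close>

locale lq_contractive = lq_system S B C K m
  for S :: "real \<Rightarrow> 'h::chilbert_space \<Rightarrow> 'h" and B :: "'u::chilbert_space \<Rightarrow> 'h"
    and C :: "'h \<Rightarrow> 'y::chilbert_space" and K :: "'u \<Rightarrow> 'u" and m :: real +
  fixes \<tau> :: real
  assumes tau: "\<tau> \<ge> 1"
    and stationary_exists: "T > 0 \<Longrightarrow> \<exists>u. stationary T w u"
    and stationary_near: "T \<ge> \<tau> \<Longrightarrow> \<exists>u. stationary T w u \<and> (\<exists>t\<in>{1..\<tau>}. norm (traj w u t) \<le> norm w / 4)"
begin

text \<open>The choice need not be linear in \<open>w\<close>; only the resulting trajectories and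
  costs are.\<close>

definition opt :: "real \<Rightarrow> 'h \<Rightarrow> real \<Rightarrow> 'u" where
  "opt T w = (SOME u. stationary T w u)"

definition xi :: "real \<Rightarrow> 'h \<Rightarrow> real \<Rightarrow> 'h" where
  "xi T w = traj w (opt T w)"

text \<open>The symmetric form of the finite horizon Riccati operator. On the diagonal it is the
  optimal homogeneous cost.\<close>

definition V :: "real \<Rightarrow> 'h \<Rightarrow> 'h \<Rightarrow> real" where
  "V T w w' = form T w (opt T w) w' (opt T w')"

lemma opt: "T > 0 \<Longrightarrow> stationary T w (opt T w)"
  unfolding opt_def using stationary_exists by (rule someI_ex)

lemma opt_L2: "T > 0 \<Longrightarrow> opt T w \<in> L2_controls T"
  using opt by (rule stationary_L2)

lemma opt_L2_sub: "T > 0 \<Longrightarrow> t \<le> T \<Longrightarrow> opt T w \<in> L2_controls t"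
  by (rule L2_subset[OF opt_L2]) auto

lemma xi_eq: "stationary T w u \<Longrightarrow> T > 0 \<Longrightarrow> 0 \<le> t \<Longrightarrow> t \<le> T \<Longrightarrow> xi T w t = traj w u t"
  unfolding xi_def by (rule stationary_unique[OF opt])

lemma xi_near:
  assumes "T \<ge> \<tau>"
  obtains t where "t \<in> {1..\<tau>}" "norm (xi T w t) \<le> norm w / 4"
proof -
  obtain u t where "stationary T w u" "t \<in> {1..\<tau>}" "norm (traj w u t) \<le> norm w / 4"
    using stationary_near[OF assms] by blast
  then show ?thesis using xi_eq[of T w u t] assms tau that[of t] by auto
qed

lemma xi_add:
  assumes "T > 0" "0 \<le> t" "t \<le> T"
  shows "xi T (w + w') t = xi T w t + xi T w' t"
proof -
  have "xi T (w + w') t = traj (w + w') (\<lambda>t. opt T w t + opt T w' t) t"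
    by (rule xi_eq[OF stationary_add[OF opt opt]]) (use assms in auto)
  also have "\<dots> = xi T w t + xi T w' t" unfolding xi_def
    by (rule traj_add) (use assms in \<open>auto intro: opt_L2_sub\<close>)
  finally show ?thesis .
qed

lemma xi_scaleR:
  assumes "T > 0" "0 \<le> t" "t \<le> T"
  shows "xi T (c *\<^sub>R w) t = c *\<^sub>R xi T w t"
  using xi_eq[OF stationary_scaleR[OF opt[OF assms(1)]] assms, of c w]
  by (simp add: traj_scaleR[OF assms(2)] xi_def)

lemma xi_scaleC:
  assumes "T > 0" "0 \<le> t" "t \<le> T"
  shows "xi T (scaleC c w) t = scaleC c (xi T w t)"
proof -
  have "opt T w \<in> L2_controls t" using assms by (simp add: opt_L2_sub)
  then show ?thesis using xi_eq[OF stationary_scaleC[OF opt[OF assms(1)]] assms, of c w]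
    by (simp add: traj_scaleC[OF assms(2)] xi_def)
qed

lemma xi_diff:
  assumes "T > 0" "0 \<le> t" "t \<le> T"
  shows "xi T (w - w') t = xi T w t - xi T w' t"
  using xi_add[OF assms, of "w - w'" w'] by simp

lemma xi_tail:
  assumes "0 \<le> s" "0 \<le> t" "s + t \<le> T" "s < T"
  shows "xi T w (s + t) = xi (T - s) (xi T w s) t"
proof -
  have T: "T > 0" "T - s > 0" using assms by auto
  have "xi (T - s) (traj w (opt T w) s) t = traj (traj w (opt T w) s) (\<lambda>r. opt T w (s + r)) t"
    by (rule xi_eq[OF stationary_tail[OF opt]]) (use assms T in auto)
  then show ?thesis using traj_shift[OF opt_L2[OF T(1)], of s t w] assms by (simp add: xi_def)
qed

lemma V_eq_form: "T > 0 \<Longrightarrow> h \<in> L2_controls T \<Longrightarrow> V T w w' = form T w (opt T w) w' h"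
  unfolding V_def by (rule stationary_form_eq[OF opt opt_L2])

lemma V_commute: "V T w w' = V T w' w"
  unfolding V_def by (rule form_commute)

text \<open>Replacing the control in the second slot by 0 exhibits \<open>V\<close> as a pairing
  with the free motion, which is visibly linear in \<open>w'\<close>. Linearity in \<open>w\<close>
  follows by symmetry.\<close>

lemma V_free: "T > 0 \<Longrightarrow> V T w w' = L2_inner T (\<lambda>t. C (xi T w t)) (\<lambda>t. C (S t w'))"
  using V_eq_form[OF _ L2_const[of 0], of T w w'] form_zero_control[of T w' w "opt T w"]
  by (simp add: form_commute[of T w'] L2_inner_commute[of T "\<lambda>t. C (S t w')"] xi_def)

lemma CS_L2: "(\<lambda>t. C (S t w)) \<in> L2_controls T"
  by (rule L2_bounded_linear[OF C_bounded_linear L2_continuous[OF S_continuous]])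

lemma C_xi_L2: "T > 0 \<Longrightarrow> (\<lambda>t. C (xi T w t)) \<in> L2_controls T"
  unfolding xi_def by (rule C_traj_L2[OF opt_L2])

lemma V_add_right:
  assumes "T > 0"
  shows "V T w (y + y') = V T w y + V T w y'"
proof -
  have "L2_inner T (\<lambda>t. C (xi T w t)) (\<lambda>t. C (S t (y + y')))
    = L2_inner T (\<lambda>t. C (xi T w t)) (\<lambda>t. C (S t y) + C (S t y'))"
    by (rule L2_inner_cong) (simp_all add: S_linear C_linear)
  then show ?thesis using assms by (simp add: V_free L2_inner_add_right C_xi_L2 CS_L2)
qed

lemma V_scaleR_right:
  assumes "T > 0"
  shows "V T w (c *\<^sub>R y) = c * V T w y"
proof -
  have "L2_inner T (\<lambda>t. C (xi T w t)) (\<lambda>t. C (S t (c *\<^sub>R y)))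
    = L2_inner T (\<lambda>t. C (xi T w t)) (\<lambda>t. c *\<^sub>R C (S t y))"
    by (rule L2_inner_cong) (simp_all add: S_linear C_linear)
  then show ?thesis using assms by (simp add: V_free L2_inner_scaleR_right)
qed

lemma V_add_left: "T > 0 \<Longrightarrow> V T (w + w') y = V T w y + V T w' y"
  using V_add_right by (metis V_commute)

lemma V_scaleR_left: "T > 0 \<Longrightarrow> V T (c *\<^sub>R w) y = c * V T w y"
  using V_scaleR_right by (metis V_commute)

lemma V_diff_left: "T > 0 \<Longrightarrow> V T (w - w') y = V T w y - V T w' y"
  using V_add_left[of T "w - w'" w' y] by simp

lemma V_diff_right: "T > 0 \<Longrightarrow> V T w (y - y') = V T w y - V T w y'"
  using V_add_right[of T w "y - y'" y'] by simp

lemma V_nonneg: "V T w w \<ge> 0"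
  unfolding V_def by (rule form_nonneg)

lemma V_le_form: "T > 0 \<Longrightarrow> h \<in> L2_controls T \<Longrightarrow> V T w w \<le> form T w h w h"
  unfolding V_def using stationary_pythagoras[OF opt, of T h w] form_nonneg by simp

lemma V_mono:
  assumes "0 < T" "T \<le> T'"
  shows "V T w w \<le> V T' w w"
proof -
  have "V T w w \<le> form T w (opt T' w) w (opt T' w)"
    by (rule V_le_form) (use assms in \<open>auto intro: opt_L2_sub\<close>)
  also have "\<dots> \<le> V T' w w"
    unfolding V_def by (rule form_mono) (use assms opt_L2 in auto)
  finally show ?thesis .
qed

section \<open>A bound on the value independent of the horizon\<close>

definition c_free :: "real \<Rightarrow> real" where "c_free T = T * (nC * S_bd T)\<^sup>2"

lemma c_free_nonneg: "T > 0 \<Longrightarrow> c_free T \<ge> 0"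
  by (simp add: c_free_def)

lemma V_le_free: "T > 0 \<Longrightarrow> V T w w \<le> c_free T * (norm w)\<^sup>2"
  using V_le_form[OF _ L2_const[of 0], of T w] form_free_le[of T w] unfolding c_free_def by simp

text \<open>Follow the optimal pair of horizon \<tau> until its state has shrunk to a quarter, then
  switch to the optimal control for the remaining time. The first piece costs at most the free
  motion on \<open>{0..\<tau>}\<close>, whatever \<open>T\<close> is; the remaining horizon may be
  enlarged to \<open>T\<close> by monotonicity.\<close>

lemma V_contract:
  assumes T: "T > \<tau>"
  obtains w1 where "norm w1 \<le> norm w / 4" "V T w w \<le> c_free \<tau> * (norm w)\<^sup>2 + V T w1 w1"
proof -
  have \<tau>: "\<tau> > 0" using tau by simp
  obtain t where t: "t \<in> {1..\<tau>}" "norm (xi \<tau> w t) \<le> norm w / 4" by (rule xi_near[OF order_refl])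
  define w1 where "w1 = xi \<tau> w t"
  have Tt: "T - t > 0" "T > 0" using t T \<tau> by auto
  have t': "0 \<le> t" "t \<le> T" "t \<le> \<tau>" using t T by auto
  let ?f = "opt \<tau> w" and ?g = "opt (T - t) w1"
  let ?c = "concat_control t ?f ?g"
  have f: "?f \<in> L2_controls t"  using \<tau> t' by (simp add: opt_L2_sub)
  have g: "?g \<in> L2_controls (T - t)" by (rule opt_L2[OF Tt(1)])
  have c: "?c \<in> L2_controls T" by (rule L2_concat[OF f g t'(1,2)])
  have tr: "traj w ?c t = w1"
    using traj_concat_before[of t t w ?f ?g] by (simp add: w1_def xi_def)
  have "V T w w \<le> form T w ?c w ?c" by (rule V_le_form[OF Tt(2) c])
  also have "\<dots> = form t w ?c w ?c + form (T - t) w1 (\<lambda>r. ?c (t + r)) w1 (\<lambda>r. ?c (t + r))"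
    using form_split[OF c c t'(1,2), of w w] by (simp add: tr)
  also have "form (T - t) w1 (\<lambda>r. ?c (t + r)) w1 (\<lambda>r. ?c (t + r)) = V (T - t) w1 w1"
    unfolding V_def by (rule form_cong) (simp_all add: concat_control_def)
  also have "\<dots> \<le> V T w1 w1" by (rule V_mono) (use Tt t' in auto)
  also have "form t w ?c w ?c = form t w ?f w ?f"
  proof -
    have "L2_inner t (\<lambda>r. K (?c r)) (\<lambda>r. K (?c r)) = L2_inner t (\<lambda>r. K (?f r)) (\<lambda>r. K (?f r))"
      unfolding L2_inner_def by (rule integral_spike[of "{t}"]) (auto simp: concat_control_def)
    moreover have "L2_inner t (\<lambda>r. C (traj w ?c r)) (\<lambda>r. C (traj w ?c r))
      = L2_inner t (\<lambda>r. C (traj w ?f r)) (\<lambda>r. C (traj w ?f r))"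
      by (rule L2_inner_cong) (simp_all add: traj_concat_before)
    ultimately show ?thesis by (simp add: form_def)
  qed
  also have "form t w ?f w ?f \<le> V \<tau> w w"
    unfolding V_def by (rule form_mono[OF opt_L2[OF \<tau>] t'(1,3)])
  also have "V \<tau> w w \<le> c_free \<tau> * (norm w)\<^sup>2" by (rule V_le_free[OF \<tau>])
  finally have "V T w w \<le> c_free \<tau> * (norm w)\<^sup>2 + V T w1 w1" by simp
  then show ?thesis using t(2) that by (simp add: w1_def)
qed

text \<open>Chosen so that \<open>c_free \<tau> + cV / 16 \<le> cV\<close>, where 1/16 is the square
  of the contraction factor 1/4.\<close>

definition cV :: real where "cV = 2 * c_free \<tau>"

lemma cV_nonneg: "cV \<ge> 0"
  using tau by (simp add: cV_def c_free_nonneg)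

text \<open>At fixed \<open>T\<close>, iterating the switching argument divides the crude bound
  \<open>c_free T\<close> by 16 each time, so in the limit only the part independent of
  \<open>T\<close> survives.\<close>

lemma V_bound:
  assumes T: "T > 0"
  shows "V T w w \<le> cV * (norm w)\<^sup>2"
proof -
  have large: "V T w w \<le> cV * (norm w)\<^sup>2" if T: "T > \<tau>" for T w
  proof -
    have T0: "T > 0" using T tau by simp
    have step: "V T w w \<le> (cV + c_free T / 16 ^ n) * (norm w)\<^sup>2" for n w
    proof (induction n arbitrary: w)
      case 0
      have "c_free T * (norm w)\<^sup>2 \<le> (cV + c_free T) * (norm w)\<^sup>2"
        using cV_nonneg by (intro mult_right_mono) auto
      then show ?case using V_le_free[OF T0, of w] by simp
    next
      case (Suc n)
      obtain w1 where w1: "norm w1 \<le> norm w / 4" "V T w w \<le> c_free \<tau> * (norm w)\<^sup>2 + V T w1 w1"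
        by (rule V_contract[OF T])
      have "(norm w1)\<^sup>2 \<le> (norm w / 4)\<^sup>2" using w1(1) by (rule power_mono) simp
      then have sq: "(norm w1)\<^sup>2 \<le> (norm w)\<^sup>2 / 16" by (simp add: power_divide)
      have pos: "cV + c_free T / 16 ^ n \<ge> 0" using cV_nonneg c_free_nonneg[OF T0] by simp
      have "V T w1 w1 \<le> (cV + c_free T / 16 ^ n) * ((norm w)\<^sup>2 / 16)"
        using Suc[of w1] mult_left_mono[OF sq pos] by linarith
      then have "V T w w \<le> c_free \<tau> * (norm w)\<^sup>2 + (cV + c_free T / 16 ^ n) * ((norm w)\<^sup>2 / 16)"
        using w1(2) by linarith
      also have "\<dots> = (c_free \<tau> + cV / 16 + c_free T / 16 ^ Suc n) * (norm w)\<^sup>2"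
        by (simp add: field_simps)
      also have "\<dots> \<le> (cV + c_free T / 16 ^ Suc n) * (norm w)\<^sup>2"
        using cV_nonneg unfolding cV_def by (intro mult_right_mono) auto
      finally show ?case .
    qed
    have "(\<lambda>n. (cV + c_free T * (1 / 16) ^ n) * (norm w)\<^sup>2) \<longlonglongrightarrow> (cV + c_free T * 0) * (norm w)\<^sup>2"
      by (intro tendsto_intros LIMSEQ_power_zero) simp
    then have "(\<lambda>n. (cV + c_free T / 16 ^ n) * (norm w)\<^sup>2) \<longlonglongrightarrow> cV * (norm w)\<^sup>2"
      by (simp add: power_one_over)
    then show ?thesis by (rule LIMSEQ_le_const) (use step in auto)
  qed
  \<comment> \<open>Horizons not exceeding \<tau> are covered by monotonicity.\<close>
  have "V T w w \<le> V (max T (\<tau> + 1)) w w" by (rule V_mono) (use T in auto)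
  also have "\<dots> \<le> cV * (norm w)\<^sup>2" by (rule large) simp
  finally show ?thesis .
qed

text \<open>The summand 1 stands for the free motion; the other is \<open>nB\<close> times the bound
  on the \<open>L1\<close> norm of the optimal control, per unit of \<open>norm w\<close>.\<close>

definition kap :: "real \<Rightarrow> real" where
  "kap t1 = S_bd t1 * (1 + nB * sqrt t1 * sqrt (cV / m))"

lemma kap_pos: "t1 \<ge> 0 \<Longrightarrow> kap t1 \<ge> 1"
proof -
  assume "t1 \<ge> 0"
  then have "1 + nB * sqrt t1 * sqrt (cV / m) \<ge> 1"
    using nB cV_nonneg m_pos by simp
  then show ?thesis using S_bd(1)[of t1] mult_mono[of 1 "S_bd t1" 1] unfolding kap_def by simp
qed

lemma opt_L1_bound:
  assumes "T > 0" "0 \<le> t" "t \<le> T"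
  shows "integral {0..t} (\<lambda>s. norm (opt T w s)) \<le> sqrt t * sqrt (cV / m) * norm w"
proof -
  have o: "opt T w \<in> L2_controls t" using assms by (simp add: opt_L2_sub)
  have "m * L2_inner t (opt T w) (opt T w) \<le> form t w (opt T w) w (opt T w)" by (rule form_coercive[OF o])
  also have "\<dots> \<le> V T w w" unfolding V_def by (rule form_mono) (use assms opt_L2 in auto)
  also have "\<dots> \<le> cV * (norm w)\<^sup>2" by (rule V_bound[OF assms(1)])
  finally have "L2_inner t (opt T w) (opt T w) \<le> cV / m * (norm w)\<^sup>2" using m_pos by (simp add: field_simps)
  then have "sqrt (L2_inner t (opt T w) (opt T w)) \<le> sqrt (cV / m * (norm w)\<^sup>2)" by simp
  also have "\<dots> = sqrt (cV / m) * norm w" unfolding real_sqrt_mult by simp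
  finally have "sqrt t * sqrt (L2_inner t (opt T w) (opt T w)) \<le> sqrt t * (sqrt (cV / m) * norm w)"
    using assms by (intro mult_left_mono) auto
  then show ?thesis using L2_integral_norm_le_sqrt[OF o assms(2)] by simp
qed

lemma xi_bound:
  assumes "T > 0" "0 \<le> t" "t \<le> T" "t \<le> t1"
  shows "norm (xi T w t) \<le> kap t1 * norm w"
proof -
  have o: "opt T w \<in> L2_controls t" using assms by (simp add: opt_L2_sub)
  have "norm (xi T w t) \<le> S_bd t1 * (norm w + nB * integral {0..t} (\<lambda>s. norm (opt T w s)))"
    unfolding xi_def by (rule traj_norm_le[OF o assms(2,4)])
  also have "integral {0..t} (\<lambda>s. norm (opt T w s)) \<le> sqrt t * sqrt (cV / m) * norm w"
    by (rule opt_L1_bound[OF assms(1-3)])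
  also have "\<dots> \<le> sqrt t1 * sqrt (cV / m) * norm w"
    using assms cV_nonneg m_pos by (intro mult_right_mono) auto
  finally have "norm (xi T w t) \<le> S_bd t1 * (norm w + nB * (sqrt t1 * sqrt (cV / m) * norm w))"
    using S_bd(1)[of t1] nB(1) by (simp add: mult_left_mono)
  then show ?thesis by (simp add: kap_def algebra_simps)
qed

text \<open>The factor \<open>sqrt t\<close>, not \<open>sqrt t1\<close>, is kept: it makes the
  limit trajectories strongly continuous at 0.\<close>

lemma xi_minus_free:
  assumes "T > 0" "0 \<le> t" "t \<le> T" "t \<le> t1"
  shows "norm (xi T w t - S t w) \<le> S_bd t1 * nB * sqrt t * sqrt (cV / m) * norm w"
proof -
  have o: "opt T w \<in> L2_controls t" using assms by (simp add: opt_L2_sub)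
  have "norm (xi T w t - S t w) \<le> S_bd t1 * nB * integral {0..t} (\<lambda>s. norm (opt T w s))"
    unfolding xi_def mild_solution_def using convolution_norm_le[OF o assms(2,4)] by simp
  also have "\<dots> \<le> S_bd t1 * nB * (sqrt t * sqrt (cV / m) * norm w)"
    using S_bd(1)[of t1] nB(1) by (intro mult_left_mono opt_L1_bound assms) auto
  finally show ?thesis by (simp add: mult.assoc)
qed

section \<open>Passage to the infinite horizon\<close>

definition Vs :: "'h \<Rightarrow> real" where "Vs w = (SUP T\<in>{0<..}. V T w w)"

definition gap :: "real \<Rightarrow> 'h \<Rightarrow> real" where "gap T w = Vs w - V T w w"

lemma V_bdd: "bdd_above ((\<lambda>T. V T w w) ` {0<..})"
  by (rule bdd_aboveI2) (use V_bound in auto)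

lemma V_le_Vs: "T > 0 \<Longrightarrow> V T w w \<le> Vs w"
  unfolding Vs_def by (rule cSUP_upper[OF _ V_bdd]) simp

lemma gap_nonneg: "T > 0 \<Longrightarrow> gap T w \<ge> 0"
  using V_le_Vs by (simp add: gap_def)

lemma gap_mono: "0 < T \<Longrightarrow> T \<le> T' \<Longrightarrow> gap T' w \<le> gap T w"
  using V_mono by (simp add: gap_def)

lemma V_tendsto: "((\<lambda>T. V T w w) \<longlongrightarrow> Vs w) at_top"
proof (rule order_tendstoI)
  fix a assume "a < Vs w"
  then obtain T0 where T0: "T0 > 0" "a < V T0 w w"
    unfolding Vs_def using less_cSUP_iff[OF _ V_bdd] by auto
  show "\<forall>\<^sub>F T in at_top. a < V T w w"
    using eventually_ge_at_top[of T0] by eventually_elim (rule less_le_trans[OF T0(2) V_mono[OF T0(1)]])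
next
  fix a assume a: "Vs w < a"
  show "\<forall>\<^sub>F T in at_top. V T w w < a"
    using eventually_gt_at_top[of 0] by eventually_elim (use V_le_Vs[of _ w] a in force)
qed

lemma gap_tendsto: "((\<lambda>T. gap T w) \<longlongrightarrow> 0) at_top"
  using tendsto_diff[OF tendsto_const[of "Vs w"] V_tendsto[of w]] by (simp add: gap_def)

text \<open>The optimal control of the longer horizon, restricted to \<open>{0..T}\<close>, costs
  there at most \<open>Vs w\<close>. Its excess over the optimum of horizon \<open>T\<close> is
  therefore at most \<open>gap T w\<close>, and the Pythagoras identity applies.\<close>

lemma xi_Cauchy_bound:
  assumes T: "0 < T" "T \<le> T'" and t: "0 \<le> t" "t \<le> t1" "t \<le> T"
  shows "norm (xi T' w t - xi T w t) \<le> S_bd t1 * nB * sqrt t1 * sqrt (gap T w / m)"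
proof -
  have o': "opt T' w \<in> L2_controls T" using T by (simp add: opt_L2_sub)
  have o: "opt T w \<in> L2_controls T" using opt_L2 T by auto
  let ?d = "\<lambda>t. opt T' w t - opt T w t"
  have "form T w (opt T w) w (opt T w) + form T 0 ?d 0 ?d = form T w (opt T' w) w (opt T' w)"
    using stationary_pythagoras[OF opt[OF T(1)] o'] by simp
  also have "\<dots> \<le> V T' w w" unfolding V_def by (rule form_mono) (use T opt_L2 in auto)
  also have "\<dots> \<le> Vs w" by (rule V_le_Vs) (use T in auto)
  finally have "form T 0 ?d 0 ?d \<le> gap T w" by (simp add: gap_def V_def)
  from traj_diff_le[OF o' o t this, of w] show ?thesis by (simp add: xi_def)
qed

text \<open>The limit is taken along integer horizons to have a sequence; \<open>xi_tendsto\<close>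
  upgrades it to all real horizons.\<close>

definition Phi :: "real \<Rightarrow> 'h \<Rightarrow> 'h" where
  "Phi t w = lim (\<lambda>n. xi (real n) w t)"

lemma Phi_bound:
  assumes T: "0 < T" and t: "0 \<le> t" "t \<le> t1" "t \<le> T"
  shows "norm (Phi t w - xi T w t) \<le> S_bd t1 * nB * sqrt t1 * sqrt (gap T w / m)"
proof -
  let ?k = "S_bd t1 * nB * sqrt t1"
  have "((\<lambda>T. ?k * sqrt (gap T w / m)) \<longlongrightarrow> ?k * sqrt (0 / m)) at_top"
    by (intro tendsto_intros gap_tendsto) (use m_pos in auto)
  then have small: "((\<lambda>T. ?k * sqrt (gap T w / m)) \<longlongrightarrow> 0) at_top" by simp
  have "Cauchy (\<lambda>n. xi (real n) w t)"
  proof (rule metric_CauchyI)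
    fix e :: real assume "e > 0"
    then have "\<forall>\<^sub>F T in at_top. ?k * sqrt (gap T w / m) < e / 2"
      using order_tendstoD(2)[OF small, of "e / 2"] by simp
    then obtain N where N: "\<And>T. T \<ge> N \<Longrightarrow> ?k * sqrt (gap T w / m) < e / 2"
      by (auto simp: eventually_at_top_linorder)
    obtain k :: nat where k: "real k \<ge> max N (max t 1)" using real_arch_simple by blast
    have near: "dist (xi (real n) w t) (xi (real k) w t) < e / 2" if "n \<ge> k" for n
    proof -
      have "norm (xi (real n) w t - xi (real k) w t) \<le> ?k * sqrt (gap (real k) w / m)"
        by (rule xi_Cauchy_bound) (use k t that in auto)
      then show ?thesis using N[of "real k"] k by (simp add: dist_norm)
    qed
    have "dist (xi (real i) w t) (xi (real j) w t) < e" if "i \<ge> k" "j \<ge> k" for i j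
      using dist_triangle_half_l[OF near[OF that(1)] near[OF that(2)]] .
    then show "\<exists>M. \<forall>i\<ge>M. \<forall>j\<ge>M. dist (xi (real i) w t) (xi (real j) w t) < e" by blast
  qed
  then have lim: "(\<lambda>n. xi (real n) w t) \<longlonglongrightarrow> Phi t w"
    unfolding Phi_def by (simp add: Cauchy_convergent_iff convergent_LIMSEQ_iff)
  then have "(\<lambda>n. norm (xi (real n) w t - xi T w t)) \<longlonglongrightarrow> norm (Phi t w - xi T w t)"
    by (intro tendsto_intros)
  moreover have "\<exists>N. \<forall>n\<ge>N. norm (xi (real n) w t - xi T w t) \<le> ?k * sqrt (gap T w / m)"
  proof -
    obtain k :: nat where k: "real k \<ge> T" using real_arch_simple by blast
    show ?thesis
    proof (intro exI[of _ k] allI impI)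
      fix n assume "n \<ge> k"
      then have "T \<le> real n" using k by linarith
      then show "norm (xi (real n) w t - xi T w t) \<le> ?k * sqrt (gap T w / m)"
        by (rule xi_Cauchy_bound[OF T _ t])
    qed
  qed
  ultimately show ?thesis by (rule LIMSEQ_le_const2)
qed

lemma xi_tendsto:
  assumes t: "0 \<le> t"
  shows "((\<lambda>T. xi T w t) \<longlongrightarrow> Phi t w) at_top"
proof -
  let ?k = "S_bd t * nB * sqrt t"
  have "((\<lambda>T. ?k * sqrt (gap T w / m)) \<longlongrightarrow> ?k * sqrt (0 / m)) at_top"
    by (intro tendsto_intros gap_tendsto) (use m_pos in auto)
  then have small: "((\<lambda>T. ?k * sqrt (gap T w / m)) \<longlongrightarrow> 0) at_top" by simp
  have "((\<lambda>T. norm (xi T w t - Phi t w)) \<longlongrightarrow> 0) at_top"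
  proof (rule tendsto_sandwich[OF _ _ tendsto_const small])
    show "\<forall>\<^sub>F T in at_top. norm (xi T w t - Phi t w) \<le> ?k * sqrt (gap T w / m)"
      using eventually_gt_at_top[of "max 0 t"]
    proof eventually_elim
      case (elim T)
      then show ?case using Phi_bound[of T t t w] t by (simp add: norm_minus_commute)
    qed
  qed simp
  then show ?thesis using tendsto_norm_zero_iff Lim_null by blast
qed

lemma Phi_eqI:
  assumes "0 \<le> t" "((\<lambda>T. xi T w t) \<longlongrightarrow> y) at_top"
  shows "Phi t w = y"
  using tendsto_unique[OF _ xi_tendsto[OF assms(1)] assms(2)] by simp

lemma Phi_0: "Phi 0 w = w"
proof (rule Phi_eqI)
  show "((\<lambda>T. xi T w 0) \<longlongrightarrow> w) at_top" by (simp add: xi_def traj_0)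
qed simp

text \<open>The identities for \<open>xi\<close> hold only once the horizon exceeds the time
  considered.\<close>

lemma (in -) tendsto_at_top_transform:
  assumes "\<And>T. T > t \<Longrightarrow> T > 0 \<Longrightarrow> f T = g T" "(f \<longlongrightarrow> l) at_top"
  shows "(g \<longlongrightarrow> l) (at_top :: real filter)"
  using assms(2) by (rule Lim_transform_eventually)
    (use eventually_gt_at_top[of "max t 0"] in eventually_elim, use assms(1) in auto)

lemma Phi_add:
  assumes "0 \<le> t"
  shows "Phi t (w + w') = Phi t w + Phi t w'"
  using assms
proof (rule Phi_eqI)
  show "((\<lambda>T. xi T (w + w') t) \<longlongrightarrow> Phi t w + Phi t w') at_top"
    by (rule tendsto_at_top_transform[where t = t, OF _ tendsto_add[OF xi_tendsto xi_tendsto]])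
      (use assms in \<open>auto simp: xi_add\<close>)
qed

lemma Phi_scaleR:
  assumes "0 \<le> t"
  shows "Phi t (c *\<^sub>R w) = c *\<^sub>R Phi t w"
  using assms
proof (rule Phi_eqI)
  show "((\<lambda>T. xi T (c *\<^sub>R w) t) \<longlongrightarrow> c *\<^sub>R Phi t w) at_top"
    by (rule tendsto_at_top_transform[where t = t, OF _ tendsto_scaleR[OF tendsto_const xi_tendsto]])
      (use assms in \<open>auto simp: xi_scaleR\<close>)
qed

lemma Phi_scaleC:
  assumes "0 \<le> t"
  shows "Phi t (scaleC c w) = scaleC c (Phi t w)"
  using assms
proof (rule Phi_eqI)
  show "((\<lambda>T. xi T (scaleC c w) t) \<longlongrightarrow> scaleC c (Phi t w)) at_top"
    by (rule tendsto_at_top_transform[where t = t, OF _ bounded_linear.tendsto[OF bounded_linear_scaleC xi_tendsto]])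
      (use assms in \<open>auto simp: xi_scaleC\<close>)
qed

lemma Phi_norm_le:
  assumes "0 \<le> t" "t \<le> t1"
  shows "norm (Phi t w) \<le> kap t1 * norm w"
proof (rule tendsto_upperbound[OF tendsto_norm[OF xi_tendsto[OF assms(1)]]])
  show "\<forall>\<^sub>F T in at_top. norm (xi T w t) \<le> kap t1 * norm w"
    using eventually_gt_at_top[of "max 0 t"]
    by eventually_elim (use xi_bound assms in auto)
qed simp

lemma Phi_bounded_clinear: "0 \<le> t \<Longrightarrow> bounded_clinear (Phi t)"
  unfolding bounded_clinear_def
  using Phi_norm_le[of t t]
  by (auto intro!: bounded_linear_intro[where K = "kap t"]
      simp: Phi_add Phi_scaleR Phi_scaleC mult.commute)

text \<open>In the tail identity both the horizon \<open>T - s\<close> and the restart state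
  \<open>xi T w s\<close> vary with \<open>T\<close>. The bound \<open>kap\<close>, uniform in the
  horizon, allows the state to be replaced by its limit before the horizon is sent to
  infinity.\<close>

lemma Phi_semigroup:
  assumes s: "0 \<le> s" and t: "0 \<le> t"
  shows "Phi (s + t) w = Phi t (Phi s w)"
proof (rule Phi_eqI)
  have shift: "filterlim (\<lambda>T. T - s) at_top (at_top :: real filter)"
    by (subst diff_conv_add_uminus, rule filterlim_tendsto_add_at_top[OF tendsto_const filterlim_ident, of "-s", simplified add.commute])
  have lim1: "((\<lambda>T. xi (T - s) (Phi s w) t) \<longlongrightarrow> Phi t (Phi s w)) at_top"
    by (rule filterlim_compose[OF xi_tendsto[OF t] shift])
  have lim2: "((\<lambda>T. xi (T - s) (xi T w s - Phi s w) t) \<longlongrightarrow> 0) at_top"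
  proof (rule tendsto_norm_zero_cancel, rule tendsto_sandwich[OF _ _ tendsto_const])
    show "((\<lambda>T. kap t * norm (xi T w s - Phi s w)) \<longlongrightarrow> 0) at_top"
      by (intro tendsto_mult_right_zero tendsto_norm_zero LIM_zero xi_tendsto s)
    show "\<forall>\<^sub>F T in at_top. norm (xi (T - s) (xi T w s - Phi s w) t) \<le> kap t * norm (xi T w s - Phi s w)"
      using eventually_gt_at_top[of "s + t"]
      by eventually_elim (use xi_bound t in auto)
  qed simp
  show "((\<lambda>T. xi T w (s + t)) \<longlongrightarrow> Phi t (Phi s w)) at_top"
  proof (rule tendsto_at_top_transform[where t = "s + t"])
    show "((\<lambda>T. xi (T - s) (xi T w s - Phi s w) t + xi (T - s) (Phi s w) t) \<longlongrightarrow> Phi t (Phi s w)) at_top"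
      using tendsto_add[OF lim2 lim1] by simp
    show "xi (T - s) (xi T w s - Phi s w) t + xi (T - s) (Phi s w) t = xi T w (s + t)"
      if "T > s + t" for T
      using that s t by (simp add: xi_tail xi_diff)
  qed
qed (use s t in simp)

lemma Phi_minus_free:
  assumes "0 \<le> t" "t \<le> t1"
  shows "norm (Phi t w - S t w) \<le> S_bd t1 * nB * sqrt t * sqrt (cV / m) * norm w"
proof (rule tendsto_upperbound[OF tendsto_norm[OF tendsto_diff[OF xi_tendsto[OF assms(1)] tendsto_const]]])
  show "\<forall>\<^sub>F T in at_top. norm (xi T w t - S t w) \<le> S_bd t1 * nB * sqrt t * sqrt (cV / m) * norm w"
    using eventually_gt_at_top[of "max 0 t"]
    by eventually_elim (use xi_minus_free assms in auto)
qed simp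

lemma Phi_c0: "c0_semigroup Phi"
  unfolding c0_semigroup_def
proof (intro conjI allI impI)
  fix x
  have "((\<lambda>t. Phi t x - S t x) \<longlongrightarrow> 0) (at_right 0)"
  proof (rule tendsto_norm_zero_cancel, rule tendsto_sandwich[OF _ _ tendsto_const])
    have "((\<lambda>t. S_bd 1 * nB * sqrt t * sqrt (cV / m) * norm x)
      \<longlongrightarrow> S_bd 1 * nB * sqrt 0 * sqrt (cV / m) * norm x) (at_right 0)"
      by (intro tendsto_intros)
    then show "((\<lambda>t. S_bd 1 * nB * sqrt t * sqrt (cV / m) * norm x) \<longlongrightarrow> 0) (at_right 0)" by simp
    show "\<forall>\<^sub>F t in at_right 0. norm (Phi t x - S t x) \<le> S_bd 1 * nB * sqrt t * sqrt (cV / m) * norm x"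
      unfolding eventually_at_right_field
      by (intro exI[of _ 1]) (auto intro: Phi_minus_free)
  qed simp
  from tendsto_add[OF this S_lim[of x]] show "((\<lambda>t. Phi t x) \<longlongrightarrow> x) (at_right 0)" by simp
next
  fix s t :: real and x assume "0 \<le> s" "0 \<le> t"
  then show "Phi (s + t) x = Phi s (Phi t x)" using Phi_semigroup[of t s x] by (simp add: add.commute)
qed (auto simp: Phi_bounded_clinear Phi_0)

text \<open>The contraction time is known only after the horizon. Since \<open>Phi_bound\<close> is
  uniform for times up to \<tau>, the horizon can be fixed first, with an error below a quarter of
  \<open>norm w\<close>.\<close>

lemma Phi_near: "\<exists>t\<in>{1..\<tau>}. norm (Phi t w) \<le> norm w / 2"
proof (cases "w = 0")
  case True
  have "Phi 1 (0 *\<^sub>R 0) = 0 *\<^sub>R Phi 1 0" by (rule Phi_scaleR) simp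
  then show ?thesis using True tau by (intro bexI[of _ 1]) auto
next
  case False
  let ?k = "S_bd \<tau> * nB * sqrt \<tau>"
  have "((\<lambda>T. ?k * sqrt (gap T w / m)) \<longlongrightarrow> ?k * sqrt (0 / m)) at_top"
    by (intro tendsto_intros gap_tendsto) (use m_pos in auto)
  then have "\<forall>\<^sub>F T in at_top. ?k * sqrt (gap T w / m) < norm w / 4"
    using False by (intro order_tendstoD) auto
  then have "\<forall>\<^sub>F T in at_top. T \<ge> \<tau> \<and> ?k * sqrt (gap T w / m) < norm w / 4"
    using eventually_ge_at_top[of \<tau>] by eventually_elim simp
  then obtain T where T: "T \<ge> \<tau>" "?k * sqrt (gap T w / m) < norm w / 4"
    by (auto simp: eventually_at_top_linorder)
  obtain t where t: "t \<in> {1..\<tau>}" "norm (xi T w t) \<le> norm w / 4" by (rule xi_near[OF T(1)])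
  have "norm (Phi t w - xi T w t) \<le> ?k * sqrt (gap T w / m)"
    by (rule Phi_bound) (use t T tau in auto)
  then have "norm (Phi t w) \<le> norm w / 2"
    using t(2) T(2) norm_triangle_sub[of "Phi t w" "xi T w t"] by linarith
  then show ?thesis using t(1) by blast
qed

lemma Phi_exp_stable: "exp_stable_on UNIV Phi"
proof (rule exp_stable_onI_contraction[where M = "kap \<tau>" and \<tau> = \<tau>])
  show "Phi (s + t) x = Phi s (Phi t x)" if "0 \<le> s" "0 \<le> t" for s t x
    using Phi_semigroup[OF that(2,1)] by (simp add: add.commute)
  show "kap \<tau> > 0" using kap_pos[of \<tau>] tau by simp
  show "\<exists>t\<in>{1..\<tau>}. norm (Phi t x) \<le> norm x / 2" for x by (rule Phi_near)
qed (auto simp: Phi_norm_le tau)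

lemma unobservable_exp_stable: "exp_stable_on (unobservable_subspace S C) S"
proof -
  have inv: "S t x \<in> unobservable_subspace S C"
    if "0 \<le> t" "x \<in> unobservable_subspace S C" for t x
    using that by (auto simp: unobservable_subspace_def S_add[symmetric])
  have eq: "Phi t x = S t x" if t: "0 \<le> t" and x: "x \<in> unobservable_subspace S C" for t x
    using t
  proof (rule Phi_eqI)
    have st: "stationary T x (\<lambda>_. 0)" for T
      unfolding stationary_def
    proof (intro conjI ballI L2_const)
      fix h :: "real \<Rightarrow> 'u"
      have "L2_inner T (\<lambda>t. C (S t x)) (\<lambda>t. C (traj 0 h t)) = L2_inner T (\<lambda>t. 0) (\<lambda>t. C (traj 0 h t))"
        by (rule L2_inner_cong) (use x in \<open>auto simp: unobservable_subspace_def\<close>)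
      then show "form T x (\<lambda>_. 0) 0 h = 0"
        by (simp add: form_zero_control) (simp add: L2_inner_def)
    qed
    show "((\<lambda>T. xi T x t) \<longlongrightarrow> S t x) at_top"
      by (rule tendsto_at_top_transform[OF _ tendsto_const, where t = t])
        (use xi_eq[OF st] t in \<open>auto simp: traj_zero_control\<close>)
  qed
  obtain M \<omega> where M: "M > 0" "\<omega> > 0" "\<And>t x. t \<ge> 0 \<Longrightarrow> norm (Phi t x) \<le> M * exp (- \<omega> * t) * norm x"
    using Phi_exp_stable unfolding exp_stable_on_def by blast
  have "norm (S t x) \<le> M * exp (- \<omega> * t) * norm x"
    if "0 \<le> t" "x \<in> unobservable_subspace S C" for t x
    using M(3)[of t x] eq[OF that] that by simp
  then show ?thesis unfolding exp_stable_on_def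
    using inv M(1,2) by (intro conjI allI impI ballI exI[of _ M] exI[of _ \<omega>]) auto
qed

end

section \<open>The stabilizing feedback\<close>

text \<open>Applied both to \<open>V\<close> and to the difference of \<open>V\<close> at two
  horizons, which is semidefinite by monotonicity.\<close>

lemma psd_form_Cauchy_Schwarz:
  fixes b :: "'a::real_vector \<Rightarrow> 'a \<Rightarrow> real"
  assumes add: "\<And>x y z. b (x + y) z = b x z + b y z"
    and scale: "\<And>c x y. b (c *\<^sub>R x) y = c * b x y"
    and comm: "\<And>x y. b x y = b y x" and nonneg: "\<And>x. b x x \<ge> 0"
  shows "(b x y)\<^sup>2 \<le> b x x * b y y"
proof (rule quadratic_nonneg_imp_discriminant[OF _ nonneg])
  fix s
  have r: "b u (v + w) = b u v + b u w" "b u (c *\<^sub>R v) = c * b u v" for u v w c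
    using add[of v w u] scale[of c v u] by (simp_all add: comm[of u])
  have "0 \<le> b (x + s *\<^sub>R y) (x + s *\<^sub>R y)" by (rule nonneg)
  also have "\<dots> = b x x + 2 * s * b x y + s\<^sup>2 * b y y"
    by (simp add: add scale r comm[of y x] power2_eq_square algebra_simps)
  finally show "0 \<le> b x x + 2 * s * b x y + s\<^sup>2 * b y y" .
qed

context lq_contractive
begin

section \<open>The infinite horizon Riccati form and its feedback\<close>

lemma V_abs_le:
  assumes T: "T > 0"
  shows "\<bar>V T w y\<bar> \<le> cV * norm w * norm y"
proof -
  have "(V T w y)\<^sup>2 \<le> V T w w * V T y y"
  proof (rule psd_form_Cauchy_Schwarz)
    show "V T x z = V T z x" for x z by (rule V_commute)
  qed (simp_all add: V_add_left V_scaleR_left V_nonneg T)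
  also have "\<dots> \<le> (cV * (norm w)\<^sup>2) * (cV * (norm y)\<^sup>2)"
    using cV_nonneg by (intro mult_mono V_bound T V_nonneg) auto
  also have "\<dots> = (cV * norm w * norm y)\<^sup>2" by (simp add: power2_eq_square)
  finally show ?thesis using cV_nonneg by (simp add: abs_le_square_iff[symmetric])
qed

text \<open>Polarization of the limit cost: the form of the algebraic Riccati operator.\<close>

definition Vi :: "'h \<Rightarrow> 'h \<Rightarrow> real" where
  "Vi w y = (Vs (w + y) - Vs (w - y)) / 4"

lemma Vi_tendsto: "((\<lambda>T. V T w y) \<longlongrightarrow> Vi w y) at_top"
proof (rule tendsto_at_top_transform[where t = 0])
  show "((\<lambda>T. (V T (w + y) (w + y) - V T (w - y) (w - y)) / 4) \<longlongrightarrow> Vi w y) at_top"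
    unfolding Vi_def by (intro tendsto_intros V_tendsto) simp
  show "(V T (w + y) (w + y) - V T (w - y) (w - y)) / 4 = V T w y" if "T > 0" for T
    using that by (simp add: V_add_left V_add_right V_diff_left V_diff_right V_commute[of T y w])
qed

lemma Vi_eqI:
  assumes "((\<lambda>T. V T w y) \<longlongrightarrow> l) at_top"
  shows "Vi w y = l"
  using tendsto_unique[OF _ Vi_tendsto assms] by simp

lemma Vi_add_right: "Vi w (y + y') = Vi w y + Vi w y'"
  by (rule Vi_eqI, rule tendsto_at_top_transform[OF _ tendsto_add[OF Vi_tendsto Vi_tendsto], where t = 0])
    (simp add: V_add_right)

lemma Vi_scaleR_right: "Vi w (c *\<^sub>R y) = c * Vi w y"
  by (rule Vi_eqI, rule tendsto_at_top_transform[OF _ tendsto_mult[OF tendsto_const Vi_tendsto], where t = 0])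
    (simp add: V_scaleR_right)

lemma Vi_add_left: "Vi (w + w') y = Vi w y + Vi w' y"
  by (rule Vi_eqI, rule tendsto_at_top_transform[OF _ tendsto_add[OF Vi_tendsto Vi_tendsto], where t = 0])
    (simp add: V_add_left)

lemma Vi_scaleR_left: "Vi (c *\<^sub>R w) y = c * Vi w y"
  by (rule Vi_eqI, rule tendsto_at_top_transform[OF _ tendsto_mult[OF tendsto_const Vi_tendsto], where t = 0])
    (simp add: V_scaleR_left)

lemma V_scaleC:
  assumes "T > 0"
  shows "V T (scaleC c w) y = V T w (scaleC (cnj c) y)"
proof -
  have "L2_inner T (\<lambda>t. C (xi T (scaleC c w) t)) (\<lambda>t. C (S t y))
    = L2_inner T (\<lambda>t. C (xi T w t)) (\<lambda>t. C (S t (scaleC (cnj c) y)))"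
    unfolding L2_inner_def
    by (rule integral_cong) (simp add: xi_scaleC assms C_scaleC S_scaleC inner_scaleC_left)
  then show ?thesis using assms by (simp add: V_free)
qed

lemma Vi_scaleC: "Vi (scaleC c w) y = Vi w (scaleC (cnj c) y)"
  by (rule Vi_eqI, rule tendsto_at_top_transform[OF _ Vi_tendsto, where t = 0]) (simp add: V_scaleC)

lemma Vi_abs_le: "\<bar>Vi w y\<bar> \<le> cV * norm w * norm y"
proof (rule tendsto_upperbound[OF tendsto_rabs[OF Vi_tendsto]])
  show "\<forall>\<^sub>F T in at_top. \<bar>V T w y\<bar> \<le> cV * norm w * norm y"
    using eventually_gt_at_top[of 0] by eventually_elim (rule V_abs_le)
qed simp

text \<open>Later \<open>y\<close> runs through all values \<open>B (h s)\<close> while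
  \<open>w\<close> stays fixed, so the error has to be uniform in \<open>y\<close>. Cauchy-Schwarz
  for the increment of \<open>V\<close> over the horizon puts the decay on \<open>w\<close> and only
  the bound \<open>cV\<close> on \<open>y\<close>.\<close>

lemma Vi_error:
  assumes T: "T > 0"
  shows "\<bar>Vi w y - V T w y\<bar> \<le> sqrt (gap T w) * sqrt cV * norm y"
proof (rule tendsto_upperbound[OF tendsto_rabs[OF tendsto_diff[OF Vi_tendsto tendsto_const]]])
  show "\<forall>\<^sub>F T' in at_top. \<bar>V T' w y - V T w y\<bar> \<le> sqrt (gap T w) * sqrt cV * norm y"
    using eventually_ge_at_top[of T]
  proof eventually_elim
    case (elim T')
    have T': "T' > 0" using elim T by simp
    define D where "D x z = V T' x z - V T x z" for x z
    have "(D w y)\<^sup>2 \<le> D w w * D y y"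
    proof (rule psd_form_Cauchy_Schwarz)
      show "D x z = D z x" for x z using V_commute[of T x z] V_commute[of T' x z] by (simp add: D_def)
    qed (use V_mono[OF T elim] in \<open>simp_all add: D_def V_add_left V_scaleR_left T T' algebra_simps\<close>)
    also have "\<dots> \<le> gap T w * (cV * (norm y)\<^sup>2)"
    proof (rule mult_mono)
      show "D w w \<le> gap T w" using V_le_Vs[OF T', of w] by (simp add: D_def gap_def)
      show "D y y \<le> cV * (norm y)\<^sup>2" using V_bound[OF T', of y] V_nonneg[of T y] by (simp add: D_def)
      show "0 \<le> D y y" using V_mono[OF T elim, of y] by (simp add: D_def)
    qed (rule gap_nonneg[OF T])
    finally have "\<bar>D w y\<bar>\<^sup>2 \<le> gap T w * (cV * (norm y)\<^sup>2)" by simp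
    then have "\<bar>D w y\<bar> \<le> sqrt (gap T w * (cV * (norm y)\<^sup>2))" by (rule real_le_rsqrt)
    also have "\<dots> = sqrt (gap T w) * sqrt cV * norm y" unfolding real_sqrt_mult by simp
    finally show ?case by (simp add: D_def)
  qed
qed simp

text \<open>The classical feedback, minus the inverse of the adjoint of \<open>K\<close> times
  \<open>K\<close>, applied to the adjoint of \<open>B\<close> times the Riccati operator. It is
  defined weakly, through the coercive form of \<open>K\<close>.\<close>

definition F :: "'h \<Rightarrow> 'u" where
  "F w = (SOME x. \<forall>g. K x \<bullet> K g = - Vi w (B g))"

lemma F: "K (F w) \<bullet> K g = - Vi w (B g)"
proof -
  have "bounded_linear (\<lambda>g. - Vi w (B g))"
  proof (rule bounded_linear_intro[where K = "cV * norm w * nB"])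
    show "norm (- Vi w (B g)) \<le> norm g * (cV * norm w * nB)" for g
    proof -
      have "\<bar>Vi w (B g)\<bar> \<le> cV * norm w * norm (B g)" by (rule Vi_abs_le)
      also have "\<dots> \<le> cV * norm w * (nB * norm g)" using cV_nonneg nB by (intro mult_left_mono) auto
      finally show ?thesis by (simp add: mult_ac)
    qed
  qed (simp_all add: B_linear Vi_add_right Vi_scaleR_right)
  then obtain x where "\<And>g. K x \<bullet> K g = - Vi w (B g)"
    using Riesz_coercive[OF K_bounded_linear m_pos K_coercive] by blast
  then have "\<exists>x. \<forall>g. K x \<bullet> K g = - Vi w (B g)" by blast
  from someI_ex[OF this] show ?thesis unfolding F_def by blast
qed

lemma K_inner_unique:
  assumes "\<And>g. K x \<bullet> K g = K y \<bullet> K g"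
  shows "x = y"
proof -
  have "K (x - y) \<bullet> K (x - y) = 0"
    using assms[of "x - y"] by (simp add: K_linear(2) inner_diff_left)
  then have "m * (norm (x - y))\<^sup>2 \<le> 0" using K_coercive[of "x - y"] by (simp add: dot_square_norm)
  then show ?thesis using m_pos by (simp add: mult_le_0_iff)
qed

lemma F_bounded_clinear: "bounded_clinear F"
  unfolding bounded_clinear_def
proof (intro conjI allI)
  show "F (scaleC c w) = scaleC c (F w)" for c w
  proof (rule K_inner_unique)
    show "K (F (scaleC c w)) \<bullet> K g = K (scaleC c (F w)) \<bullet> K g" for g
      using F[of w "scaleC (cnj c) g"] by (simp add: F Vi_scaleC K_scaleC B_scaleC inner_scaleC_left)
  qed
  show "bounded_linear F"
  proof (rule bounded_linear_intro[where K = "cV * nB / m"])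
    show "F (x + y) = F x + F y" for x y
      by (rule K_inner_unique) (simp add: K_linear F Vi_add_left inner_add_left)
    show "F (c *\<^sub>R x) = c *\<^sub>R F x" for c x
      by (rule K_inner_unique) (simp add: K_linear F Vi_scaleR_left)
    show "norm (F x) \<le> norm x * (cV * nB / m)" for x
    proof (cases "F x = 0")
      case False
      have "m * (norm (F x))\<^sup>2 \<le> K (F x) \<bullet> K (F x)" using K_coercive by (simp add: dot_square_norm)
      also have "\<dots> \<le> cV * norm x * norm (B (F x))" using Vi_abs_le[of x "B (F x)"] by (simp add: F)
      also have "\<dots> \<le> cV * norm x * (nB * norm (F x))" using cV_nonneg nB by (intro mult_left_mono) auto
      finally have "m * norm (F x) * norm (F x) \<le> cV * norm x * nB * norm (F x)"
        by (simp add: power2_eq_square algebra_simps)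
      then have "m * norm (F x) \<le> cV * norm x * nB" using False by simp
      then show ?thesis using m_pos by (simp add: field_simps)
    qed (use cV_nonneg nB m_pos in simp)
  qed
qed

section \<open>Short time behaviour of optimal trajectories\<close>

lemma V_tail:
  assumes r: "0 \<le> r" "r < T"
  shows "V T a y = L2_inner r (\<lambda>t. C (xi T a t)) (\<lambda>t. C (S t y)) + V (T - r) (xi T a r) (S r y)"
proof -
  have T: "T > 0" "T - r > 0" using r by auto
  \<comment> \<open>The optimal factor restarts from its own state at \<open>r\<close>, the free
    factor from \<open>S r y\<close>.\<close>
  have "L2_inner (T - r) (\<lambda>t. C (xi T a (r + t))) (\<lambda>t. C (S (r + t) y))
    = L2_inner (T - r) (\<lambda>t. C (xi (T - r) (xi T a r) t)) (\<lambda>t. C (S t (S r y)))"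
  proof (rule L2_inner_cong)
    fix t assume t: "t \<in> {0..T - r}"
    then show "C (xi T a (r + t)) = C (xi (T - r) (xi T a r) t)" using r by (simp add: xi_tail)
    show "C (S (r + t) y) = C (S t (S r y))" using S_add[of t r y] t r by (simp add: add.commute)
  qed
  then show ?thesis
    using L2_inner_split[OF C_xi_L2[OF T(1)] CS_L2 r(1), of a y] r T by (simp add: V_free)
qed

lemma L2_inner_head_le:
  assumes "0 < T" "0 \<le> r" "r \<le> T" "r \<le> 1"
  shows "\<bar>L2_inner r (\<lambda>t. C (xi T a t)) (\<lambda>t. C (S t y))\<bar> \<le> r * (nC * kap 1 * norm a) * (nC * S_bd 1 * norm y)"
proof -
  have sub: "(\<lambda>t. C (xi T a t)) \<in> L2_controls r"
    using C_xi_L2[OF assms(1)] by (rule L2_subset) (use assms in auto)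
  have "norm (L2_inner r (\<lambda>t. C (xi T a t)) (\<lambda>t. C (S t y)))
    \<le> integral {0..r} (\<lambda>t. (nC * kap 1 * norm a) * (nC * S_bd 1 * norm y))"
    unfolding L2_inner_def
  proof (rule integral_norm_bound_integral[OF L2_integrable_inner[OF sub CS_L2] integrable_const_ivl])
    fix t assume t: "t \<in> {0..r}"
    have "norm (C (xi T a t)) \<le> nC * norm (xi T a t)" by (rule nC)
    also have "\<dots> \<le> nC * (kap 1 * norm a)" using nC(1) t assms by (intro mult_left_mono xi_bound) auto
    finally have 1: "norm (C (xi T a t)) \<le> nC * kap 1 * norm a" by simp
    have "norm (C (S t y)) \<le> nC * norm (S t y)" by (rule nC)
    also have "\<dots> \<le> nC * (S_bd 1 * norm y)" using nC(1) t assms by (intro mult_left_mono S_bd) auto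
    finally have 2: "norm (C (S t y)) \<le> nC * S_bd 1 * norm y" by simp
    have "norm (C (xi T a t) \<bullet> C (S t y)) \<le> norm (C (xi T a t)) * norm (C (S t y))"
      by (simp add: Cauchy_Schwarz_ineq2)
    also have "\<dots> \<le> (nC * kap 1 * norm a) * (nC * S_bd 1 * norm y)"
      by (rule mult_mono[OF 1 2 order_trans[OF norm_ge_zero 1]]) simp
    finally show "norm (C (xi T a t) \<bullet> C (S t y)) \<le> (nC * kap 1 * norm a) * (nC * S_bd 1 * norm y)" .
  qed
  then show ?thesis using assms by (simp add: mult_ac)
qed

text \<open>All three are constants for the unit time interval: \<open>c1\<close> for the head of
  the cost in \<open>V_local_error\<close>, \<open>c2\<close> for the observation term in
  \<open>opt_near_F\<close>, \<open>c3\<close> for the distance of the optimal from the free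
  motion.\<close>

definition c1 :: real where "c1 = (nC * kap 1 * kap 1) * (nC * S_bd 1)"
definition c2 :: real where "c2 = (nC * kap 1) * (nC * S_bd 1 * nB)"
definition c3 :: real where "c3 = S_bd 1 * nB * sqrt (cV / m)"

text \<open>Three comparisons are added: going back from time \<open>t\<close> to \<open>s\<close>
  by dynamic programming, replacing the state at \<open>s\<close> by \<open>w\<close>, and replacing
  horizon \<open>T - s\<close> by infinity. The first removes \<open>S (t - s)\<close> from
  \<open>y\<close> at the price of a cost integral of order \<open>t\<close>, uniformly in
  \<open>y\<close>.\<close>

lemma V_local_error:
  assumes s: "0 \<le> s" "s \<le> t" and t: "t \<le> 1" "T > 1" and \<delta>: "norm (S s w - w) \<le> \<delta>"
  shows "\<bar>V (T - t) (xi T w t) (S (t - s) y) - Vi w y\<bar>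
    \<le> (c1 * t * norm w + cV * (c3 * sqrt t * norm w + \<delta>) + sqrt (gap (T - 1) w) * sqrt cV) * norm y"
proof -
  define a where "a = xi T w s"
  have pos: "T - s > 0" "T - s \<ge> T - 1" using s t by auto
  have a_le: "norm a \<le> kap 1 * norm w" unfolding a_def by (rule xi_bound) (use s t in auto)
  have k1: "kap 1 \<ge> 1" by (rule kap_pos) simp
  have "xi (T - s) a (t - s) = xi T w t"
    using xi_tail[of s "t - s" T w] s t by (simp add: a_def)
  then have "V (T - s) a y - V (T - t) (xi T w t) (S (t - s) y)
    = L2_inner (t - s) (\<lambda>r. C (xi (T - s) a r)) (\<lambda>r. C (S r y))"
    using V_tail[of "t - s" "T - s" a y] s t by simp
  then have "\<bar>V (T - s) a y - V (T - t) (xi T w t) (S (t - s) y)\<bar>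
    \<le> (t - s) * (nC * kap 1 * norm a) * (nC * S_bd 1 * norm y)"
    using L2_inner_head_le[of "T - s" "t - s" a y] s t by simp
  also have "\<dots> \<le> t * (nC * kap 1 * (kap 1 * norm w)) * (nC * S_bd 1 * norm y)"
    using s t a_le nC(1) k1 S_bd(1)[of 1] by (intro mult_mono mult_nonneg_nonneg order_refl) auto
  also have "\<dots> = c1 * t * norm w * norm y" by (simp add: c1_def mult_ac)
  finally have e1: "\<bar>V (T - s) a y - V (T - t) (xi T w t) (S (t - s) y)\<bar> \<le> c1 * t * norm w * norm y" .
  have "norm (a - w) \<le> norm (a - S s w) + norm (S s w - w)"
    using norm_triangle_ineq[of "a - S s w" "S s w - w"] by simp
  also have "norm (a - S s w) \<le> S_bd 1 * nB * sqrt s * sqrt (cV / m) * norm w"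
    unfolding a_def by (rule xi_minus_free) (use s t in auto)
  also have "\<dots> \<le> S_bd 1 * nB * sqrt t * sqrt (cV / m) * norm w"
    using s S_bd(1)[of 1] nB(1) cV_nonneg m_pos by (intro mult_right_mono mult_left_mono) auto
  finally have aw: "norm (a - w) \<le> c3 * sqrt t * norm w + \<delta>" using \<delta> by (simp add: c3_def mult_ac)
  have "\<bar>V (T - s) a y - V (T - s) w y\<bar> \<le> cV * norm (a - w) * norm y"
    using V_abs_le[OF pos(1), of "a - w" y] by (simp add: V_diff_left[OF pos(1)])
  also have "\<dots> \<le> cV * (c3 * sqrt t * norm w + \<delta>) * norm y"
    using cV_nonneg aw by (intro mult_right_mono mult_left_mono) auto
  finally have e2: "\<bar>V (T - s) a y - V (T - s) w y\<bar> \<le> cV * (c3 * sqrt t * norm w + \<delta>) * norm y" .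
  have "\<bar>Vi w y - V (T - s) w y\<bar> \<le> sqrt (gap (T - s) w) * sqrt cV * norm y" by (rule Vi_error[OF pos(1)])
  also have "\<dots> \<le> sqrt (gap (T - 1) w) * sqrt cV * norm y"
    using gap_mono[of "T - 1" "T - s" w] pos t cV_nonneg by (intro mult_right_mono) auto
  finally have e3: "\<bar>Vi w y - V (T - s) w y\<bar> \<le> sqrt (gap (T - 1) w) * sqrt cV * norm y" .
  from e1 e2 e3 show ?thesis unfolding distrib_right by linarith
qed

text \<open>The stationarity of the optimal control \<open>u\<close> is tested with \<open>h = u - F w\<close> on \<open>{0..t}\<close>, continued
  by \<open>0\<close>. The cost on \<open>{t..T}\<close> is then a value of the form \<open>V\<close> at \<open>\<integral> S (t - s) (B (h s)) ds\<close>, and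
  by dynamic programming \<open>V\<close> absorbs \<open>S (t - s)\<close> up to a small error. A uniform estimate for
  \<open>S (t - s) - I\<close>, which fails for a merely strongly continuous semigroup, is thus avoided.\<close>

lemma opt_near_F:
  assumes t: "0 < t" "t \<le> 1" "T > 1" and \<delta>: "\<And>s. 0 \<le> s \<Longrightarrow> s \<le> t \<Longrightarrow> norm (S s w - w) \<le> \<delta>"
  defines "e \<equiv> c2 * t * norm w
     + nB * (c1 * t * norm w + cV * (c3 * sqrt t * norm w + \<delta>) + sqrt (gap (T - 1) w) * sqrt cV)"
  shows "norm (xi T w t - S t w - integral {0..t} (\<lambda>s. S (t - s) (B (F w)))) \<le> S_bd 1 * nB * (t * e / m)"
proof -
  define u where "u = opt T w"
  define h where "h s = u s - F w" for s
  have T: "T > 0" "t < T" "t \<le> T" "0 \<le> t" using t by auto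
  have u: "u \<in> L2_controls T" unfolding u_def by (rule opt_L2[OF T(1)])
  have ut: "u \<in> L2_controls t" using u T by (auto intro: L2_subset)
  have h: "h \<in> L2_controls t" unfolding h_def by (rule L2_diff[OF ut L2_const])
  let ?E = "c1 * t * norm w + cV * (c3 * sqrt t * norm w + \<delta>) + sqrt (gap (T - 1) w) * sqrt cV"
  have E_nonneg: "?E \<ge> 0"
  proof -
    have "0 \<le> \<delta>" using order_trans[OF norm_ge_zero \<delta>[of 0]] t by simp
    moreover have "kap 1 \<ge> 1" by (rule kap_pos) simp
    ultimately show ?thesis
      using cV_nonneg t nC(1) nB(1) S_bd(1)[of 1] m_pos gap_nonneg[of "T - 1" w]
      unfolding c1_def c3_def by (intro add_nonneg_nonneg mult_nonneg_nonneg) auto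
  qed
  let ?c = "concat_control t h (\<lambda>_. 0)"
  have c: "?c \<in> L2_controls T" by (rule L2_concat[OF h L2_const]) (use T in auto)
  have tr: "traj 0 ?c r = traj 0 h r" if "r \<le> t" for r using that by (rule traj_concat_before)
  have head: "form t w u 0 ?c = L2_inner t (\<lambda>r. C (xi T w r)) (\<lambda>r. C (traj 0 h r))
      + L2_inner t (\<lambda>r. K (u r)) (\<lambda>r. K (h r))"
  proof -
    have "L2_inner t (\<lambda>r. K (u r)) (\<lambda>r. K (?c r)) = L2_inner t (\<lambda>r. K (u r)) (\<lambda>r. K (h r))"
      unfolding L2_inner_def by (rule integral_spike[of "{t}"]) (auto simp: concat_control_def)
    moreover have "L2_inner t (\<lambda>r. C (traj w u r)) (\<lambda>r. C (traj 0 ?c r))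
      = L2_inner t (\<lambda>r. C (xi T w r)) (\<lambda>r. C (traj 0 h r))"
      by (rule L2_inner_cong) (simp_all add: tr xi_def u_def)
    ultimately show ?thesis by (simp add: form_def)
  qed
  have tail: "form (T - t) (traj w u t) (\<lambda>r. u (t + r)) (traj 0 ?c t) (\<lambda>r. ?c (t + r))
    = V (T - t) (xi T w t) (traj 0 h t)"
  proof -
    have st: "stationary (T - t) (xi T w t) (\<lambda>r. u (t + r))"
      unfolding xi_def u_def by (rule stationary_tail[OF opt[OF T(1)] T(4,3)])
    have "form (T - t) (traj w u t) (\<lambda>r. u (t + r)) (traj 0 ?c t) (\<lambda>r. ?c (t + r))
      = form (T - t) (xi T w t) (\<lambda>r. u (t + r)) (traj 0 h t) (\<lambda>_. 0)"
      unfolding tr[OF order_refl] xi_def u_def by (rule form_cong) (simp_all add: concat_control_def)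
    also have "\<dots> = L2_inner (T - t) (\<lambda>r. C (traj (xi T w t) (\<lambda>r. u (t + r)) r)) (\<lambda>r. C (S r (traj 0 h t)))"
      by (subst form_commute, subst form_zero_control) (rule L2_inner_commute)
    also have "\<dots> = L2_inner (T - t) (\<lambda>r. C (xi (T - t) (xi T w t) r)) (\<lambda>r. C (S r (traj 0 h t)))"
      by (rule L2_inner_cong) (use xi_eq[OF st] T in auto)
    also have "\<dots> = V (T - t) (xi T w t) (traj 0 h t)" using T by (simp add: V_free)
    finally show ?thesis .
  qed
  have eq: "L2_inner t (\<lambda>r. K (u r)) (\<lambda>r. K (h r))
    = - L2_inner t (\<lambda>r. C (xi T w r)) (\<lambda>r. C (traj 0 h r)) - V (T - t) (xi T w t) (traj 0 h t)"
    using form_split[OF u c T(4,3), of w 0] stationaryD[OF opt[OF T(1)] c, of w]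
    unfolding head tail by (simp add: u_def)
  let ?N = "integral {0..t} (\<lambda>r. norm (h r))"
  have hsub: "h \<in> L2_controls r" if "0 \<le> r" "r \<le> t" for r using h that by (auto intro: L2_subset)
  have N_mono: "integral {0..r} (\<lambda>r. norm (h r)) \<le> ?N" if "0 \<le> r" "r \<le> t" for r
    by (rule integral_subset_le) (use that L2_integrable_norm[OF h] L2_integrable_norm[OF hsub[OF that]] in auto)
  have N0: "?N \<ge> 0"
    by (rule Henstock_Kurzweil_Integration.integral_nonneg[OF L2_integrable_norm[OF h]]) simp
  have b1: "\<bar>L2_inner t (\<lambda>r. C (xi T w r)) (\<lambda>r. C (traj 0 h r))\<bar> \<le> c2 * t * norm w * ?N"
  proof -
    have sub: "(\<lambda>r. C (xi T w r)) \<in> L2_controls t"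
      using C_xi_L2[OF T(1)] by (rule L2_subset) (use T in auto)
    have "norm (L2_inner t (\<lambda>r. C (xi T w r)) (\<lambda>r. C (traj 0 h r)))
      \<le> integral {0..t} (\<lambda>r. (nC * kap 1 * norm w) * (nC * S_bd 1 * nB * ?N))"
      unfolding L2_inner_def
    proof (rule integral_norm_bound_integral[OF L2_integrable_inner[OF sub C_traj_L2[OF h]] integrable_const_ivl])
      fix r assume r: "r \<in> {0..t}"
      have "norm (C (xi T w r)) \<le> nC * norm (xi T w r)" by (rule nC)
      also have "\<dots> \<le> nC * (kap 1 * norm w)" using nC(1) r t by (intro mult_left_mono xi_bound) auto
      finally have 1: "norm (C (xi T w r)) \<le> nC * kap 1 * norm w" by simp
      have "norm (traj 0 h r) \<le> S_bd 1 * (nB * integral {0..r} (\<lambda>r. norm (h r)))"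
        using traj_norm_le[OF hsub, of r 1 0] r t by simp
      also have "\<dots> \<le> S_bd 1 * (nB * ?N)"
        using S_bd(1)[of 1] nB(1) N_mono r by (intro mult_left_mono) auto
      finally have "nC * norm (traj 0 h r) \<le> nC * (S_bd 1 * (nB * ?N))" using nC(1) by (rule mult_left_mono)
      then have 2: "norm (C (traj 0 h r)) \<le> nC * S_bd 1 * nB * ?N" using nC(2)[of "traj 0 h r"] by simp
      have "norm (C (xi T w r) \<bullet> C (traj 0 h r)) \<le> norm (C (xi T w r)) * norm (C (traj 0 h r))"
        by (simp add: Cauchy_Schwarz_ineq2)
      also have "\<dots> \<le> (nC * kap 1 * norm w) * (nC * S_bd 1 * nB * ?N)"
        by (rule mult_mono[OF 1 2 order_trans[OF norm_ge_zero 1]]) simp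
      finally show "norm (C (xi T w r) \<bullet> C (traj 0 h r)) \<le> (nC * kap 1 * norm w) * (nC * S_bd 1 * nB * ?N)" .
    qed
    then show ?thesis using t by (simp add: c2_def mult_ac)
  qed
  \<comment> \<open>The state \<open>traj 0 h t\<close> is a convolution integral and
    \<open>V\<close> is bounded linear in its right argument. Pulling \<open>V\<close> under the
    integral permits a comparison with \<open>Vi w (B (h s))\<close> at each
    \<open>s\<close>.\<close>
  let ?v = "\<lambda>s. V (T - t) (xi T w t) (S (t - s) (B (h s)))"
  have V_bl: "bounded_linear (V (T - t) (xi T w t))"
    by (rule bounded_linear_intro[where K = "cV * norm (xi T w t)"])
      (use T V_abs_le[of "T - t" "xi T w t"] in \<open>auto simp: V_add_right V_scaleR_right mult_ac\<close>)
  have v_int: "?v integrable_on {0..t}" and v_eq: "V (T - t) (xi T w t) (traj 0 h t) = integral {0..t} ?v"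
    using integrable_linear[OF convolution_integrable[OF h] V_bl]
      integral_linear[OF convolution_integrable[OF h] V_bl] T
    by (simp_all add: o_def mild_solution_def S_linear)
  have KFh: "L2_inner t (\<lambda>_. K (F w)) (\<lambda>r. K (h r)) = integral {0..t} (\<lambda>s. - Vi w (B (h s)))"
    unfolding L2_inner_def by (simp add: F)
  have KFh_int: "(\<lambda>s. - Vi w (B (h s))) integrable_on {0..t}"
    using L2_integrable_inner[OF L2_const K_L2[OF h], of "K (F w)"] by (simp add: F)
  have "\<bar>integral {0..t} ?v - integral {0..t} (\<lambda>s. Vi w (B (h s)))\<bar>
    = norm (integral {0..t} (\<lambda>s. ?v s - Vi w (B (h s))))"
    using KFh_int v_int by (simp add: Henstock_Kurzweil_Integration.integral_diff integrable_neg_iff)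
  also have "\<dots> \<le> integral {0..t} (\<lambda>s. ?E * nB * norm (h s))"
  proof (rule integral_norm_bound_integral)
    show "(\<lambda>s. ?v s - Vi w (B (h s))) integrable_on {0..t}"
      using KFh_int v_int by (intro integrable_diff) (simp_all add: integrable_neg_iff)
    show "(\<lambda>s. ?E * nB * norm (h s)) integrable_on {0..t}"
      by (intro integrable_on_mult_right L2_integrable_norm h)
    fix s assume s: "s \<in> {0..t}"
    have "norm (?v s - Vi w (B (h s))) \<le> ?E * norm (B (h s))"
      using V_local_error[of s t T w \<delta> "B (h s)"] s t \<delta> by simp
    also have "\<dots> \<le> ?E * (nB * norm (h s))" using nB E_nonneg by (intro mult_left_mono) auto
    finally show "norm (?v s - Vi w (B (h s))) \<le> ?E * nB * norm (h s)" by simp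
  qed
  finally have b2: "\<bar>integral {0..t} ?v - integral {0..t} (\<lambda>s. Vi w (B (h s)))\<bar> \<le> ?E * nB * ?N" by simp
  \<comment> \<open>Here \<open>K (h r)\<close> is \<open>K (u r) - K (F w)\<close>. Stationarity
    evaluates the first part, the defining identity of \<open>F\<close> the second; the leading
    terms cancel and only errors remain.\<close>
  have Kh: "L2_inner t (\<lambda>r. K (h r)) (\<lambda>r. K (h r)) \<le> e * ?N"
  proof -
    have "L2_inner t (\<lambda>r. K (h r)) (\<lambda>r. K (h r))
      = L2_inner t (\<lambda>r. K (u r) - K (F w)) (\<lambda>r. K (h r))"
      by (simp add: h_def K_linear)
    also have "\<dots> = L2_inner t (\<lambda>r. K (u r)) (\<lambda>r. K (h r)) - L2_inner t (\<lambda>_. K (F w)) (\<lambda>r. K (h r))"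
      by (rule L2_inner_diff_left[OF K_L2[OF ut] L2_const K_L2[OF h]])
    also have "\<dots> = - L2_inner t (\<lambda>r. C (xi T w r)) (\<lambda>r. C (traj 0 h r))
        - (integral {0..t} ?v - integral {0..t} (\<lambda>s. Vi w (B (h s))))"
      unfolding eq v_eq KFh by simp
    also have "\<dots> \<le> c2 * t * norm w * ?N + ?E * nB * ?N" using b1 b2 by linarith
    also have "\<dots> = e * ?N" unfolding e_def by (simp add: algebra_simps)
    finally show ?thesis .
  qed
  \<comment> \<open>The estimate is quadratic in \<open>q\<close> on the left and linear on the
    right, so \<open>q\<close> is of order \<open>e * sqrt t\<close>. Passing back to the
    \<open>L1\<close> norm gives a second \<open>sqrt t\<close>, in total the factor
    \<open>t\<close> that the difference quotient will divide away.\<close>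
  define q where "q = sqrt (L2_inner t h h)"
  have q: "q \<ge> 0" "q\<^sup>2 = L2_inner t h h" using L2_inner_nonneg[of t h] by (simp_all add: q_def)
  have N_q: "?N \<le> sqrt t * q" unfolding q_def by (rule L2_integral_norm_le_sqrt[OF h T(4)])
  have e0: "e \<ge> 0"
  proof -
    have "kap 1 \<ge> 1" by (rule kap_pos) simp
    then have "c2 \<ge> 0" unfolding c2_def using nC(1) nB(1) S_bd(1)[of 1] by (intro mult_nonneg_nonneg) auto
    then have "0 \<le> c2 * t * norm w" using t by simp
    then show ?thesis unfolding e_def
      using mult_nonneg_nonneg[OF nB(1) E_nonneg] by (rule add_nonneg_nonneg)
  qed
  have "m * q\<^sup>2 \<le> L2_inner t (\<lambda>r. K (h r)) (\<lambda>r. K (h r))"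
  proof -
    have "m * q\<^sup>2 = integral {0..t} (\<lambda>r. m * (norm (h r))\<^sup>2)"
      by (simp add: q L2_inner_self)
    also have "\<dots> \<le> integral {0..t} (\<lambda>r. (norm (K (h r)))\<^sup>2)"
      by (intro integral_le integrable_on_mult_right L2_integrable_norm_sq K_L2 h K_coercive)
    finally show ?thesis by (simp add: L2_inner_self)
  qed
  also note Kh
  also have "e * ?N \<le> e * (sqrt t * q)" using N_q e0 by (rule mult_left_mono)
  finally have mq: "m * q * q \<le> e * sqrt t * q" by (simp add: power2_eq_square mult.assoc)
  have "q \<le> e * sqrt t / m"
  proof (cases "q = 0")
    case False
    then have "m * q \<le> e * sqrt t" using mq q(1) by simp
    then show ?thesis using m_pos by (simp add: field_simps)
  qed (use e0 t m_pos in simp)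
  then have "sqrt t * q \<le> sqrt t * (e * sqrt t / m)" using t by (intro mult_left_mono) auto
  also have "\<dots> = t * e / m" using t by (simp add: field_simps)
  finally have N_le: "?N \<le> t * e / m" using N_q by linarith
  have "xi T w t - S t w - integral {0..t} (\<lambda>s. S (t - s) (B (F w)))
    = integral {0..t} (\<lambda>s. S (t - s) (B (u s)) - S (t - s) (B (F w)))"
    unfolding xi_def mild_solution_def u_def[symmetric]
    by (subst Henstock_Kurzweil_Integration.integral_diff)
      (auto intro: convolution_integrable ut convolution_integrable[OF L2_const])
  also have "\<dots> = integral {0..t} (\<lambda>s. S (t - s) (B (h s)))"
    by (rule integral_cong) (simp add: h_def B_linear S_linear)
  finally have "norm (xi T w t - S t w - integral {0..t} (\<lambda>s. S (t - s) (B (F w)))) \<le> S_bd 1 * nB * ?N"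
    using convolution_norm_le[OF h T(4) t(2)] by simp
  also have "\<dots> \<le> S_bd 1 * nB * (t * e / m)"
    using S_bd(1)[of 1] nB(1) N_le by (intro mult_left_mono) auto
  finally show ?thesis .
qed

text \<open>The horizon goes to infinity at fixed \<open>t\<close>, which removes the
  \<open>gap\<close> term; only afterwards does \<open>t\<close> go to 0.\<close>

lemma Phi_near_F:
  assumes t: "0 < t" "t \<le> 1" and \<delta>: "\<And>s. 0 \<le> s \<Longrightarrow> s \<le> t \<Longrightarrow> norm (S s w - w) \<le> \<delta>"
  shows "norm (Phi t w - S t w - integral {0..t} (\<lambda>s. S (t - s) (B (F w))))
    \<le> S_bd 1 * nB * (t * (c2 * t * norm w
     + nB * (c1 * t * norm w + cV * (c3 * sqrt t * norm w + \<delta>))) / m)"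
proof -
  let ?I = "integral {0..t} (\<lambda>s. S (t - s) (B (F w)))"
  have shift: "filterlim (\<lambda>T. T - 1) at_top (at_top :: real filter)"
    using filterlim_tendsto_add_at_top[OF tendsto_const[of "-1"] filterlim_ident] by simp
  have g: "((\<lambda>T. gap (T - 1) w) \<longlongrightarrow> 0) at_top"
    by (rule filterlim_compose[OF gap_tendsto shift])
  have "((\<lambda>T. S_bd 1 * nB * (t * (c2 * t * norm w
     + nB * (c1 * t * norm w + cV * (c3 * sqrt t * norm w + \<delta>) + sqrt (gap (T - 1) w) * sqrt cV)) / m))
    \<longlongrightarrow> S_bd 1 * nB * (t * (c2 * t * norm w
     + nB * (c1 * t * norm w + cV * (c3 * sqrt t * norm w + \<delta>) + sqrt 0 * sqrt cV)) / m)) at_top"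
    by (intro tendsto_intros g) (use m_pos in auto)
  moreover have "((\<lambda>T. norm (xi T w t - S t w - ?I)) \<longlongrightarrow> norm (Phi t w - S t w - ?I)) at_top"
    by (intro tendsto_intros xi_tendsto) (use t in simp)
  moreover have "\<forall>\<^sub>F T in at_top. norm (xi T w t - S t w - ?I) \<le> S_bd 1 * nB * (t * (c2 * t * norm w
     + nB * (c1 * t * norm w + cV * (c3 * sqrt t * norm w + \<delta>) + sqrt (gap (T - 1) w) * sqrt cV)) / m)"
    using eventually_gt_at_top[of 1] by eventually_elim (rule opt_near_F[OF t _ \<delta>])
  ultimately show ?thesis using tendsto_le[OF trivial_limit_at_top_linorder] by fastforce
qed

text \<open>This holds for every \<open>w\<close>, in or out of the generator's domain: the
  convolution acts on the single vector \<open>B (F w)\<close>, for which strong continuity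
  suffices. The error is split into thirds: \<open>Q t 0\<close>, the part due to \<delta>, and
  \<open>S s y - y\<close>.\<close>

lemma Phi_minus_S_derivative:
  "((\<lambda>t. (Phi t w - S t w) /\<^sub>R t) \<longlongrightarrow> B (F w)) (at_right 0)"
proof (rule tendstoI)
  fix \<epsilon> :: real assume \<epsilon>: "\<epsilon> > 0"
  define y where "y = B (F w)"
  define Q where "Q t \<delta> = S_bd 1 * nB * ((c2 * t * norm w
     + nB * (c1 * t * norm w + cV * (c3 * sqrt t * norm w + \<delta>))) / m)" for t \<delta>
  \<comment> \<open>\<open>R - 1\<close> is the slope of \<open>Q t\<close> in \<delta>, the same
    for all \<open>t\<close>; adding 1 makes division by \<open>R\<close> legitimate.\<close>
  define R where "R = S_bd 1 * nB * (nB * cV / m) + 1"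
  have R: "R > 0" unfolding R_def using S_bd(1)[of 1] nB(1) cV_nonneg m_pos by (simp add: add_nonneg_pos)
  define \<delta> where "\<delta> = \<epsilon> / (3 * R)"
  have \<delta>: "\<delta> > 0" "R * \<delta> = \<epsilon> / 3" using \<epsilon> R by (auto simp: \<delta>_def)
  have "\<forall>\<^sub>F t in at_right 0. dist (S t w) w < \<delta>" "\<forall>\<^sub>F t in at_right 0. dist (S t y) y < \<epsilon> / 3"
    using S_lim tendstoD \<delta>(1) \<epsilon> by (blast, metis S_lim tendstoD zero_less_divide_iff zero_less_numeral)
  then obtain b b' where b: "b > 0" "\<And>t. 0 < t \<Longrightarrow> t < b \<Longrightarrow> dist (S t w) w < \<delta>"
    and b': "b' > 0" "\<And>t. 0 < t \<Longrightarrow> t < b' \<Longrightarrow> dist (S t y) y < \<epsilon> / 3"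
    unfolding eventually_at_right_field by blast
  have "((\<lambda>t. Q t 0) \<longlongrightarrow> Q 0 0) (at_right 0)"
    unfolding Q_def by (intro tendsto_intros) (use m_pos in auto)
  then have "\<forall>\<^sub>F t in at_right 0. Q t 0 < \<epsilon> / 3"
    using \<epsilon> by (intro order_tendstoD) (auto simp: Q_def)
  moreover have "\<forall>\<^sub>F t in at_right 0. t < min 1 (min b b')"
    using b(1) b'(1) by (intro eventually_at_rightI[of 0 "min 1 (min b b')"]) auto
  ultimately have "\<forall>\<^sub>F t in at_right 0. Q t 0 < \<epsilon> / 3 \<and> 0 < t \<and> t < min 1 (min b b')"
    using eventually_at_right_less[of "0::real"] by eventually_elim simp
  then show "\<forall>\<^sub>F t in at_right 0. dist ((Phi t w - S t w) /\<^sub>R t) (B (F w)) < \<epsilon>"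
  proof eventually_elim
    case (elim t)
    then have t: "0 < t" "t \<le> 1" "t < b" "t < b'" and Qt: "Q t 0 < \<epsilon> / 3" by auto
    have sw: "norm (S s w - w) \<le> \<delta>" if "0 \<le> s" "s \<le> t" for s
      using b(2)[of s] \<delta>(1) that t by (cases "s = 0") (auto simp: S_0 dist_norm)
    have sy: "norm (S s y - y) \<le> \<epsilon> / 3" if "0 \<le> s" "s \<le> t" for s
      using b'(2)[of s] \<epsilon> that t by (cases "s = 0") (auto simp: S_0 dist_norm)
    let ?I = "integral {0..t} (\<lambda>s. S (t - s) y)"
    have I_int: "(\<lambda>s. S (t - s) y) integrable_on {0..t}"
      unfolding y_def using convolution_integrable[OF L2_const, of t "F w"] .
    have "norm (Phi t w - S t w - ?I) \<le> t * Q t \<delta>"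
      using Phi_near_F[OF t(1,2) sw] by (simp add: Q_def y_def mult_ac)
    also have "Q t \<delta> = Q t 0 + S_bd 1 * nB * (nB * cV / m) * \<delta>"
      by (simp add: Q_def add_divide_distrib distrib_left algebra_simps)
    also have "\<dots> \<le> Q t 0 + R * \<delta>" using \<delta>(1) by (simp add: R_def algebra_simps)
    also have "\<dots> < 2 * \<epsilon> / 3" using Qt \<delta>(2) by simp
    finally have 1: "norm (Phi t w - S t w - ?I) < t * (2 * \<epsilon> / 3)" using t by simp
    have "?I - t *\<^sub>R y = integral {0..t} (\<lambda>s. S (t - s) y - y)"
      using t Henstock_Kurzweil_Integration.integral_diff[OF I_int integrable_const_ivl, of y] by simp
    also have "norm \<dots> \<le> integral {0..t} (\<lambda>s. \<epsilon> / 3)"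
      by (rule integral_norm_bound_integral) (use I_int sy in \<open>auto intro!: integrable_diff\<close>)
    also have "\<dots> = t * (\<epsilon> / 3)" using t by simp
    finally have 2: "norm (?I - t *\<^sub>R y) \<le> t * (\<epsilon> / 3)" .
    define x where "x = Phi t w - S t w - t *\<^sub>R y"
    have "norm x < t * \<epsilon>"
      unfolding x_def using norm_triangle_ineq[of "Phi t w - S t w - ?I" "?I - t *\<^sub>R y"] 1 2 by (simp add: algebra_simps)
    then have "norm (x /\<^sub>R t) < \<epsilon>" using t by (simp add: field_simps)
    moreover have "(Phi t w - S t w) /\<^sub>R t - y = x /\<^sub>R t"
      using t by (simp add: x_def scaleR_diff_right)
    ultimately show ?case by (simp add: dist_norm y_def[symmetric])
  qed
qed

text \<open>The two difference quotients differ by a term that converges for every \<open>x\<close>,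
  so they converge for the same \<open>x\<close>; hence both generators have the domain
  \<open>DA\<close>.\<close>

lemma Phi_generates:
  assumes gen: "generates DA A S"
  shows "generates DA (\<lambda>x. A x + B (F x)) Phi"
proof -
  have split: "(Phi h x - x) /\<^sub>R h = (S h x - x) /\<^sub>R h + (Phi h x - S h x) /\<^sub>R h" for h x
    by (simp add: scaleR_add_right[symmetric])
  have to: "((\<lambda>h. (Phi h x - x) /\<^sub>R h) \<longlongrightarrow> l + B (F x)) (at_right 0)"
    if "((\<lambda>h. (S h x - x) /\<^sub>R h) \<longlongrightarrow> l) (at_right 0)" for x l
    unfolding split using that by (rule tendsto_add[OF _ Phi_minus_S_derivative])
  have "((\<lambda>h. (S h x - x) /\<^sub>R h) \<longlongrightarrow> l - B (F x)) (at_right 0)"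
    if "((\<lambda>h. (Phi h x - x) /\<^sub>R h) \<longlongrightarrow> l) (at_right 0)" for x l
    using tendsto_diff[OF that Phi_minus_S_derivative[of x]] unfolding split by simp
  then have "(\<exists>l. ((\<lambda>h. (Phi h x - x) /\<^sub>R h) \<longlongrightarrow> l) (at_right 0))
    \<longleftrightarrow> (\<exists>l. ((\<lambda>h. (S h x - x) /\<^sub>R h) \<longlongrightarrow> l) (at_right 0))" for x
    using to by blast
  then show ?thesis using gen to Phi_c0 unfolding generates_def by auto
qed

lemma exp_stabilizable: "generates DA A S \<Longrightarrow> exp_stabilizable DA A B"
  unfolding exp_stabilizable_def
  using F_bounded_clinear Phi_generates Phi_exp_stable by blast

end

section \<open>Consequences of the turnpike property\<close>

lemma exponential_imp_measure_turnpike: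
  assumes "exponential_turnpike S B l xe ue"
  shows "measure_turnpike S B l xe ue"
  unfolding measure_turnpike_def
proof (intro allI impI)
  fix N and \<epsilon> :: real assume N: "bounded_neighborhood xe N \<and> \<epsilon> > 0"
  from assms[unfolded exponential_turnpike_def, rule_format, OF conjunct1[OF N]]
  obtain M k where M: "M > 0" and k: "k > 0"
    and turn: "\<forall>x0\<in>N. \<forall>T>0. \<exists>x u. optimal_pair S B l T x0 x u \<and>
      (\<forall>t\<in>{0..T}. norm (x t - xe) + norm (u t - ue) \<le> M * (exp (- k * t) + exp (- k * (T - t))))"
    by (elim exE conjE) (rule that)
  \<comment> \<open>Further than \<open>b\<close> from an end of the interval the corresponding
    exponential contributes at most \<open>\<epsilon> / 2\<close>. The maximum and the added 1 keep
    \<open>b\<close> positive when the logarithm is negative.\<close>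
  define b where "b = max 0 (ln (2 * M / \<epsilon>) / k) + 1"
  have b: "b > 0" by (simp add: b_def)
  have small: "M * exp (- k * s) \<le> \<epsilon> / 2" if "s > b" for s
  proof -
    have "ln (2 * M / \<epsilon>) / k \<le> s" using that by (simp add: b_def)
    then have "ln (2 * M / \<epsilon>) \<le> k * s" using k by (simp add: pos_divide_le_eq mult.commute)
    then have "exp (ln (2 * M / \<epsilon>)) \<le> exp (k * s)" by (simp only: exp_le_cancel_iff)
    then have "2 * M / \<epsilon> \<le> exp (k * s)" using M N by simp
    then have "2 * M \<le> \<epsilon> * exp (k * s)" using N by (simp add: pos_divide_le_eq mult.commute)
    then have "2 * M * exp (- k * s) \<le> \<epsilon> * exp (k * s) * exp (- k * s)" by (rule mult_right_mono) simp
    also have "\<dots> = \<epsilon>" by (simp add: mult.assoc exp_add[symmetric])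
    finally show ?thesis by simp
  qed
  show "\<exists>M>0. \<forall>x0\<in>N. \<forall>T>0. \<exists>x u. optimal_pair S B l T x0 x u \<and>
    measure lebesgue {t\<in>{0..T}. norm (x t - xe) + norm (u t - ue) > \<epsilon>} \<le> M"
  proof (intro exI[of _ "2 * b"] conjI ballI allI impI)
    fix x0 and T :: real assume x0: "x0 \<in> N" and T: "T > 0"
    obtain x u where opt: "optimal_pair S B l T x0 x u"
      and le: "\<And>t. t \<in> {0..T} \<Longrightarrow> norm (x t - xe) + norm (u t - ue) \<le> M * (exp (- k * t) + exp (- k * (T - t)))"
      using turn[rule_format, OF x0 T] by blast
    let ?A = "{t\<in>{0..T}. norm (x t - xe) + norm (u t - ue) > \<epsilon>}"
    have sub: "?A \<subseteq> {0..b} \<union> {T - b..T}"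
    proof
      fix t assume t: "t \<in> ?A"
      show "t \<in> {0..b} \<union> {T - b..T}"
      proof (rule ccontr)
        assume "t \<notin> {0..b} \<union> {T - b..T}"
        then have "t > b" "T - t > b" using t by auto
        then have "M * (exp (- k * t) + exp (- k * (T - t))) \<le> \<epsilon>"
          using small[of t] small[of "T - t"] by (simp add: distrib_left)
        then show False using le[of t] t by auto
      qed
    qed
    have "measure lebesgue ?A \<le> 2 * b"
    \<comment> \<open>By convention \<open>measure\<close> is 0 outside the sigma-algebra.\<close>
    proof (cases "?A \<in> sets lebesgue")
      case True
      have "measure lebesgue ?A \<le> measure lebesgue ({0..b} \<union> {T - b..T})"
        by (rule measure_mono_fmeasurable[OF sub True]) (intro fmeasurable.Un; simp)
      also have "\<dots> \<le> measure lebesgue {0..b} + measure lebesgue {T - b..T}"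
        by (rule measure_Un_le) auto
      also have "\<dots> = 2 * b" using b by simp
      finally show ?thesis .
    qed (use b in \<open>simp add: measure_notin_sets\<close>)
    then show "\<exists>x u. optimal_pair S B l T x0 x u \<and>
      measure lebesgue {t\<in>{0..T}. norm (x t - xe) + norm (u t - ue) > \<epsilon>} \<le> 2 * b"
      using opt by blast
  qed (use b in simp)
qed

text \<open>Because \<open>measure\<close> defaults to 0 on nonmeasurable sets, the turnpike bound
  carries information only together with this fact.\<close>

lemma superlevel_lmeasurable:
  assumes x: "x \<in> L2_controls T" and u: "u \<in> L2_controls T"
  shows "{t\<in>{0..T}. norm (x t - a) + norm (u t - b) > \<epsilon>} \<in> lmeasurable"
proof -
  have "strongly_measurable (lebesgue_on {0..T}) (\<lambda>t. norm (x t - a) + norm (u t - b))"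
    by (rule strongly_measurable_compose2[OF L2_measurable[OF x] L2_measurable[OF u]])
      (intro continuous_intros)
  then have g: "(\<lambda>t. norm (x t - a) + norm (u t - b)) \<in> borel_measurable (lebesgue_on {0..T})"
    by (rule strongly_measurable_imp_borel) simp
  have "{t \<in> space (lebesgue_on {0..T}). norm (x t - a) + norm (u t - b) > \<epsilon>} \<in> sets (lebesgue_on {0..T})"
    using g by measurable
  then have "{t\<in>{0..T}. norm (x t - a) + norm (u t - b) > \<epsilon>} \<in> sets lebesgue"
    by (simp add: sets_restrict_space_iff)
  then show ?thesis
    by (intro bounded_set_imp_lmeasurable) (auto intro: bounded_subset[of "{0..T}"])
qed

section \<open>Orbits through the domain of the generator\<close>

context c0_semigroup_loc
begin

text \<open>From the right derivative at 0 one gets both one-sided derivatives at \<open>s\<close>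
  by pulling out \<open>S a\<close> with \<open>a = min s t\<close>. For the left one
  \<open>a\<close> moves towards \<open>s\<close>, and continuity of \<open>S a y\<close>
  compensates.\<close>

lemma S_has_vector_derivative:
  assumes D: "((\<lambda>h. (S h x - x) /\<^sub>R h) \<longlongrightarrow> y) (at_right 0)" and s: "s \<in> {0..T}"
  shows "((\<lambda>t. S t x) has_vector_derivative S s y) (at s within {0..T})"
  unfolding has_vector_derivative_def has_derivative_within_alt
proof (intro conjI allI impI)
  show "bounded_linear (\<lambda>r. r *\<^sub>R S s y)" by (rule bounded_linear_scaleR_left)
  fix e :: real assume e: "e > 0"
  let ?M = "S_bd T"
  have M: "?M \<ge> 1" by (rule S_bd)
  have "e / (2 * ?M) > 0" using e M by simp
  then obtain d1 where d1: "d1 > 0" "\<And>h. 0 < h \<Longrightarrow> h < d1 \<Longrightarrow> dist ((S h x - x) /\<^sub>R h) y < e / (2 * ?M)"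
    using D[THEN tendstoD, of "e / (2 * ?M)"] unfolding eventually_at_right_field by blast
  obtain d2 where d2: "d2 > 0" "\<And>a. a \<in> {0..T} \<Longrightarrow> dist a s < d2 \<Longrightarrow> dist (S a y) (S s y) < e / 2"
    using S_continuous[of T y, unfolded continuous_on_iff] s e by (metis half_gt_zero)
  show "\<exists>d>0. \<forall>t\<in>{0..T}. norm (t - s) < d \<longrightarrow>
    norm (S t x - S s x - (t - s) *\<^sub>R S s y) \<le> e * norm (t - s)"
  proof (intro exI[of _ "min d1 d2"] conjI ballI impI)
    fix t assume t: "t \<in> {0..T}" "norm (t - s) < min d1 d2"
    show "norm (S t x - S s x - (t - s) *\<^sub>R S s y) \<le> e * norm (t - s)"
    proof (cases "t = s")
      case False
      define a where "a = min s t"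
      define h where "h = \<bar>t - s\<bar>"
      have h: "h > 0" "h < d1" using False t by (auto simp: h_def)
      have a: "a \<in> {0..T}" "dist a s < d2" using s t d2 by (auto simp: a_def dist_real_def)
      have ah: "S (a + h) x = S a (S h x)" using S_add[of a h x] a h by simp
      have quot: "S (a + h) x - S a x = h *\<^sub>R S a ((S h x - x) /\<^sub>R h)"
        using a h by (simp add: ah S_linear)
      have "norm (S a ((S h x - x) /\<^sub>R h) - S s y)
        \<le> norm (S a ((S h x - x) /\<^sub>R h - y)) + norm (S a y - S s y)"
        using norm_triangle_ineq[of "S a ((S h x - x) /\<^sub>R h - y)" "S a y - S s y"] a by (simp add: S_linear)
      also have "norm (S a ((S h x - x) /\<^sub>R h - y)) \<le> ?M * norm ((S h x - x) /\<^sub>R h - y)"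
        by (rule S_bd(2)[OF a(1)])
      also have "\<dots> \<le> ?M * (e / (2 * ?M))"
        using d1(2)[OF h] M by (intro mult_left_mono) (auto simp: dist_norm)
      also have "\<dots> = e / 2" using M by simp
      also have "norm (S a y - S s y) \<le> e / 2" using d2(2)[OF a] by (simp add: dist_norm)
      finally have q: "norm (S a ((S h x - x) /\<^sub>R h) - S s y) \<le> e" by simp
      have "norm (S (a + h) x - S a x - h *\<^sub>R S s y) = h * norm (S a ((S h x - x) /\<^sub>R h) - S s y)"
        unfolding quot using h by (simp add: scaleR_diff_right[symmetric])
      also have "\<dots> \<le> h * e" using q h by (intro mult_left_mono) auto
      finally have fin: "norm (S (a + h) x - S a x - h *\<^sub>R S s y) \<le> e * h" by (simp add: mult.commute)
      show ?thesis
      proof (cases "s < t")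
        case True
        then show ?thesis using fin by (simp add: a_def h_def)
      next
        case lt: False
        then have eqs: "a = t" "h = s - t" "a + h = s" using False by (auto simp: a_def h_def)
        then have "S t x - S s x - (t - s) *\<^sub>R S s y = - (S (a + h) x - S a x - h *\<^sub>R S s y)"
          unfolding eqs(3) unfolding eqs(1,2) by (simp add: algebra_simps)
        then show ?thesis using fin by (simp only: norm_minus_cancel) (simp add: h_def)
      qed
    qed simp
  qed (use d1 d2 in simp)
qed

text \<open>The fundamental theorem of calculus for an orbit, with time reversed. It makes steady
  states constant mild solutions, since there \<open>B u = - A x\<close>.\<close>

lemma S_integral_generator:
  assumes D: "((\<lambda>h. (S h x - x) /\<^sub>R h) \<longlongrightarrow> y) (at_right 0)" and t: "0 \<le> t"
  shows "integral {0..t} (\<lambda>s. S (t - s) y) = S t x - x"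
proof -
  have "((\<lambda>s. S s y) has_integral (S t x - S 0 x)) {0..t}"
    by (rule fundamental_theorem_of_calculus[OF t S_has_vector_derivative[OF D]])
  then have "integral {0..t} (\<lambda>s. S s y) = S t x - x" by (simp add: integral_unique S_0)
  moreover have "integral {0..t} (\<lambda>s. S (t - s) y) = integral {-t..0} (\<lambda>s. S (- s) y)"
    using integral_shift_0[of "-t" 0 "\<lambda>s. S (- s) y"] by simp
  moreover have "integral {-t..0} (\<lambda>s. S (- s) y) = integral {0..t} (\<lambda>s. S s y)"
    using Henstock_Kurzweil_Integration.integral_reflect_real[of t 0 "\<lambda>s. S s y"] by simp
  ultimately show ?thesis by simp
qed

end

text \<open>Makes the midpoint and the difference of two steady states available as steady
  states.\<close>

lemma generates_lincomb:
  assumes gen: "generates DA A S" and x: "x \<in> DA" and y: "y \<in> DA"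
  shows "a *\<^sub>R x + b *\<^sub>R y \<in> DA" "A (a *\<^sub>R x + b *\<^sub>R y) = a *\<^sub>R A x + b *\<^sub>R A y"
proof -
  have lin: "bounded_linear (S h)" if "h > 0" for h
    using gen that by (simp add: generates_def c0_semigroup_def bounded_clinear_def)
  let ?w = "a *\<^sub>R x + b *\<^sub>R y"
  have "((\<lambda>h. a *\<^sub>R ((S h x - x) /\<^sub>R h) + b *\<^sub>R ((S h y - y) /\<^sub>R h)) \<longlongrightarrow> a *\<^sub>R A x + b *\<^sub>R A y) (at_right 0)"
    using gen x y unfolding generates_def by (intro tendsto_intros) auto
  moreover have "\<forall>\<^sub>F h in at_right 0. a *\<^sub>R ((S h x - x) /\<^sub>R h) + b *\<^sub>R ((S h y - y) /\<^sub>R h) = (S h ?w - ?w) /\<^sub>R h"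
    using eventually_at_right_less[of "0::real"]
  proof eventually_elim
    case (elim h)
    show ?case by (simp add: linear_simps[OF lin[OF elim]] algebra_simps)
  qed
  ultimately have lim: "((\<lambda>h. (S h ?w - ?w) /\<^sub>R h) \<longlongrightarrow> a *\<^sub>R A x + b *\<^sub>R A y) (at_right 0)"
    by (rule Lim_transform_eventually)
  then show w: "?w \<in> DA" using gen unfolding generates_def by blast
  have "((\<lambda>h. (S h ?w - ?w) /\<^sub>R h) \<longlongrightarrow> A ?w) (at_right 0)"
    using gen w unfolding generates_def by blast
  then show "A ?w = a *\<^sub>R A x + b *\<^sub>R A y"
    using tendsto_unique[OF trivial_limit_at_right_real _ lim] by blast
qed

section \<open>The inhomogeneous cost and the reduction to the homogeneous problem\<close>

locale lq_turnpike = lq_system S B C K m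
  for S :: "real \<Rightarrow> 'h::chilbert_space \<Rightarrow> 'h" and B :: "'u::chilbert_space \<Rightarrow> 'h"
    and C :: "'h \<Rightarrow> 'y::chilbert_space" and K :: "'u \<Rightarrow> 'u" and m :: real +
  fixes DA :: "'h set" and A :: "'h \<Rightarrow> 'h" and z xe :: 'h and v ue :: 'u
  assumes gen: "generates DA A S" and steady: "(xe, ue) \<in> steady_states DA A B"
    and turnpike: "measure_turnpike S B (running_cost C K z v) xe ue"
begin

abbreviation ell :: "'h \<Rightarrow> 'u \<Rightarrow> real" where "ell \<equiv> running_cost C K z v"

lemma ell_eq: "ell x u = C x \<bullet> C x + K u \<bullet> K u + 2 * (z \<bullet> x) + 2 * (v \<bullet> u)"
  by (simp add: running_cost_def Re_cinner dot_square_norm)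

definition lin :: "real \<Rightarrow> 'h \<Rightarrow> (real \<Rightarrow> 'u) \<Rightarrow> real" where
  "lin T w u = L2_inner T (\<lambda>_. z) (traj w u) + L2_inner T (\<lambda>_. v) u"

abbreviation J :: "real \<Rightarrow> 'h \<Rightarrow> (real \<Rightarrow> 'u) \<Rightarrow> real" where "J \<equiv> total_cost S B ell"

lemma ell_absolutely_integrable:
  assumes u: "u \<in> L2_controls T"
  shows "(\<lambda>t. ell (traj w u t) (u t)) absolutely_integrable_on {0..T}"
  unfolding ell_eq
  by (intro set_integral_add set_integrable_mult_right L2_absolutely_integrable_inner
      C_traj_L2 K_L2 traj_L2 L2_const u)

lemma J_eq_integral:
  assumes u: "u \<in> L2_controls T"
  shows "J T w u = integral {0..T} (\<lambda>t. ell (traj w u t) (u t))"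
proof -
  have "integrable (lebesgue_on {0..T}) (\<lambda>t. ell (traj w u t) (u t))"
    using ell_absolutely_integrable[OF u] by (simp add: integrable_restrict_space set_integrable_def)
  then show ?thesis unfolding total_cost_def by (rule lebesgue_integral_eq_integral) simp
qed

lemma J_eq:
  assumes u: "u \<in> L2_controls T"
  shows "J T w u = form T w u w u + 2 * lin T w u"
proof -
  note ints = L2_integrable_inner[OF C_traj_L2[OF u] C_traj_L2[OF u], of w w]
    L2_integrable_inner[OF K_L2[OF u] K_L2[OF u]]
    L2_integrable_inner[OF L2_const traj_L2[OF u], of z w] L2_integrable_inner[OF L2_const u, of v]
  have "J T w u = integral {0..T} (\<lambda>t. C (traj w u t) \<bullet> C (traj w u t) + K (u t) \<bullet> K (u t)
    + 2 * (z \<bullet> traj w u t) + 2 * (v \<bullet> u t))"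
    by (simp only: J_eq_integral[OF u] ell_eq)
  also have "\<dots> = form T w u w u + 2 * lin T w u"
    using ints by (simp add: Henstock_Kurzweil_Integration.integral_add integrable_add
        integrable_on_mult_right form_def lin_def L2_inner_def)
  finally show ?thesis .
qed

lemma lin_add:
  assumes u: "u \<in> L2_controls T" and h: "h \<in> L2_controls T"
  shows "lin T (w + w') (\<lambda>t. u t + h t) = lin T w u + lin T w' h"
proof -
  have "L2_inner T (\<lambda>_. z) (traj (w + w') (\<lambda>t. u t + h t)) = L2_inner T (\<lambda>_. z) (\<lambda>t. traj w u t + traj w' h t)"
  proof (rule L2_inner_cong)
    fix t assume t: "t \<in> {0..T}"
    then show "traj (w + w') (\<lambda>t. u t + h t) t = traj w u t + traj w' h t"
      using u h by (intro traj_add) (auto intro: L2_subset)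
  qed simp
  then show ?thesis
    by (simp add: lin_def L2_inner_add_right[OF _ _ L2_const] traj_L2 u h)
qed

lemma lin_scaleR: "lin T (c *\<^sub>R w) (\<lambda>t. c *\<^sub>R u t) = c * lin T w u"
proof -
  have "L2_inner T (\<lambda>_. z) (traj (c *\<^sub>R w) (\<lambda>t. c *\<^sub>R u t)) = L2_inner T (\<lambda>_. z) (\<lambda>t. c *\<^sub>R traj w u t)"
    by (rule L2_inner_cong) (simp_all add: traj_scaleR)
  then show ?thesis by (simp add: lin_def L2_inner_scaleR_right algebra_simps)
qed

lemma optimal_first_order:
  assumes opt: "optimal_pair S B ell T w x u" and h: "h \<in> L2_controls T"
  shows "form T w u 0 h + lin T 0 h = 0"
proof -
  have u: "u \<in> L2_controls T" and min: "\<And>w'. w' \<in> L2_controls T \<Longrightarrow> J T w u \<le> J T w w'"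
    using opt by (auto simp: optimal_pair_def)
  have "0 \<le> 0 + 2 * s * (form T w u 0 h + lin T 0 h) + s\<^sup>2 * form T 0 h 0 h" for s
  proof -
    have sh: "(\<lambda>t. s *\<^sub>R h t) \<in> L2_controls T" using h by (rule L2_scaleR)
    have ush: "(\<lambda>t. u t + s *\<^sub>R h t) \<in> L2_controls T" using u sh by (rule L2_add)
    have sc: "form T y g 0 (\<lambda>t. s *\<^sub>R h t) = s * form T y g 0 h" for y g
      using form_scaleR_right[of T y g s 0 h] by simp
    have sc': "form T 0 (\<lambda>t. s *\<^sub>R h t) y g = s * form T 0 h y g" for y g
      using form_scaleR_left[of T s 0 h y g] by simp
    have "form T w (\<lambda>t. u t + s *\<^sub>R h t) w (\<lambda>t. u t + s *\<^sub>R h t)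
      = form T w u w (\<lambda>t. u t + s *\<^sub>R h t) + form T 0 (\<lambda>t. s *\<^sub>R h t) w (\<lambda>t. u t + s *\<^sub>R h t)"
      using form_add_left[OF u sh ush, of w 0] by simp
    also have "\<dots> = form T w u w u + form T w u 0 (\<lambda>t. s *\<^sub>R h t)
      + (form T 0 (\<lambda>t. s *\<^sub>R h t) w u + form T 0 (\<lambda>t. s *\<^sub>R h t) 0 (\<lambda>t. s *\<^sub>R h t))"
      using form_add_right[OF u sh u, of w w 0] form_add_right[OF u sh sh, of 0 w 0] by simp
    also have "\<dots> = form T w u w u + 2 * s * form T w u 0 h + s\<^sup>2 * form T 0 h 0 h"
      by (simp add: sc sc' form_commute[of T 0 h w u] power2_eq_square)
    finally have "J T w (\<lambda>t. u t + s *\<^sub>R h t)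
      = J T w u + 2 * s * (form T w u 0 h + lin T 0 h) + s\<^sup>2 * form T 0 h 0 h"
      using lin_add[OF u sh, of w 0] lin_scaleR[of T s 0 h] by (simp add: J_eq u ush algebra_simps)
    then show ?thesis using min[OF ush] by simp
  qed
  from quadratic_nonneg_imp_discriminant[OF this form_nonneg] show ?thesis by simp
qed

text \<open>The linear term in the first order condition is \<open>lin T 0 h\<close>, which sees
  neither the initial state nor the control, so it cancels in the difference.\<close>

lemma optimal_diff_stationary:
  assumes "optimal_pair S B ell T w x u" "optimal_pair S B ell T w' x' u'"
  shows "stationary T (w - w') (\<lambda>t. u t - u' t)"
proof -
  have u: "u \<in> L2_controls T" "u' \<in> L2_controls T" using assms by (auto simp: optimal_pair_def)
  show ?thesis unfolding stationary_def
    using optimal_first_order[OF assms(1)] optimal_first_order[OF assms(2)]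
    by (auto intro: L2_diff u simp: form_diff_left[OF u])
       (metis add_right_cancel diff_self)
qed

lemma bad_lmeasurable:
  assumes "optimal_pair S B ell T w x u"
  shows "{t\<in>{0..T}. norm (x t - xe) + norm (u t - ue) > \<epsilon>} \<in> lmeasurable"
  using assms unfolding optimal_pair_def by (intro superlevel_lmeasurable) (auto intro: traj_L2)

lemma turnpike_ball:
  assumes "r > 0" "\<epsilon> > 0"
  obtains M where "M > 0" "\<And>x0 T. norm (x0 - xe) \<le> r \<Longrightarrow> T > 0 \<Longrightarrow>
    \<exists>x u. optimal_pair S B ell T x0 x u \<and>
      measure lebesgue {t\<in>{0..T}. norm (x t - xe) + norm (u t - ue) > \<epsilon>} \<le> M"
proof -
  have "bounded_neighborhood xe (cball xe r)"
    using assms ball_subset_cball by (auto simp: bounded_neighborhood_def mem_interior)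
  from turnpike[unfolded measure_turnpike_def, rule_format, OF conjI, OF this assms(2)]
  obtain M where "M > 0" and M: "\<forall>x0\<in>cball xe r. \<forall>T>0. \<exists>x u. optimal_pair S B ell T x0 x u \<and>
      measure lebesgue {t\<in>{0..T}. norm (x t - xe) + norm (u t - ue) > \<epsilon>} \<le> M"
    by (elim exE conjE) (rule that)
  from this(1) show ?thesis
  proof (rule that)
    fix x0 and T :: real assume "norm (x0 - xe) \<le> r" "T > 0"
    then show "\<exists>x u. optimal_pair S B ell T x0 x u \<and>
      measure lebesgue {t\<in>{0..T}. norm (x t - xe) + norm (u t - ue) > \<epsilon>} \<le> M"
      using M[rule_format, of x0 T] by (simp add: dist_norm norm_minus_commute)
  qed
qed

lemma (in -) not_covered:
  assumes "A1 \<in> lmeasurable" "A2 \<in> lmeasurable" "measure lebesgue A1 + measure lebesgue A2 < b - a"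
  obtains t where "t \<in> {a..b}" "t \<notin> A1" "t \<notin> A2"
proof -
  have "\<not> {a..b} \<subseteq> A1 \<union> A2"
  proof
    assume sub: "{a..b} \<subseteq> A1 \<union> A2"
    have "measure lebesgue {a..b} \<le> measure lebesgue (A1 \<union> A2)"
      by (rule measure_mono_fmeasurable[OF sub]) (use assms in \<open>auto intro: fmeasurable.Un\<close>)
    also have "\<dots> \<le> measure lebesgue A1 + measure lebesgue A2"
      by (rule measure_Un_le) (use assms in \<open>auto simp: fmeasurableD\<close>)
    finally have "measure lebesgue {a..b} < b - a" using assms(3) by simp
    moreover have "measure lebesgue {a..b} \<ge> b - a" by (cases "a \<le> b") auto
    ultimately show False by simp
  qed
  then show ?thesis using that by blast
qed

text \<open>Compare the optimal pairs started at \<open>xe + w1\<close> and at \<open>xe\<close>,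
  where \<open>w1\<close> is \<open>w\<close> normalized: \<open>M\<close> is uniform on the unit
  ball around \<open>xe\<close>, and scaling back by \<open>norm w\<close> gives the estimate for
  every \<open>w\<close>.\<close>

lemma contractive: "\<exists>\<tau>. lq_contractive S B C K m \<tau>"
proof -
  obtain M where M: "M > 0" and turn: "\<And>x0 T. norm (x0 - xe) \<le> 1 \<Longrightarrow> T > 0 \<Longrightarrow>
    \<exists>x u. optimal_pair S B ell T x0 x u \<and>
      measure lebesgue {t\<in>{0..T}. norm (x t - xe) + norm (u t - ue) > 1 / 8} \<le> M"
    by (rule turnpike_ball[of 1 "1/8"]) auto
  \<comment> \<open>The window \<open>{1..\<tau>}\<close> has length \<open>2 * M + 1\<close>, more
    than two bad sets can cover, so both pairs are near the steady state at a common time.\<close>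
  define \<tau> where "\<tau> = 2 * M + 2"
  have key: "\<exists>u. stationary T w u \<and> (T \<ge> \<tau> \<longrightarrow> (\<exists>t\<in>{1..\<tau>}. norm (traj w u t) \<le> norm w / 4))"
    if T: "T > 0" for T w
  proof -
    \<comment> \<open>For \<open>w = 0\<close> division by 0 gives \<open>w1 = 0\<close>, as
      desired.\<close>
    define w1 where "w1 = w /\<^sub>R norm w"
    have w1: "norm w1 \<le> 1" "w = norm w *\<^sub>R w1"
      by (cases "w = 0"; simp add: w1_def)+
    have near1: "norm (xe + w1 - xe) \<le> 1" and near0: "norm (xe - xe) \<le> 1" using w1(1) by simp_all
    from turn[OF near1 T] obtain x u where o: "optimal_pair S B ell T (xe + w1) x u"
      and mu: "measure lebesgue {t\<in>{0..T}. norm (x t - xe) + norm (u t - ue) > 1 / 8} \<le> M"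
      by (elim exE conjE) (rule that)
    from turn[OF near0 T] obtain x0 u0 where o0: "optimal_pair S B ell T xe x0 u0"
      and mu0: "measure lebesgue {t\<in>{0..T}. norm (x0 t - xe) + norm (u0 t - ue) > 1 / 8} \<le> M"
      by (elim exE conjE) (rule that)
    define d where "d t = u t - u0 t" for t
    have st: "stationary T w1 d"
      using optimal_diff_stationary[OF o o0] by (simp add: d_def[abs_def])
    have "stationary T w (\<lambda>t. norm w *\<^sub>R d t)"
      using stationary_scaleR[OF st, of "norm w"] w1(2) by simp
    moreover have "\<exists>t\<in>{1..\<tau>}. norm (traj w (\<lambda>t. norm w *\<^sub>R d t) t) \<le> norm w / 4" if "T \<ge> \<tau>"
    proof -
      have sum: "measure lebesgue {t\<in>{0..T}. norm (x t - xe) + norm (u t - ue) > 1 / 8}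
        + measure lebesgue {t\<in>{0..T}. norm (x0 t - xe) + norm (u0 t - ue) > 1 / 8} < \<tau> - 1"
        using mu mu0 unfolding \<tau>_def by linarith
      obtain t where t: "t \<in> {1..\<tau>}" "t \<notin> {t\<in>{0..T}. norm (x t - xe) + norm (u t - ue) > 1 / 8}"
        "t \<notin> {t\<in>{0..T}. norm (x0 t - xe) + norm (u0 t - ue) > 1 / 8}"
        by (rule not_covered[OF bad_lmeasurable[OF o] bad_lmeasurable[OF o0] sum]) (rule that)
      then have tT: "t \<in> {0..T}" using that by auto
      have u: "u \<in> L2_controls t" "u0 \<in> L2_controls t" and xt: "x t = traj (xe + w1) u t" "x0 t = traj xe u0 t"
        using o o0 tT by (auto simp: optimal_pair_def intro: L2_subset)
      have "norm (x t - xe) + norm (u t - ue) \<le> 1 / 8" "norm (x0 t - xe) + norm (u0 t - ue) \<le> 1 / 8"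
        using t(2,3) tT by (simp_all add: not_less)
      then have near: "norm (x t - xe) \<le> 1 / 8" "norm (x0 t - xe) \<le> 1 / 8"
        using norm_ge_zero[of "u t - ue"] norm_ge_zero[of "u0 t - ue"] by linarith+
      have "traj w1 d t = x t - x0 t"
        using traj_diff[OF u, of "xe + w1" xe] tT by (simp add: xt d_def[abs_def])
      then have "norm (traj w1 d t) \<le> 1 / 4"
        using norm_triangle_ineq4[of "x t - xe" "x0 t - xe"] near by simp
      then have "norm w * norm (traj w1 d t) \<le> norm w * (1 / 4)" by (rule mult_left_mono) simp
      moreover have "traj w (\<lambda>t. norm w *\<^sub>R d t) t = norm w *\<^sub>R traj w1 d t"
        using traj_scaleR[of t "norm w" w1 d] w1(2) tT by simp
      ultimately show ?thesis using t(1) by (intro bexI[of _ t]) auto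
    qed
    ultimately show ?thesis by blast
  qed
  have "lq_contractive S B C K m \<tau>"
  proof unfold_locales
    show \<tau>: "1 \<le> \<tau>" using M by (simp add: \<tau>_def)
    show "\<exists>u. stationary T w u" if "0 < T" for T w
      using key[OF that, of w] by (elim exE conjE) (rule exI)
    show "\<exists>u. stationary T w u \<and> (\<exists>t\<in>{1..\<tau>}. norm (traj w u t) \<le> norm w / 4)"
      if "\<tau> \<le> T" for T w
    proof -
      have "0 < T" using that \<tau> by simp
      from key[OF this, of w] that show ?thesis by (simp only: simp_thms)
    qed
  qed
  then show ?thesis ..
qed

section \<open>Optimality and uniqueness of the steady state\<close>

lemma steady_traj:
  assumes "(x, u) \<in> steady_states DA A B" "0 \<le> t"
  shows "traj x (\<lambda>_. u) t = x"
proof -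
  have x: "x \<in> DA" "B u = - A x" using assms by (auto simp: steady_states_def eq_neg_iff_add_eq_0 add.commute)
  have D: "((\<lambda>h. (S h x - x) /\<^sub>R h) \<longlongrightarrow> A x) (at_right 0)"
    using gen x unfolding generates_def by blast
  have "integral {0..t} (\<lambda>s. S (t - s) (B u)) = integral {0..t} (\<lambda>s. - S (t - s) (A x))"
    by (rule integral_cong) (simp add: x(2) S_linear)
  also have "\<dots> = x - S t x" using S_integral_generator[OF D assms(2)] by simp
  finally show ?thesis by (simp add: mild_solution_def)
qed

text \<open>Bounds the growth since an earlier time at most \<tau> ago. Apart from the
  \<open>L2\<close> norm of the control, the constants depend on \<tau> but not on the
  horizon.\<close>

lemma traj_window:
  assumes q: "q \<in> L2_controls T" and s: "0 \<le> s" "s \<le> t" "t \<le> T" "t - s \<le> \<tau>"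
  shows "norm (traj w q t) \<le> S_bd \<tau> * (norm (traj w q s) + nB * (sqrt \<tau> * sqrt (L2_inner T q q)))"
proof -
  let ?q = "\<lambda>r. q (s + r)"
  have q': "?q \<in> L2_controls (t - s)" by (rule L2_sub[OF q]) (use s in auto)
  have qt: "q \<in> L2_controls t" using q s by (auto intro: L2_subset)
  have "L2_inner (t - s) ?q ?q \<le> L2_inner t q q"
    using L2_inner_split[OF qt qt s(1,2)] L2_inner_nonneg[of s q] by simp
  also have "\<dots> \<le> L2_inner T q q"
    using L2_inner_split[OF q q _ s(3)] s L2_inner_nonneg[of "T - t" "\<lambda>r. q (t + r)"] by simp
  finally have "sqrt (t - s) * sqrt (L2_inner (t - s) ?q ?q) \<le> sqrt \<tau> * sqrt (L2_inner T q q)"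
    using s L2_inner_nonneg by (intro mult_mono) auto
  then have int: "integral {0..t - s} (\<lambda>r. norm (?q r)) \<le> sqrt \<tau> * sqrt (L2_inner T q q)"
    using L2_integral_norm_le_sqrt[OF q'] s by simp
  have "norm (traj w q t) = norm (traj (traj w q s) ?q (t - s))"
    using traj_shift[OF q s(1), of "t - s" w] s by simp
  also have "\<dots> \<le> S_bd \<tau> * (norm (traj w q s) + nB * integral {0..t - s} (\<lambda>r. norm (?q r)))"
    by (rule traj_norm_le[OF q']) (use s in auto)
  also have "\<dots> \<le> S_bd \<tau> * (norm (traj w q s) + nB * (sqrt \<tau> * sqrt (L2_inner T q q)))"
    using int nB(1) S_bd(1)[of \<tau>] by (intro mult_left_mono add_left_mono) auto
  finally show ?thesis .
qed

text \<open>Bounds half the derivative of \<open>ell\<close> at \<open>(xe, ue)\<close>; the added 1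
  makes it positive, since it is divided by later.\<close>

definition cl :: real where
  "cl = nC * nC * norm xe + nK * nK * norm ue + norm z + norm v + 1"

lemma cl_pos: "cl > 0"
  unfolding cl_def using nC(1) nK(1) by (simp add: add_nonneg_pos)

lemma ell_lower: "ell (xe + p) (ue + q) \<ge> ell xe ue - 2 * cl * (norm p + norm q) + m * (norm q)\<^sup>2"
proof -
  have CC: "\<bar>C xe \<bullet> C p\<bar> \<le> nC * nC * norm xe * norm p"
    using Cauchy_Schwarz_ineq2[of "C xe" "C p"] mult_mono[OF nC(2)[of xe] nC(2)[of p]] nC(1)
    by (simp add: mult_ac)
  have KK: "\<bar>K ue \<bullet> K q\<bar> \<le> nK * nK * norm ue * norm q"
    using Cauchy_Schwarz_ineq2[of "K ue" "K q"] mult_mono[OF nK(2)[of ue] nK(2)[of q]] nK(1)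
    by (simp add: mult_ac)
  have zz: "\<bar>z \<bullet> p\<bar> \<le> norm z * norm p" and vv: "\<bar>v \<bullet> q\<bar> \<le> norm v * norm q"
    by (rule Cauchy_Schwarz_ineq2)+
  have "(nC * nC * norm xe + norm z) * norm p \<le> cl * norm p"
    unfolding cl_def using nC(1) nK(1) by (intro mult_right_mono) auto
  moreover have "(nK * nK * norm ue + norm v) * norm q \<le> cl * norm q"
    unfolding cl_def using nC(1) nK(1) by (intro mult_right_mono) auto
  ultimately have "\<bar>C xe \<bullet> C p\<bar> + \<bar>K ue \<bullet> K q\<bar> + \<bar>z \<bullet> p\<bar> + \<bar>v \<bullet> q\<bar> \<le> cl * (norm p + norm q)"
    using CC KK zz vv unfolding distrib_right distrib_left by linarith
  then have low: "- (cl * (norm p + norm q)) \<le> C xe \<bullet> C p + K ue \<bullet> K q + z \<bullet> p + v \<bullet> q"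
    by linarith
  have "ell (xe + p) (ue + q) = ell xe ue
    + 2 * (C xe \<bullet> C p + K ue \<bullet> K q + z \<bullet> p + v \<bullet> q) + (norm (C p))\<^sup>2 + (norm (K q))\<^sup>2"
    by (simp add: ell_eq C_linear K_linear power2_norm_eq_inner inner_simps inner_commute algebra_simps)
  moreover have "e - 2 * b + c \<le> e + 2 * s + d + k" if "- b \<le> s" "c \<le> k" "0 \<le> d"
    for e b c s d k :: real using that by linarith
  from this[OF low K_coercive[of q] zero_le_power2[of "norm (C p)"]]
  have "ell xe ue - 2 * (cl * (norm p + norm q)) + m * (norm q)\<^sup>2
    \<le> ell xe ue + 2 * (C xe \<bullet> C p + K ue \<bullet> K q + z \<bullet> p + v \<bullet> q) + (norm (C p))\<^sup>2 + (norm (K q))\<^sup>2" .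
  ultimately show ?thesis by (simp only: mult.assoc)
qed

text \<open>On the bad set the linear part of the cost is only bounded by the \<open>L\<^sup>2\<close> norm \<open>y\<close> of the deviation
  of the control, with a factor independent of \<open>T\<close>; the quadratic part of the cost absorbs it.\<close>

lemma steady_optimal_approx:
  assumes xu: "(x, u) \<in> steady_states DA A B" and \<epsilon>: "\<epsilon> > 0"
  shows "\<exists>D. \<forall>T>0. T * (ell xe ue - 2 * cl * \<epsilon> - ell x u) \<le> D"
proof -
  define \<rho> where "\<rho> = max \<epsilon> (norm (x - xe))"
  obtain M where M: "M > 0" and turn: "\<And>x0 T. norm (x0 - xe) \<le> norm (x - xe) + 1 \<Longrightarrow> T > 0 \<Longrightarrow>
    \<exists>X U. optimal_pair S B ell T x0 X U \<and>
      measure lebesgue {t\<in>{0..T}. norm (X t - xe) + norm (U t - ue) > \<epsilon>} \<le> M"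
    \<comment> \<open>The added 1 keeps the radius positive in the case
      \<open>x = xe\<close>.\<close>
    by (rule turnpike_ball[of "norm (x - xe) + 1" \<epsilon>]) (use \<epsilon> in \<open>auto simp: add_nonneg_pos\<close>)
  \<comment> \<open>A window of length \<open>M + 1\<close> is too long to consist of bad times
    only.\<close>
  define \<tau> where "\<tau> = M + 1"
  define R where "R = S_bd \<tau> * (1 + nB * sqrt \<tau>)"
  have R: "R \<ge> 0" unfolding R_def using S_bd(1)[of \<tau>] nB(1) M by (simp add: \<tau>_def)
  have \<rho>: "\<rho> > 0" using \<epsilon> by (simp add: \<rho>_def)
  \<comment> \<open>\<open>M\<close> times the part of \<open>Dy\<close> free of \<open>y\<close>,
    plus the remainder left when the part linear in \<open>y\<close> is absorbed by
    \<open>(m / 2) * y\<^sup>2\<close>.\<close>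
  define D where "D = M * (2 * cl\<^sup>2 / m + 2 * cl * (R * \<rho>)) + 2 * (M * cl * R)\<^sup>2 / m"
  have "T * (ell xe ue - 2 * cl * \<epsilon> - ell x u) \<le> D" if T: "T > 0" for T
  proof -
    obtain X U where opt: "optimal_pair S B ell T x X U"
      and mu: "measure lebesgue {t\<in>{0..T}. norm (X t - xe) + norm (U t - ue) > \<epsilon>} \<le> M"
      using turn[of x T, OF _ T] by auto
    define bad where "bad = {t\<in>{0..T}. norm (X t - xe) + norm (U t - ue) > \<epsilon>}"
    have bad: "bad \<in> lmeasurable" "measure lebesgue bad \<le> M"
      unfolding bad_def using bad_lmeasurable[OF opt] mu by auto
    have U: "U \<in> L2_controls T" and X: "X = traj x U" and min: "J T x U \<le> J T x (\<lambda>_. u)"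
      using opt L2_const[of u T] by (auto simp: optimal_pair_def)
    define q where "q t = U t - ue" for t
    have q: "q \<in> L2_controls T" unfolding q_def by (rule L2_diff[OF U L2_const])
    define p where "p = traj (x - xe) q"
    have p: "p t = X t - xe" if "t \<in> {0..T}" for t
      using traj_diff[of U t "\<lambda>_. ue" x xe] U L2_const[of ue t] that steady_traj[OF steady, of t]
      by (simp add: p_def X q_def[abs_def] L2_subset)
    define y where "y = sqrt (L2_inner T q q)"
    have y: "y \<ge> 0" "y\<^sup>2 = L2_inner T q q" using L2_inner_nonneg[of T q] by (simp_all add: y_def)
    have p_le: "norm (p t) \<le> R * (\<rho> + y)" if t: "t \<in> {0..T}" for t
    proof -
      \<comment> \<open>Early times are compared with time 0, where \<open>p\<close> is
        \<open>x - xe\<close>; later ones with a good time in the preceding window.\<close>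
      have "\<exists>s. 0 \<le> s \<and> s \<le> t \<and> t - s \<le> \<tau> \<and> norm (p s) \<le> \<rho>"
      proof (cases "t \<le> \<tau>")
        case True
        then show ?thesis using t by (intro exI[of _ 0]) (auto simp: p_def traj_0 \<rho>_def)
      next
        case False
        have "({} :: real set) \<in> lmeasurable" by simp
        from not_covered[OF bad(1) this, of t "t - \<tau>"]
        obtain s where s: "s \<in> {t - \<tau>..t}" "s \<notin> bad" using bad(2) by (auto simp: \<tau>_def)
        then have "norm (X s - xe) + norm (U s - ue) \<le> \<epsilon>"
          using t False by (auto simp: bad_def)
        then have "norm (X s - xe) \<le> \<epsilon>" using norm_ge_zero[of "U s - ue"] by linarith
        then have "norm (p s) \<le> \<epsilon>" using p[of s] s t False by auto
        then show ?thesis using s False by (intro exI[of _ s]) (auto simp: \<rho>_def)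
      qed
      then obtain s where s: "0 \<le> s" "s \<le> t" "t - s \<le> \<tau>" "norm (p s) \<le> \<rho>" by blast
      have "norm (p t) \<le> S_bd \<tau> * (norm (p s) + nB * (sqrt \<tau> * y))"
        unfolding p_def y_def by (rule traj_window[OF q]) (use s t in auto)
      also have "\<dots> \<le> S_bd \<tau> * ((1 + nB * sqrt \<tau>) * (\<rho> + y))"
      proof (rule mult_left_mono)
        have "0 \<le> nB * sqrt \<tau> * \<rho>" using nB(1) M \<rho> by (simp add: \<tau>_def)
        then show "norm (p s) + nB * (sqrt \<tau> * y) \<le> (1 + nB * sqrt \<tau>) * (\<rho> + y)"
          using s(4) y(1) by (simp add: algebra_simps)
      qed (use S_bd(1)[of \<tau>] in simp)
      finally show ?thesis by (simp add: R_def mult.assoc)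
    qed
    \<comment> \<open>The penalty density on the bad set. Half of the coercive term
      \<open>m * (norm (q t))\<^sup>2\<close> absorbs the linear term in \<open>q t\<close>, at the
      price \<open>2 * cl\<^sup>2 / m\<close>; the other half is saved for the integral
      \<open>y\<^sup>2\<close>. The last summand bounds the linear term in
      \<open>p t\<close>.\<close>
    define Dy where "Dy = 2 * cl\<^sup>2 / m + 2 * cl * (R * (\<rho> + y))"
    have Dy: "Dy \<ge> 0" unfolding Dy_def using cl_pos m_pos R \<rho> y by simp
    have low: "ell xe ue - 2 * cl * \<epsilon> + (m / 2) * (norm (q t))\<^sup>2 - Dy * indicat_real bad t \<le> ell (X t) (U t)"
      if t: "t \<in> {0..T}" for t
    proof -
      have base: "ell xe ue - 2 * cl * (norm (p t) + norm (q t)) + m * (norm (q t))\<^sup>2 \<le> ell (X t) (U t)"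
        using ell_lower[of "p t" "q t"] p[OF t] by (simp add: q_def)
      have q2: "0 \<le> (norm (q t))\<^sup>2 * m" using m_pos by simp
      show ?thesis
      proof (cases "t \<in> bad")
        case False
        then have "cl * (norm (p t) + norm (q t)) \<le> cl * \<epsilon>"
          using t p[OF t] cl_pos by (intro mult_left_mono) (auto simp: bad_def q_def)
        then show ?thesis using base False q2 by (simp add: algebra_simps)
      next
        case True
        have "0 \<le> (m * norm (q t) - 2 * cl)\<^sup>2 / (2 * m)" using m_pos by simp
        also have "\<dots> = (m / 2) * (norm (q t))\<^sup>2 - 2 * cl * norm (q t) + 2 * cl\<^sup>2 / m"
          using m_pos by (simp add: power2_eq_square field_simps)
        finally have a: "2 * cl * norm (q t) \<le> (m / 2) * (norm (q t))\<^sup>2 + 2 * cl\<^sup>2 / m" by simp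
        have b: "2 * cl * norm (p t) \<le> 2 * cl * (R * (\<rho> + y))"
          using p_le[OF t] cl_pos by (intro mult_left_mono) auto
        have "e - k + h - (d + c) \<le> e - (i + j) + (h + h)" if "j \<le> h + d" "i \<le> c" "0 \<le> k"
          for c d e h i j k :: real using that by linarith
        from this[OF a b, of "2 * cl * \<epsilon>" "ell xe ue"]
        have "ell xe ue - 2 * cl * \<epsilon> + (m / 2) * (norm (q t))\<^sup>2 - Dy
          \<le> ell xe ue - (2 * cl * norm (p t) + 2 * cl * norm (q t))
            + ((m / 2) * (norm (q t))\<^sup>2 + (m / 2) * (norm (q t))\<^sup>2)"
          using cl_pos \<epsilon> unfolding Dy_def by simp
        also have "\<dots> = ell xe ue - 2 * cl * (norm (p t) + norm (q t)) + m * (norm (q t))\<^sup>2"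
          by (simp add: distrib_left)
        also note base
        finally show ?thesis using True by simp
      qed
    qed
    have ind: "(indicat_real bad has_integral measure lebesgue bad) {0..T}"
    proof -
      have "bad \<inter> {0..T} = bad" by (auto simp: bad_def)
      then show ?thesis using integral_indicator[of bad "{0..T}"] integrable_on_indicator[of bad "{0..T}"] bad(1)
        by (simp add: has_integral_iff)
    qed
    have qsq: "((\<lambda>t. (norm (q t))\<^sup>2) has_integral y\<^sup>2) {0..T}"
      unfolding y L2_inner_self by (rule integrable_integral[OF L2_integrable_norm_sq[OF q]])
    have const: "((\<lambda>t. ell xe ue - 2 * cl * \<epsilon>) has_integral T * (ell xe ue - 2 * cl * \<epsilon>)) {0..T}"
      using has_integral_const_real[of "ell xe ue - 2 * cl * \<epsilon>" 0 T] T by simp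
    have int_low: "((\<lambda>t. ell xe ue - 2 * cl * \<epsilon> + (m / 2) * (norm (q t))\<^sup>2 - Dy * indicat_real bad t)
      has_integral (T * (ell xe ue - 2 * cl * \<epsilon>) + (m / 2) * y\<^sup>2 - Dy * measure lebesgue bad)) {0..T}"
      by (intro has_integral_diff has_integral_add has_integral_mult_right const qsq ind)
    have int_ell: "((\<lambda>t. ell (X t) (U t)) has_integral J T x U) {0..T}"
      using ell_absolutely_integrable[OF U, of x]
      unfolding X J_eq_integral[OF U] absolutely_integrable_on_def by (blast intro: integrable_integral)
    have lower: "T * (ell xe ue - 2 * cl * \<epsilon>) + (m / 2) * y\<^sup>2 - Dy * measure lebesgue bad \<le> J T x U"
      by (rule has_integral_le[OF int_low int_ell low])
    have upper: "J T x (\<lambda>_. u) = T * ell x u"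
    proof -
      have "J T x (\<lambda>_. u) = integral {0..T} (\<lambda>t. ell x u)"
        unfolding J_eq_integral[OF L2_const]
        by (rule integral_cong) (simp add: steady_traj[OF xu])
      then show ?thesis using T by simp
    qed
    have "Dy * measure lebesgue bad \<le> Dy * M" using bad(2) Dy by (rule mult_left_mono)
    also have "Dy * M = M * (2 * cl\<^sup>2 / m + 2 * cl * (R * \<rho>)) + 2 * (M * cl * R) * y"
      by (simp add: Dy_def algebra_simps)
    \<comment> \<open>Young's inequality spends the saved half; the penalty grows only linearly in
      \<open>y\<close>.\<close>
    also have "2 * (M * cl * R) * y \<le> (m / 2) * y\<^sup>2 + 2 * (M * cl * R)\<^sup>2 / m"
    proof -
      have "0 \<le> (m * y - 2 * (M * cl * R))\<^sup>2 / (2 * m)" using m_pos by simp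
      also have "\<dots> = (m / 2) * y\<^sup>2 - 2 * (M * cl * R) * y + 2 * (M * cl * R)\<^sup>2 / m"
        using m_pos by (simp add: power2_eq_square field_simps)
      finally show ?thesis by simp
    qed
    finally have "Dy * measure lebesgue bad \<le> D + (m / 2) * y\<^sup>2" by (simp add: D_def)
    then show ?thesis using lower upper min by (simp add: right_diff_distrib)
  qed
  then show ?thesis by blast
qed

lemma steady_optimal:
  assumes xu: "(x, u) \<in> steady_states DA A B"
  shows "ell xe ue \<le> ell x u"
proof (rule ccontr)
  assume neg: "\<not> ?thesis"
  define g where "g = ell xe ue - ell x u"
  have g: "g > 0" using neg by (simp add: g_def)
  \<comment> \<open>The loss \<open>2 * cl * \<epsilon>\<close> is then half of the supposed
    advantage \<open>g\<close>, so the left side of the approximate inequality grows linearly in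
    \<open>T\<close>.\<close>
  define \<epsilon> where "\<epsilon> = g / (4 * cl)"
  have \<epsilon>: "\<epsilon> > 0" "2 * cl * \<epsilon> = g / 2" using g cl_pos by (auto simp: \<epsilon>_def field_simps)
  obtain D where D: "\<And>T. T > 0 \<Longrightarrow> T * (ell xe ue - 2 * cl * \<epsilon> - ell x u) \<le> D"
    using steady_optimal_approx[OF xu \<epsilon>(1)] by blast
  have eq: "ell xe ue - 2 * cl * \<epsilon> - ell x u = g / 2" using \<epsilon>(2) by (simp add: g_def)
  have le: "T * (g / 2) \<le> D" if "T > 0" for T using D[OF that] unfolding eq .
  define T where "T = 2 * (\<bar>D\<bar> + 1) / g"
  have "T > 0" using g by (simp add: T_def)
  moreover have "T * (g / 2) = \<bar>D\<bar> + 1" using g by (simp add: T_def)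
  ultimately show False using le[of T] by linarith
qed

text \<open>Optimality tested at the midpoint forces \<open>C (x - xe) = 0\<close> and
  \<open>u = ue\<close>. Then \<open>x - xe\<close> is an unobservable equilibrium of
  \<open>S\<close>, and exponential decay leaves only 0.\<close>

lemma steady_unique:
  assumes xu: "(x, u) \<in> steady_states DA A B" and le: "ell x u \<le> ell xe ue"
    and stable: "exp_stable_on (unobservable_subspace S C) S"
  shows "x = xe \<and> u = ue"
proof -
  have dom: "x \<in> DA" "xe \<in> DA" and eqs: "A x = - B u" "A xe = - B ue"
    using xu steady by (auto simp: steady_states_def eq_neg_iff_add_eq_0)
  have comb: "(a *\<^sub>R x + b *\<^sub>R xe, a *\<^sub>R u + b *\<^sub>R ue) \<in> steady_states DA A B" for a b
    using generates_lincomb[OF gen dom, of a b] by (simp add: steady_states_def eqs B_linear)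
  have "ell xe ue \<le> ell ((1/2) *\<^sub>R x + (1/2) *\<^sub>R xe) ((1/2) *\<^sub>R u + (1/2) *\<^sub>R ue)"
    by (rule steady_optimal[OF comb])
  also have "\<dots> = ell x u / 2 + ell xe ue / 2 - (norm (C (x - xe)))\<^sup>2 / 4 - (norm (K (u - ue)))\<^sup>2 / 4"
    by (simp add: ell_eq C_linear K_linear power2_norm_eq_inner inner_simps inner_commute field_simps)
  finally have "(norm (C (x - xe)))\<^sup>2 + (norm (K (u - ue)))\<^sup>2 \<le> 0" using le by simp
  then have C0: "C (x - xe) = 0" and K0: "K (u - ue) = 0"
    using zero_le_power2[of "norm (C (x - xe))"] zero_le_power2[of "norm (K (u - ue))"]
    by (auto simp: sum_power2_le_zero_iff)
  have "m * (norm (u - ue))\<^sup>2 \<le> 0" using K_coercive[of "u - ue"] K0 by simp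
  then have u: "u = ue" using m_pos by (simp add: mult_le_0_iff)
  have "(x - xe, 0) \<in> steady_states DA A B" using comb[of 1 "-1"] u by simp
  then have S_eq: "S t (x - xe) = x - xe" if "0 \<le> t" for t
    using steady_traj[of "x - xe" 0 t] traj_zero_control[OF that] that by simp
  then have "x - xe \<in> unobservable_subspace S C" using C0 by (simp add: unobservable_subspace_def)
  moreover obtain M \<omega> where "M > 0" "\<omega> > 0"
    and st: "\<And>t y. t \<ge> 0 \<Longrightarrow> y \<in> unobservable_subspace S C \<Longrightarrow> norm (S t y) \<le> M * exp (- \<omega> * t) * norm y"
    using stable unfolding exp_stable_on_def by blast
  ultimately have bound: "norm (x - xe) \<le> M * exp (- \<omega> * t) * norm (x - xe)" if "t \<ge> 0" for t
    using st[OF that, of "x - xe"] S_eq[OF that] by simp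
  have "x - xe = 0"
  proof (rule ccontr)
    assume "x - xe \<noteq> 0"
    then have "1 \<le> M * exp (- \<omega> * t)" if "t \<ge> 0" for t using bound[OF that] by simp
    \<comment> \<open>At this time the decay factor, including \<open>M\<close>, is at most 1/2; the
      absolute value keeps the time nonnegative.\<close>
    from this[of "\<bar>ln (2 * M)\<bar> / \<omega>"] have "1 \<le> M * exp (- \<bar>ln (2 * M)\<bar>)" using \<open>\<omega> > 0\<close> by simp
    also have "\<dots> \<le> M * exp (- ln (2 * M))" using \<open>M > 0\<close> by (intro mult_left_mono) auto
    also have "\<dots> = 1 / 2" using \<open>M > 0\<close> by (simp add: exp_minus field_simps)
    finally show False by simp
  qed
  then show ?thesis using u by simp
qed

end

theorem theorem3p3:
  fixes S :: "real \<Rightarrow> 'h::chilbert_space \<Rightarrow> 'h"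
    and DA :: "'h set" and A :: "'h \<Rightarrow> 'h"
    and B :: "'u::chilbert_space \<Rightarrow> 'h"
    and C :: "'h \<Rightarrow> 'y::chilbert_space"
    and K :: "'u \<Rightarrow> 'u"
    and z xe :: 'h and v ue :: 'u
  assumes "generates DA A S"
    and "bounded_clinear B" and "bounded_clinear C" and "bounded_clinear K"
    and "coercive_op K"
    and "(xe, ue) \<in> steady_states DA A B"
    and "measure_turnpike S B (running_cost C K z v) xe ue \<or>
         exponential_turnpike S B (running_cost C K z v) xe ue"
  shows "exp_stable_on (unobservable_subspace S C) S
       \<and> (\<forall>p. is_arg_min (\<lambda>(x, u). running_cost C K z v x u)
                 (\<lambda>q. q \<in> steady_states DA A B) p \<longleftrightarrow> p = (xe, ue))
       \<and> exp_stabilizable DA A B"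
proof -
  obtain Kadj m where adj: "is_cadjoint K Kadj" and m: "m > 0"
    "\<And>u. Re (cinner (Kadj (K u)) u) \<ge> m * (norm u)\<^sup>2"
    using assms(5) unfolding coercive_op_def by blast
  have "m * (norm u)\<^sup>2 \<le> (norm (K u))\<^sup>2" for u
  proof -
    \<comment> \<open>Moving the adjoint across turns coercivity into a lower bound for
      \<open>norm (K u)\<close>, the form in which the locales use it.\<close>
    have "Re (cinner (Kadj (K u)) u) = K u \<bullet> K u"
      using adj unfolding is_cadjoint_def by (metis Re_cinner inner_commute)
    then show ?thesis using m(2)[of u] by (simp add: dot_square_norm)
  qed
  moreover have "measure_turnpike S B (running_cost C K z v) xe ue"
    using assms(7) exponential_imp_measure_turnpike by blast
  ultimately interpret lq_turnpike S B C K m DA A z xe v ue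
    using assms m(1) by unfold_locales (auto simp: generates_def)
  obtain \<tau> where "lq_contractive S B C K m \<tau>" using contractive by blast
  then interpret lq_contractive S B C K m \<tau> .
  have "is_arg_min (\<lambda>(x, u). ell x u) (\<lambda>q. q \<in> steady_states DA A B) p \<longleftrightarrow> p = (xe, ue)" for p
  proof (cases p)
    case (Pair x u)
    show ?thesis
    proof
      assume min: "is_arg_min (\<lambda>(x, u). ell x u) (\<lambda>q. q \<in> steady_states DA A B) p"
      then have "(x, u) \<in> steady_states DA A B" "ell x u \<le> ell xe ue"
        using steady unfolding is_arg_min_def Pair by (auto simp: not_less)
      then show "p = (xe, ue)" using steady_unique unobservable_exp_stable Pair by blast
    next
      assume "p = (xe, ue)"
      then show "is_arg_min (\<lambda>(x, u). ell x u) (\<lambda>q. q \<in> steady_states DA A B) p"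
        using steady steady_optimal unfolding is_arg_min_def by (auto simp: not_less)
    qed
  qed
  then show ?thesis using unobservable_exp_stable exp_stabilizable[OF gen] by blast
qed

end
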